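(* Let $F=\alpha\phi(\beta/\alpha)$, $\phi(s)=\pm s^{-m}(c+ds^2)^{(m+1)/2}$ with real constants $m,c,d$, be a properly Finslerian generalized $m$-Kropina metric on a conic subbundle $\mathcal A\subset TM$, with $n=\dim M>2$. Then $F$ is of Berwald type if and only if there exists a smooth vector field $f^i(x)$ on $M$ such that $$\mathring\nabla_ib_j=cm(f^kb_k)a_{ij}+(c+\epsilon d|b|^2)f_ib_j-(cm-\epsilon d|b|^2)b_if_j-\epsilon d(f^kb_k)b_ib_j .$$ In that case the affine connection of $F$ is given by $$\Gamma^k_{ij}=\mathring\Gamma^k_{ij}+a^{k\ell}\left(f_ih_{j\ell}+f_jh_{i\ell}-f_\ell h_{ij}\right),\qquad h_{ij}:=\epsilon d\,b_ib_j-cm\,a_{ij}.$$ Moreover, whenever $|b|^2\neq0$ and $c+\epsilon d|b|^2\neq0$, the vector field $f^i$ can be expressed explicitly as $$f_i=\frac{\partial_i\ln\big||b|^2\big|}{2(c+\epsilon d|b|^2)},$$ and in this case $df=0$ (i.e. the 1-form $f=f_i\,dx^i$ is closed).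
   Context: $M$ is a smooth manifold; coordinates $x^i$ induce coordinates $(x^i,y^i)$ on $TM$; $\partial_i=\partial/\partial x^i$, $\bar\partial_i=\partial/\partial y^i$. A conic subbundle $\mathcal A\subset TM$ is an open subset projecting onto $M$ and closed under $(x,y)\mapsto(x,\lambda y)$, $\lambda>0$. A Finsler metric on $\mathcal A$ is a smooth $F:\mathcal A\to\mathbb R$ with $F(x,\lambda y)=\lambda F(x,y)$ for $\lambda>0$ and $g_{ij}=\tfrac12\bar\partial_i\bar\partial_jF^2$ nondegenerate; put $L=F^2$. $F$ is properly Finslerian if there is no finite cover of $\mathcal A$ by sets on each of which $L$ is quadratic in $y$. The canonical nonlinear connection is $N^j_i=\tfrac14\bar\partial_i[g^{jk}(y^m\partial_m\bar\partial_kL-\partial_kL)]$; $F$ is of Berwald type if $N^k_i=\Gamma^k_{ij}(x)y^j$ on $\mathcal A$, and then $\Gamma^k_{ij}$ are the Christoffel symbols of a torsion-free affine connection on $M$, called the affine connection of $F$. $a_{ij}$ is a pseudo-Riemannian metric on $M$ with Levi-Civita connection $\mathring\nabla$ and Christoffel symbols $\mathring\Gamma^k_{ij}$, $b=b_i\,dx^i$ a smooth 1-form, $A=a_{ij}y^iy^j$, $\alpha=\sqrt{|A|}$, $\beta=b_iy^i$, $s=\beta/\alpha$, $\epsilon=\operatorname{sgn}(A)$, $|b|^2=a_{ij}b^ib^j$; indices are raised and lowered with $a_{ij}$. A generalized $m$-Kropina metric is a Finsler metric $F=\alpha\phi(\beta/\alpha)$ with $\phi(s)=\pm s^{-m}(c+ds^2)^{(m+1)/2}$,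 $m,c,d\in\mathbb R$ constant, where $\mathcal A$ is assumed to be contained in the subset of $TM$ where $\alpha\neq0$, $s>0$ and $c+ds^2>0$ (so that in particular $b$ is nowhere vanishing). The condition on $\mathring\nabla_ib_j$, in which $\epsilon$ occurs, is understood to hold for the values of $\epsilon$ attained on $\mathcal A$.
   Formalization: The "if" direction is stated only when no fibre of A over a point with |b|²=0 contains vectors of both signs of A, unless d=0; without this it is false (e.g. a=2du dv+dw², b=e^u du, m=-1/2, c=d=1). ε is read fibrewise. *)

theory Defs
  imports "HOL-Analysis.Analysis"
begin

section \<open>Smooth functions and partial derivatives\<close>

primrec Ck_on :: "nat \<Rightarrow> 'a::real_normed_vector set \<Rightarrow> ('a \<Rightarrow> 'b::real_normed_vector) \<Rightarrow> bool" where
  "Ck_on 0 S f \<longleftrightarrow> continuous_on S f"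
| "Ck_on (Suc k) S f \<longleftrightarrow>
     (\<forall>x\<in>S. f differentiable (at x)) \<and> (\<forall>v. Ck_on k S (\<lambda>x. frechet_derivative f (at x) v))"

text \<open>Used only for open \<open>S\<close> in finite-dimensional spaces, where it is the usual notion of a
  smooth function.\<close>

definition smooth_on :: "'a::real_normed_vector set \<Rightarrow> ('a \<Rightarrow> 'b::real_normed_vector) \<Rightarrow> bool" where
  "smooth_on S f \<longleftrightarrow> (\<forall>k. Ck_on k S f)"

definition partial :: "'n::finite \<Rightarrow> (real^'n \<Rightarrow> real) \<Rightarrow> real^'n \<Rightarrow> real" where
  "partial i f x = frechet_derivative f (at x) (axis i 1)"

section \<open>Smooth manifolds and tangent vectors\<close>

text \<open>A chart is a pair of a domain and a coordinate map. The manifold is the whole (Hausdorff,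
  second countable) type \<open>'m\<close>, of dimension \<open>CARD('n)\<close>; its smooth structure is given by a smooth
  atlas \<open>M\<close>, which is allowed, but not required, to be maximal.\<close>

type_synonym ('m, 'n) chart = "'m set \<times> ('m \<Rightarrow> real^'n)"

abbreviation chart_dom :: "('m, 'n) chart \<Rightarrow> 'm set" where
  "chart_dom \<kappa> \<equiv> fst \<kappa>"

abbreviation chart_map :: "('m, 'n) chart \<Rightarrow> 'm \<Rightarrow> real^'n" where
  "chart_map \<kappa> \<equiv> snd \<kappa>"

abbreviation chart_img :: "('m, 'n) chart \<Rightarrow> (real^'n) set" where
  "chart_img \<kappa> \<equiv> chart_map \<kappa> ` chart_dom \<kappa>"

abbreviation chart_inv :: "('m, 'n) chart \<Rightarrow> real^'n \<Rightarrow> 'm" where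
  "chart_inv \<kappa> \<equiv> inv_into (chart_dom \<kappa>) (chart_map \<kappa>)"

definition is_chart :: "('m::topological_space, 'n::finite) chart \<Rightarrow> bool" where
  "is_chart \<kappa> \<longleftrightarrow> open (chart_dom \<kappa>) \<and> open (chart_img \<kappa>) \<and>
     homeomorphism (chart_dom \<kappa>) (chart_img \<kappa>) (chart_map \<kappa>) (chart_inv \<kappa>)"

definition transition :: "('m, 'n) chart \<Rightarrow> ('m, 'n) chart \<Rightarrow> real^'n \<Rightarrow> real^'n" where
  "transition \<kappa> \<mu> = chart_map \<mu> \<circ> chart_inv \<kappa>"

definition smooth_atlas :: "('m::topological_space, 'n::finite) chart set \<Rightarrow> bool" where
  "smooth_atlas M \<longleftrightarrow> (\<forall>\<kappa>\<in>M. is_chart \<kappa>) \<and> (\<Union>\<kappa>\<in>M. chart_dom \<kappa>) = UNIV \<and>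
     (\<forall>\<kappa>\<in>M. \<forall>\<mu>\<in>M. smooth_on (chart_map \<kappa> ` (chart_dom \<kappa> \<inter> chart_dom \<mu>)) (transition \<kappa> \<mu>))"

text \<open>A tangent vector at \<open>p\<close> is the family of its components in all the charts around \<open>p\<close>, related by
  the Jacobians of the coordinate changes (and \<open>0\<close> at the irrelevant arguments).\<close>

type_synonym ('m, 'n) tvector = "('m, 'n) chart \<Rightarrow> real^'n"

definition tangent_space :: "('m, 'n::finite) chart set \<Rightarrow> 'm \<Rightarrow> ('m, 'n) tvector set" where
  "tangent_space M p = {v.
     (\<forall>\<kappa>. \<kappa> \<notin> M \<or> p \<notin> chart_dom \<kappa> \<longrightarrow> v \<kappa> = 0) \<and>
     (\<forall>\<kappa>\<in>M. \<forall>\<mu>\<in>M. p \<in> chart_dom \<kappa> \<and> p \<in> chart_dom \<mu> \<longrightarrow>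
        v \<mu> = frechet_derivative (transition \<kappa> \<mu>) (at (chart_map \<kappa> p)) (v \<kappa>))}"

text \<open>The tangent vector \<open>y\<^sup>i \<partial>\<^sub>i\<close> at the point with coordinates \<open>x\<close> in the chart \<open>\<kappa>\<close>. Hence
  \<open>(x, y) \<mapsto> (chart_inv \<kappa> x, tvec M \<kappa> x y)\<close> is the inverse of the chart of the tangent bundle
  induced by \<open>\<kappa>\<close>.\<close>

definition tvec :: "('m, 'n::finite) chart set \<Rightarrow> ('m, 'n) chart \<Rightarrow> real^'n \<Rightarrow> real^'n \<Rightarrow> ('m, 'n) tvector" where
  "tvec M \<kappa> x y = (\<lambda>\<mu>. if \<mu> \<in> M \<and> chart_inv \<kappa> x \<in> chart_dom \<mu>
     then frechet_derivative (transition \<kappa> \<mu>) (at x) y else 0)"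

section \<open>Tensor fields and connections\<close>

definition smooth_vector_field :: "('m, 'n::finite) chart set \<Rightarrow> ('m \<Rightarrow> ('m, 'n) tvector) \<Rightarrow> bool" where
  "smooth_vector_field M f \<longleftrightarrow> (\<forall>p. f p \<in> tangent_space M p) \<and>
     (\<forall>\<kappa>\<in>M. smooth_on (chart_img \<kappa>) (\<lambda>x. f (chart_inv \<kappa> x) \<kappa>))"

definition vcomp :: "('m \<Rightarrow> ('m, 'n) tvector) \<Rightarrow> ('m, 'n::finite) chart \<Rightarrow> real^'n \<Rightarrow> 'n \<Rightarrow> real" where
  "vcomp f \<kappa> x i = f (chart_inv \<kappa> x) \<kappa> $ i"

definition bcomp :: "('m, 'n) chart set \<Rightarrow> ('m \<Rightarrow> ('m, 'n) tvector \<Rightarrow> real) \<Rightarrow>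
    ('m, 'n::finite) chart \<Rightarrow> real^'n \<Rightarrow> 'n \<Rightarrow> real" where
  "bcomp M b \<kappa> x i = b (chart_inv \<kappa> x) (tvec M \<kappa> x (axis i 1))"

definition smooth_one_form :: "('m, 'n::finite) chart set \<Rightarrow> ('m \<Rightarrow> ('m, 'n) tvector \<Rightarrow> real) \<Rightarrow> bool" where
  "smooth_one_form M b \<longleftrightarrow> (\<forall>\<kappa>\<in>M.
     (\<forall>x\<in>chart_img \<kappa>. linear (\<lambda>y. b (chart_inv \<kappa> x) (tvec M \<kappa> x y))) \<and>
     (\<forall>i. smooth_on (chart_img \<kappa>) (\<lambda>x. bcomp M b \<kappa> x i)))"

definition bilinear_forms :: "('m, 'n::finite) chart set \<Rightarrow>
    ('m \<Rightarrow> ('m, 'n) tvector \<Rightarrow> ('m, 'n) tvector \<Rightarrow> real) \<Rightarrow> bool" where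
  "bilinear_forms M a \<longleftrightarrow> (\<forall>\<kappa>\<in>M. \<forall>x\<in>chart_img \<kappa>.
     bilinear (\<lambda>y z. a (chart_inv \<kappa> x) (tvec M \<kappa> x y) (tvec M \<kappa> x z)))"

definition acomp :: "('m, 'n) chart set \<Rightarrow>
    ('m \<Rightarrow> ('m, 'n) tvector \<Rightarrow> ('m, 'n) tvector \<Rightarrow> real) \<Rightarrow>
    ('m, 'n::finite) chart \<Rightarrow> real^'n \<Rightarrow> 'n \<Rightarrow> 'n \<Rightarrow> real" where
  "acomp M a \<kappa> x i j = a (chart_inv \<kappa> x) (tvec M \<kappa> x (axis i 1)) (tvec M \<kappa> x (axis j 1))"

definition pseudo_riemannian_metric :: "('m, 'n::finite) chart set \<Rightarrow>
    ('m \<Rightarrow> ('m, 'n) tvector \<Rightarrow> ('m, 'n) tvector \<Rightarrow> real) \<Rightarrow> bool" where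
  "pseudo_riemannian_metric M a \<longleftrightarrow> bilinear_forms M a \<and>
     (\<forall>p. \<forall>v\<in>tangent_space M p. \<forall>w\<in>tangent_space M p. a p v w = a p w v) \<and>
     (\<forall>p. \<forall>v\<in>tangent_space M p. (\<forall>w\<in>tangent_space M p. a p v w = 0) \<longrightarrow> v = (\<lambda>\<kappa>. 0)) \<and>
     (\<forall>\<kappa>\<in>M. \<forall>i j. smooth_on (chart_img \<kappa>) (\<lambda>x. acomp M a \<kappa> x i j))"

definition ainv :: "('m, 'n) chart set \<Rightarrow>
    ('m \<Rightarrow> ('m, 'n) tvector \<Rightarrow> ('m, 'n) tvector \<Rightarrow> real) \<Rightarrow>
    ('m, 'n::finite) chart \<Rightarrow> real^'n \<Rightarrow> 'n \<Rightarrow> 'n \<Rightarrow> real" where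
  "ainv M a \<kappa> x i j = matrix_inv (\<chi> k l. acomp M a \<kappa> x k l) $ i $ j"

text \<open>Connection coefficients are written with the upper index first: \<open>\<Gamma> k i j\<close> is
  \<open>\<Gamma>\<^sup>k\<^sub>i\<^sub>j\<close>.\<close>

definition christoffel :: "('m, 'n) chart set \<Rightarrow>
    ('m \<Rightarrow> ('m, 'n) tvector \<Rightarrow> ('m, 'n) tvector \<Rightarrow> real) \<Rightarrow>
    ('m, 'n::finite) chart \<Rightarrow> real^'n \<Rightarrow> 'n \<Rightarrow> 'n \<Rightarrow> 'n \<Rightarrow> real" where
  "christoffel M a \<kappa> x k i j = 1/2 * (\<Sum>l\<in>UNIV. ainv M a \<kappa> x k l *
     (partial i (\<lambda>x. acomp M a \<kappa> x j l) x + partial j (\<lambda>x. acomp M a \<kappa> x i l) x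
      - partial l (\<lambda>x. acomp M a \<kappa> x i j) x))"

text \<open>\<open>nabla M a b \<kappa> x i j\<close> is the component \<open>\<nabla>\<^sub>i b\<^sub>j\<close> with respect to the Levi-Civita connection of
  \<open>a\<close>.\<close>

definition nabla :: "('m, 'n) chart set \<Rightarrow>
    ('m \<Rightarrow> ('m, 'n) tvector \<Rightarrow> ('m, 'n) tvector \<Rightarrow> real) \<Rightarrow> ('m \<Rightarrow> ('m, 'n) tvector \<Rightarrow> real) \<Rightarrow>
    ('m, 'n::finite) chart \<Rightarrow> real^'n \<Rightarrow> 'n \<Rightarrow> 'n \<Rightarrow> real" where
  "nabla M a b \<kappa> x i j = partial i (\<lambda>x. bcomp M b \<kappa> x j) x
     - (\<Sum>k\<in>UNIV. christoffel M a \<kappa> x k i j * bcomp M b \<kappa> x k)"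

definition bnorm2 :: "('m, 'n) chart set \<Rightarrow>
    ('m \<Rightarrow> ('m, 'n) tvector \<Rightarrow> ('m, 'n) tvector \<Rightarrow> real) \<Rightarrow> ('m \<Rightarrow> ('m, 'n) tvector \<Rightarrow> real) \<Rightarrow>
    ('m, 'n::finite) chart \<Rightarrow> real^'n \<Rightarrow> real" where
  "bnorm2 M a b \<kappa> x = (\<Sum>i\<in>UNIV. \<Sum>j\<in>UNIV. ainv M a \<kappa> x i j * bcomp M b \<kappa> x i * bcomp M b \<kappa> x j)"

definition vlower :: "('m, 'n) chart set \<Rightarrow>
    ('m \<Rightarrow> ('m, 'n) tvector \<Rightarrow> ('m, 'n) tvector \<Rightarrow> real) \<Rightarrow> ('m \<Rightarrow> ('m, 'n) tvector) \<Rightarrow>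
    ('m, 'n::finite) chart \<Rightarrow> real^'n \<Rightarrow> 'n \<Rightarrow> real" where
  "vlower M a f \<kappa> x i = (\<Sum>j\<in>UNIV. acomp M a \<kappa> x i j * vcomp f \<kappa> x j)"

definition pairing :: "('m, 'n) chart set \<Rightarrow> ('m \<Rightarrow> ('m, 'n) tvector \<Rightarrow> real) \<Rightarrow>
    ('m \<Rightarrow> ('m, 'n) tvector) \<Rightarrow> ('m, 'n::finite) chart \<Rightarrow> real^'n \<Rightarrow> real" where
  "pairing M b f \<kappa> x = (\<Sum>k\<in>UNIV. vcomp f \<kappa> x k * bcomp M b \<kappa> x k)"

definition torsion_free_affine_connection :: "('m, 'n::finite) chart set \<Rightarrow>
    (('m, 'n) chart \<Rightarrow> real^'n \<Rightarrow> 'n \<Rightarrow> 'n \<Rightarrow> 'n \<Rightarrow> real) \<Rightarrow> bool" where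
  "torsion_free_affine_connection M \<Gamma> \<longleftrightarrow>
     (\<forall>\<kappa>\<in>M. \<forall>k i j. smooth_on (chart_img \<kappa>) (\<lambda>x. \<Gamma> \<kappa> x k i j) \<and>
        (\<forall>x\<in>chart_img \<kappa>. \<Gamma> \<kappa> x k i j = \<Gamma> \<kappa> x k j i)) \<and>
     (\<forall>\<kappa>\<in>M. \<forall>\<mu>\<in>M. \<forall>x\<in>chart_map \<kappa> ` (chart_dom \<kappa> \<inter> chart_dom \<mu>). \<forall>c i j.
        let X = transition \<kappa> \<mu>; J = (\<lambda>a i. partial i (\<lambda>x. X x $ a) x) in
        (\<Sum>k\<in>UNIV. \<Gamma> \<kappa> x k i j * J c k) =
          partial i (\<lambda>x. partial j (\<lambda>x. X x $ c) x) x
          + (\<Sum>a\<in>UNIV. \<Sum>b\<in>UNIV. \<Gamma> \<mu> (X x) c a b * J a i * J b j))"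

section \<open>Finsler metrics\<close>

text \<open>The coordinate expression in the chart \<open>\<kappa>\<close> of a subset of the tangent bundle.\<close>

definition chart_cone :: "('m, 'n::finite) chart set \<Rightarrow> ('m \<times> ('m, 'n) tvector) set \<Rightarrow>
    ('m, 'n) chart \<Rightarrow> ((real^'n) \<times> (real^'n)) set" where
  "chart_cone M A \<kappa> = {(x, y). x \<in> chart_img \<kappa> \<and> (chart_inv \<kappa> x, tvec M \<kappa> x y) \<in> A}"

definition conic_subbundle :: "('m, 'n::finite) chart set \<Rightarrow> ('m \<times> ('m, 'n) tvector) set \<Rightarrow> bool" where
  "conic_subbundle M A \<longleftrightarrow> A \<subseteq> (SIGMA p:UNIV. tangent_space M p) \<and>
     (\<forall>\<kappa>\<in>M. open (chart_cone M A \<kappa>)) \<and> fst ` A = UNIV \<and>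
     (\<forall>(p, v)\<in>A. \<forall>r>0. (p, \<lambda>\<kappa>. r *\<^sub>R v \<kappa>) \<in> A)"

definition Fcomp :: "('m, 'n::finite) chart set \<Rightarrow> ('m \<Rightarrow> ('m, 'n) tvector \<Rightarrow> real) \<Rightarrow>
    ('m, 'n) chart \<Rightarrow> real^'n \<Rightarrow> real^'n \<Rightarrow> real" where
  "Fcomp M F \<kappa> x y = F (chart_inv \<kappa> x) (tvec M \<kappa> x y)"

definition Lcomp :: "('m, 'n::finite) chart set \<Rightarrow> ('m \<Rightarrow> ('m, 'n) tvector \<Rightarrow> real) \<Rightarrow>
    ('m, 'n) chart \<Rightarrow> real^'n \<Rightarrow> real^'n \<Rightarrow> real" where
  "Lcomp M F \<kappa> x y = (Fcomp M F \<kappa> x y)\<^sup>2"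

definition fundamental_tensor :: "('m, 'n::finite) chart set \<Rightarrow> ('m \<Rightarrow> ('m, 'n) tvector \<Rightarrow> real) \<Rightarrow>
    ('m, 'n) chart \<Rightarrow> real^'n \<Rightarrow> real^'n \<Rightarrow> real^'n^'n" where
  "fundamental_tensor M F \<kappa> x y =
     (\<chi> i j. 1/2 * partial i (\<lambda>y. partial j (\<lambda>y. Lcomp M F \<kappa> x y) y) y)"

definition finsler_metric :: "('m, 'n::finite) chart set \<Rightarrow> ('m \<times> ('m, 'n) tvector) set \<Rightarrow>
    ('m \<Rightarrow> ('m, 'n) tvector \<Rightarrow> real) \<Rightarrow> bool" where
  "finsler_metric M A F \<longleftrightarrow>
     (\<forall>\<kappa>\<in>M. smooth_on (chart_cone M A \<kappa>) (\<lambda>(x, y). Fcomp M F \<kappa> x y)) \<and>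
     (\<forall>(p, v)\<in>A. \<forall>r>0. F p (\<lambda>\<kappa>. r *\<^sub>R v \<kappa>) = r * F p v) \<and>
     (\<forall>\<kappa>\<in>M. \<forall>(x, y)\<in>chart_cone M A \<kappa>. invertible (fundamental_tensor M F \<kappa> x y))"

definition properly_finslerian :: "('m, 'n::finite) chart set \<Rightarrow> ('m \<times> ('m, 'n) tvector) set \<Rightarrow>
    ('m \<Rightarrow> ('m, 'n) tvector \<Rightarrow> real) \<Rightarrow> bool" where
  "properly_finslerian M A F \<longleftrightarrow> \<not> (\<exists>\<U>. finite \<U> \<and> \<Union>\<U> = A \<and>
     (\<forall>U\<in>\<U>. \<exists>Q. bilinear_forms M Q \<and> (\<forall>(p, v)\<in>U. (F p v)\<^sup>2 = Q p v v)))"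

text \<open>The canonical nonlinear connection; \<open>nonlinear_connection M F \<kappa> x y j i\<close> is
  \<open>N\<^sup>j\<^sub>i\<close>.\<close>

definition nonlinear_connection :: "('m, 'n::finite) chart set \<Rightarrow> ('m \<Rightarrow> ('m, 'n) tvector \<Rightarrow> real) \<Rightarrow>
    ('m, 'n) chart \<Rightarrow> real^'n \<Rightarrow> real^'n \<Rightarrow> 'n \<Rightarrow> 'n \<Rightarrow> real" where
  "nonlinear_connection M F \<kappa> x y j i = 1/4 * partial i (\<lambda>y.
     \<Sum>k\<in>UNIV. matrix_inv (fundamental_tensor M F \<kappa> x y) $ j $ k *
       ((\<Sum>m\<in>UNIV. y $ m * partial m (\<lambda>x. partial k (\<lambda>y. Lcomp M F \<kappa> x y) y) x)
        - partial k (\<lambda>x. Lcomp M F \<kappa> x y) x)) y"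

definition berwald_coefficients :: "('m, 'n::finite) chart set \<Rightarrow> ('m \<times> ('m, 'n) tvector) set \<Rightarrow>
    ('m \<Rightarrow> ('m, 'n) tvector \<Rightarrow> real) \<Rightarrow>
    (('m, 'n) chart \<Rightarrow> real^'n \<Rightarrow> 'n \<Rightarrow> 'n \<Rightarrow> 'n \<Rightarrow> real) \<Rightarrow> bool" where
  "berwald_coefficients M A F \<Gamma> \<longleftrightarrow> (\<forall>\<kappa>\<in>M. \<forall>(x, y)\<in>chart_cone M A \<kappa>. \<forall>k i.
     nonlinear_connection M F \<kappa> x y k i = (\<Sum>j\<in>UNIV. \<Gamma> \<kappa> x k i j * y $ j))"

definition berwald_type :: "('m, 'n::finite) chart set \<Rightarrow> ('m \<times> ('m, 'n) tvector) set \<Rightarrow>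
    ('m \<Rightarrow> ('m, 'n) tvector \<Rightarrow> real) \<Rightarrow> bool" where
  "berwald_type M A F \<longleftrightarrow> (\<exists>\<Gamma>. berwald_coefficients M A F \<Gamma>)"

definition affine_connection_of :: "('m, 'n::finite) chart set \<Rightarrow> ('m \<times> ('m, 'n) tvector) set \<Rightarrow>
    ('m \<Rightarrow> ('m, 'n) tvector \<Rightarrow> real) \<Rightarrow>
    (('m, 'n) chart \<Rightarrow> real^'n \<Rightarrow> 'n \<Rightarrow> 'n \<Rightarrow> 'n \<Rightarrow> real) \<Rightarrow> bool" where
  "affine_connection_of M A F \<Gamma> \<longleftrightarrow>
     torsion_free_affine_connection M \<Gamma> \<and> berwald_coefficients M A F \<Gamma>"

section \<open>Generalized m-Kropina metrics\<close>

text \<open>\<open>\<sigma> \<in> {1, -1}\<close> is the sign in front of \<open>\<phi>\<close>.\<close>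

definition kropina_phi :: "real \<Rightarrow> real \<Rightarrow> real \<Rightarrow> real \<Rightarrow> real \<Rightarrow> real" where
  "kropina_phi \<sigma> m c d s = \<sigma> * s powr (- m) * (c + d * s\<^sup>2) powr ((m + 1) / 2)"

definition generalized_kropina :: "('m \<times> ('m, 'n::finite) tvector) set \<Rightarrow>
    ('m \<Rightarrow> ('m, 'n) tvector \<Rightarrow> ('m, 'n) tvector \<Rightarrow> real) \<Rightarrow> ('m \<Rightarrow> ('m, 'n) tvector \<Rightarrow> real) \<Rightarrow>
    ('m \<Rightarrow> ('m, 'n) tvector \<Rightarrow> real) \<Rightarrow> real \<Rightarrow> real \<Rightarrow> real \<Rightarrow> real \<Rightarrow> bool" where
  "generalized_kropina A a b F \<sigma> m c d \<longleftrightarrow> \<sigma> \<in> {1, -1} \<and>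
     (\<forall>(p, v)\<in>A. let \<alpha> = sqrt \<bar>a p v v\<bar>; s = b p v / \<alpha> in
        \<alpha> \<noteq> 0 \<and> s > 0 \<and> c + d * s\<^sup>2 > 0 \<and> F p v = \<alpha> * kropina_phi \<sigma> m c d s)"

definition eps :: "('m, 'n) chart set \<Rightarrow>
    ('m \<Rightarrow> ('m, 'n) tvector \<Rightarrow> ('m, 'n) tvector \<Rightarrow> real) \<Rightarrow>
    ('m, 'n::finite) chart \<Rightarrow> real^'n \<Rightarrow> real^'n \<Rightarrow> real" where
  "eps M a \<kappa> x y = sgn (a (chart_inv \<kappa> x) (tvec M \<kappa> x y) (tvec M \<kappa> x y))"

text \<open>The condition on \<open>\<nabla>\<^sub>i b\<^sub>j\<close> is imposed at each point for each value of \<open>\<epsilon>\<close> attained in the fibre of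
  \<open>A\<close> over that point.\<close>

definition kropina_condition :: "('m, 'n::finite) chart set \<Rightarrow> ('m \<times> ('m, 'n) tvector) set \<Rightarrow>
    ('m \<Rightarrow> ('m, 'n) tvector \<Rightarrow> ('m, 'n) tvector \<Rightarrow> real) \<Rightarrow> ('m \<Rightarrow> ('m, 'n) tvector \<Rightarrow> real) \<Rightarrow>
    real \<Rightarrow> real \<Rightarrow> real \<Rightarrow> ('m \<Rightarrow> ('m, 'n) tvector) \<Rightarrow> bool" where
  "kropina_condition M A a b m c d f \<longleftrightarrow> (\<forall>\<kappa>\<in>M. \<forall>(x, y)\<in>chart_cone M A \<kappa>. \<forall>i j.
     let \<epsilon> = eps M a \<kappa> x y; B = bnorm2 M a b \<kappa> x; fb = pairing M b f \<kappa> x;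
         b' = bcomp M b \<kappa> x; f' = vlower M a f \<kappa> x in
     nabla M a b \<kappa> x i j =
       c * m * fb * acomp M a \<kappa> x i j
       + (c + \<epsilon> * d * B) * f' i * b' j
       - (c * m - \<epsilon> * d * B) * b' i * f' j
       - \<epsilon> * d * fb * b' i * b' j)"

definition kropina_h :: "('m, 'n) chart set \<Rightarrow>
    ('m \<Rightarrow> ('m, 'n) tvector \<Rightarrow> ('m, 'n) tvector \<Rightarrow> real) \<Rightarrow> ('m \<Rightarrow> ('m, 'n) tvector \<Rightarrow> real) \<Rightarrow>
    real \<Rightarrow> real \<Rightarrow> real \<Rightarrow> real \<Rightarrow> ('m, 'n::finite) chart \<Rightarrow> real^'n \<Rightarrow> 'n \<Rightarrow> 'n \<Rightarrow> real" where
  "kropina_h M a b m c d \<epsilon> \<kappa> x i j =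
     \<epsilon> * d * bcomp M b \<kappa> x i * bcomp M b \<kappa> x j - c * m * acomp M a \<kappa> x i j"

definition kropina_connection :: "('m, 'n) chart set \<Rightarrow>
    ('m \<Rightarrow> ('m, 'n) tvector \<Rightarrow> ('m, 'n) tvector \<Rightarrow> real) \<Rightarrow> ('m \<Rightarrow> ('m, 'n) tvector \<Rightarrow> real) \<Rightarrow>
    real \<Rightarrow> real \<Rightarrow> real \<Rightarrow> ('m \<Rightarrow> ('m, 'n) tvector) \<Rightarrow> real \<Rightarrow>
    ('m, 'n::finite) chart \<Rightarrow> real^'n \<Rightarrow> 'n \<Rightarrow> 'n \<Rightarrow> 'n \<Rightarrow> real" where
  "kropina_connection M a b m c d f \<epsilon> \<kappa> x k i j =
     (let h = kropina_h M a b m c d \<epsilon> \<kappa> x; f' = vlower M a f \<kappa> x in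
      christoffel M a \<kappa> x k i j
      + (\<Sum>l\<in>UNIV. ainv M a \<kappa> x k l * (f' i * h j l + f' j * h i l - f' l * h i j)))"

text \<open>A fibre of a conic subbundle need not be connected, so \<open>\<epsilon>\<close> may attain both signs in one fibre.
  If moreover \<open>|b|\<^sup>2 = 0\<close> and \<open>d \<noteq> 0\<close> there, the condition on \<open>\<nabla>\<^sub>i b\<^sub>j\<close> does not ensure that the
  connection coefficients obtained from the two signs agree. Example: \<open>a = 2 du dv + dw\<^sup>2\<close>,
  \<open>b = e\<^sup>u du\<close>, \<open>m = -1/2\<close>, \<open>c = d = 1\<close>, \<open>A = {\<beta> > 0, \<alpha> \<noteq> 0}\<close> and \<open>f\<^sub>i dx\<^sup>i = (2/3) du\<close> satisfy the
  condition for both signs, with \<open>\<Gamma>\<^sup>v\<^sub>u\<^sub>u = (2/3) \<epsilon> e\<^bsup>2u\<^esup>\<close> on the part of \<open>A\<close> with sign \<open>\<epsilon>\<close>,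
  so \<open>F\<close> is not of Berwald type on \<open>A\<close>.
  The following predicate excludes only such points; it holds in particular if \<open>\<epsilon>\<close> is constant on
  each fibre of \<open>A\<close>.\<close>

definition sign_consistent :: "('m, 'n::finite) chart set \<Rightarrow> ('m \<times> ('m, 'n) tvector) set \<Rightarrow>
    ('m \<Rightarrow> ('m, 'n) tvector \<Rightarrow> ('m, 'n) tvector \<Rightarrow> real) \<Rightarrow> ('m \<Rightarrow> ('m, 'n) tvector \<Rightarrow> real) \<Rightarrow>
    real \<Rightarrow> bool" where
  "sign_consistent M A a b d \<longleftrightarrow> (\<forall>\<kappa>\<in>M. \<forall>x y z.
     (x, y) \<in> chart_cone M A \<kappa> \<and> (x, z) \<in> chart_cone M A \<kappa> \<and> eps M a \<kappa> x y \<noteq> eps M a \<kappa> x z \<longrightarrow>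
     d = 0 \<or> bnorm2 M a b \<kappa> x \<noteq> 0)"

end

theory Submission
  imports Defs
begin

text \<open>On the part of \<open>A\<close> where \<open>a(y, y)\<close> has sign \<open>\<epsilon>\<close>, \<open>L = \<beta>\<^bsup>-2m\<^esup> P\<^bsup>m+1\<^esup>\<close> with
  \<open>P = c\<epsilon> a(y, y) + d\<beta>\<^sup>2\<close>. A Finsler metric is of Berwald type with coefficients \<open>\<Gamma>\<close> if and only if \<open>\<Gamma>\<close> is
  symmetric and \<open>L\<close> is constant along its horizontal lifts. For the above \<open>L\<close> this says that
  \<open>2mP D\<^sub>i\<beta> = (m+1)\<beta> D\<^sub>iP\<close>, where \<open>D\<close> is the covariant derivative of \<open>\<Gamma>\<close>. Both sides are cubic
  polynomials in \<open>y\<close>. As \<open>n > 2\<close>, the hyperplane \<open>\<beta> = 0\<close> is not isotropic, so \<open>\<beta>\<close> divides \<open>D\<^sub>i\<beta>\<close>,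
  say \<open>D\<^sub>ib\<^sub>j = c(m+1)f\<^sub>ib\<^sub>j\<close>, and then \<open>D\<^sub>ia\<^sub>j\<^sub>k = -2f\<^sub>ih\<^sub>j\<^sub>k\<close>. The second equation determines \<open>\<Gamma>\<close> as
  the Levi-Civita connection is determined by \<open>\<nabla>a = 0\<close>, and the first one then becomes the condition on
  \<open>\<nabla>\<^sub>ib\<^sub>j\<close>. Contracting that condition with \<open>b\<^sup>j\<close> gives \<open>\<partial>\<^sub>i|b|\<^sup>2 = 2(c + \<epsilon>d|b|\<^sup>2)|b|\<^sup>2f\<^sub>i\<close>. The fundamental
  tensor is degenerate if \<open>c = 0\<close> or \<open>m = -1\<close>, and \<open>L\<close> is quadratic for either sign if \<open>m = 0\<close>.\<close>

section \<open>Calculus of smooth functions\<close>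

text \<open>The obstacle is that a fibre of \<open>A\<close> may be disconnected and contain vectors
  of both signs. Arguments on L are therefore made on an open part of one fibre with a fixed sign.
  This suffices: parallelism there determines symmetric coefficients, and a cubic polynomial
  vanishing there vanishes identically, so that it may be evaluated on the hyperplane \<beta> = 0,
  which \<open>A\<close> does not meet. The field f is read off from D_i b_j, in which \<epsilon>
  does not occur, so one f serves both signs. It is smooth because \<Gamma> consists of second fibre
  derivatives of the spray, and it is a vector field because D_u \<beta> / \<beta> has the same
  value in all charts. The converse builds a connection for each sign. If both signs occur over a
  point with d |b|^2 different from 0, the two conditions force f = 0 there, so the connections
  agree. The values c = 0 and m = -1 are excluded because f arises by division by c (m + 1). For m =
  0 the cubic identity says nothing about D_i \<beta> on \<beta> = 0; proper Finslerianity excludes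
  that case.\<close>

abbreviation dird :: "('a::real_normed_vector \<Rightarrow> 'b::real_normed_vector) \<Rightarrow> 'a \<Rightarrow> 'a \<Rightarrow> 'b" where
  "dird f x v \<equiv> frechet_derivative f (at x) v"

section \<open>Locality of derivatives and of \<open>Ck_on\<close>\<close>

lemma has_derivative_dird:
  "f differentiable (at x) \<Longrightarrow> (f has_derivative dird f x) (at x)"
  by (simp add: frechet_derivative_works)

lemma dird_eqI: "(f has_derivative f') (at x) \<Longrightarrow> dird f x v = f' v"
  using frechet_derivative_at[of f f' x] by simp

lemma linear_dird: "f differentiable (at x) \<Longrightarrow> linear (dird f x)"
  by (rule linear_frechet_derivative)

lemma dird_cong:
  assumes "open S" "x \<in> S" "\<And>z. z \<in> S \<Longrightarrow> f z = g z"
  shows "dird f x = dird g x"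
proof -
  \<comment> \<open>\<open>frechet_derivative\<close> is a choice among all derivatives, so both
    functions must have the same set of derivatives; this also covers points where there is
    none.\<close>
  have "(f has_derivative F) (at x) \<longleftrightarrow> (g has_derivative F) (at x)" for F
    using has_derivative_transform_within_open[OF _ assms(1,2), of f F UNIV g]
      has_derivative_transform_within_open[OF _ assms(1,2), of g F UNIV f] assms(3) by auto
  then show ?thesis
    unfolding frechet_derivative_def by simp
qed

lemma differentiable_cong_open:
  assumes "open S" "x \<in> S" "\<And>z. z \<in> S \<Longrightarrow> f z = g z"
  shows "f differentiable (at x) \<longleftrightarrow> g differentiable (at x)"
proof -
  have "(f has_derivative F) (at x) \<longleftrightarrow> (g has_derivative F) (at x)" for F
    using has_derivative_transform_within_open[OF _ assms(1,2), of f F UNIV g]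
      has_derivative_transform_within_open[OF _ assms(1,2), of g F UNIV f] assms(3) by auto
  then show ?thesis
    unfolding differentiable_def by simp
qed

lemma Ck_on_cong:
  assumes "open S" "\<And>z. z \<in> S \<Longrightarrow> f z = g z"
  shows "Ck_on k S f \<longleftrightarrow> Ck_on k S g"
  using assms(2)
proof (induction k arbitrary: f g)
  case 0
  then show ?case by (simp cong: continuous_on_cong)
next
  case (Suc k)
  have "Ck_on k S (\<lambda>x. dird f x v) \<longleftrightarrow> Ck_on k S (\<lambda>x. dird g x v)" for v
    by (rule Suc.IH) (simp add: dird_cong[OF assms(1) _ Suc.prems])
  then show ?case
    using differentiable_cong_open[OF assms(1), of _ f g] Suc.prems by simp
qed

lemma Ck_on_transfer:
  "open S \<Longrightarrow> Ck_on k S g \<Longrightarrow> (\<And>z. z \<in> S \<Longrightarrow> f z = g z) \<Longrightarrow> Ck_on k S f"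
  using Ck_on_cong[of S f g k] by simp

text \<open>\<open>Ck_on (Suc k)\<close> does not mention continuity of f itself; at the base of the
  induction it comes from differentiability.\<close>

lemma Ck_on_SucD: "Ck_on (Suc k) S f \<Longrightarrow> Ck_on k S f"
proof (induction k arbitrary: f)
  case 0
  then have "f differentiable_on S"
    unfolding differentiable_on_def using differentiable_at_withinI by auto
  then show ?case
    by (simp add: differentiable_imp_continuous_on)
next
  case (Suc k)
  have "Ck_on (Suc k) S (\<lambda>x. dird f x v)" for v
    using Suc.prems by simp
  then have "Ck_on k S (\<lambda>x. dird f x v)" for v
    using Suc.IH by blast
  then show ?case using Suc.prems by simp
qed

text \<open>Derivatives are taken \<open>at x\<close>, not within the set, so the neighbourhood
  \<open>T\<close> may stick out of \<open>S\<close>.\<close>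

lemma Ck_on_local:
  assumes "\<And>x. x \<in> S \<Longrightarrow> \<exists>T. open T \<and> x \<in> T \<and> Ck_on k T f"
  shows "Ck_on k S f"
  using assms
proof (induction k arbitrary: f)
  case 0
  show ?case
    unfolding Ck_on.simps
  proof (rule continuous_at_imp_continuous_on, rule ballI)
    fix x assume "x \<in> S"
    then obtain T where "open T" "x \<in> T" "continuous_on T f"
      using 0 by auto
    then show "isCont f x"
      using continuous_on_eq_continuous_at by blast
  qed
next
  case (Suc k)
  have "Ck_on k S (\<lambda>x. dird f x v)" for v
    by (rule Suc.IH) (use Suc.prems in fastforce)
  then show ?case using Suc.prems by fastforce
qed

lemma smooth_on_cong:
  "open S \<Longrightarrow> (\<And>z. z \<in> S \<Longrightarrow> f z = g z) \<Longrightarrow> smooth_on S f \<longleftrightarrow> smooth_on S g"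
  by (simp add: smooth_on_def cong: Ck_on_cong)

lemma smooth_on_transfer:
  "open S \<Longrightarrow> smooth_on S g \<Longrightarrow> (\<And>z. z \<in> S \<Longrightarrow> f z = g z) \<Longrightarrow> smooth_on S f"
  using smooth_on_cong[of S f g] by simp

lemma smooth_on_local:
  assumes "\<And>x. x \<in> S \<Longrightarrow> \<exists>T. open T \<and> x \<in> T \<and> smooth_on T f"
  shows "smooth_on S f"
  unfolding smooth_on_def
proof
  show "Ck_on k S f" for k
    by (rule Ck_on_local) (use assms in \<open>auto simp: smooth_on_def\<close>)
qed

lemma smooth_on_dird: "smooth_on S f \<Longrightarrow> smooth_on S (\<lambda>x. dird f x v)"
  unfolding smooth_on_def
proof
  fix k
  assume "\<forall>k. Ck_on k S f"
  then have "Ck_on (Suc k) S f" ..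
  then show "Ck_on k S (\<lambda>x. dird f x v)" by simp
qed

lemma smooth_on_differentiable: "smooth_on S f \<Longrightarrow> x \<in> S \<Longrightarrow> f differentiable (at x)"
  unfolding smooth_on_def by (auto dest!: spec[of _ "Suc 0"])

lemma smooth_on_continuous_on: "smooth_on S f \<Longrightarrow> continuous_on S f"
  unfolding smooth_on_def by (auto dest!: spec[of _ 0])

section \<open>Closure properties of smooth functions\<close>

lemma Ck_on_const: "Ck_on k S (\<lambda>x. c)"
  by (induction k arbitrary: c) (auto simp: frechet_derivative_const)

lemma smooth_on_const: "smooth_on S (\<lambda>x. c)"
  by (simp add: smooth_on_def Ck_on_const)

lemma smooth_on_bounded_linear:
  assumes "bounded_linear f"
  shows "smooth_on S f"
proof -
  have d: "(f has_derivative f) (at x)" for x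
    using assms bounded_linear_imp_has_derivative by blast
  have "Ck_on k S f" for k
  proof (cases k)
    case 0
    then show ?thesis using assms by (simp add: linear_continuous_on)
  next
    case (Suc n)
    have "dird f x v = f v" for x v
      using dird_eqI[OF d] .
    then show ?thesis using d by (auto simp: Suc Ck_on_const differentiable_def)
  qed
  then show ?thesis by (simp add: smooth_on_def)
qed

lemma Ck_on_add:
  assumes "open S"
  shows "Ck_on k S f \<Longrightarrow> Ck_on k S g \<Longrightarrow> Ck_on k S (\<lambda>x. f x + g x)"
proof (induction k arbitrary: f g)
  case 0
  then show ?case by (auto intro: continuous_on_add)
next
  case (Suc k)
  have "Ck_on k S (\<lambda>x. dird (\<lambda>x. f x + g x) x v)" for v
  proof -
    have "dird (\<lambda>x. f x + g x) x v = dird f x v + dird g x v" if "x \<in> S" for x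
      by (rule dird_eqI) (use Suc.prems that in \<open>auto intro!: derivative_intros has_derivative_dird\<close>)
    then show ?thesis
      by (rule Ck_on_transfer[OF assms, rotated]) (use Suc in auto)
  qed
  then show ?case using Suc.prems by auto
qed

lemma (in bounded_bilinear) Ck_on_prod:
  assumes "open S"
  shows "Ck_on k S f \<Longrightarrow> Ck_on k S g \<Longrightarrow> Ck_on k S (\<lambda>x. prod (f x) (g x))"
proof (induction k arbitrary: f g)
  case 0
  then show ?case by (auto intro: continuous_on)
next
  case (Suc k)
  have *: "((\<lambda>x. prod (f x) (g x)) has_derivative
      (\<lambda>v. prod (f x) (dird g x v) + prod (dird f x v) (g x))) (at x)" if "x \<in> S" for x
    by (rule FDERIV) (use Suc.prems that in \<open>auto intro!: has_derivative_dird\<close>)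
  have "Ck_on k S (\<lambda>x. dird (\<lambda>x. prod (f x) (g x)) x v)" for v
  proof -
    have "Ck_on k S (\<lambda>x. prod (f x) (dird g x v) + prod (dird f x v) (g x))"
      using Suc.prems Ck_on_SucD[of k S f] Ck_on_SucD[of k S g]
      by (intro Ck_on_add assms Suc.IH) auto
    moreover have "dird (\<lambda>x. prod (f x) (g x)) x v = prod (f x) (dird g x v) + prod (dird f x v) (g x)"
      if "x \<in> S" for x
      using dird_eqI[OF *[OF that]] .
    ultimately show ?thesis
      by (rule Ck_on_transfer[OF assms])
  qed
  then show ?case using * by (auto simp: differentiable_def)
qed

lemma smooth_on_add:
  "open S \<Longrightarrow> smooth_on S f \<Longrightarrow> smooth_on S g \<Longrightarrow> smooth_on S (\<lambda>x. f x + g x)"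
  by (simp add: smooth_on_def Ck_on_add)

lemma smooth_on_mult:
  fixes f g :: "_ \<Rightarrow> real"
  shows "open S \<Longrightarrow> smooth_on S f \<Longrightarrow> smooth_on S g \<Longrightarrow> smooth_on S (\<lambda>x. f x * g x)"
  by (simp add: smooth_on_def bounded_bilinear.Ck_on_prod[OF bounded_bilinear_mult])

lemma smooth_on_scaleR:
  "open S \<Longrightarrow> smooth_on S f \<Longrightarrow> smooth_on S g \<Longrightarrow> smooth_on S (\<lambda>x. f x *\<^sub>R g x)"
  by (simp add: smooth_on_def bounded_bilinear.Ck_on_prod[OF bounded_bilinear_scaleR])

lemma smooth_on_diff:
  fixes f g :: "_ \<Rightarrow> real"
  assumes "open S" "smooth_on S f" "smooth_on S g"
  shows "smooth_on S (\<lambda>x. f x - g x)"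
  using smooth_on_add[OF assms(1,2) smooth_on_mult[OF assms(1) smooth_on_const[of S "-1"] assms(3)]]
  by simp

lemma smooth_on_sum:
  assumes "open S" "\<And>i. i \<in> I \<Longrightarrow> smooth_on S (f i)"
  shows "smooth_on S (\<lambda>x. \<Sum>i\<in>I. f i x)"
  using assms(2) by (induction I rule: infinite_finite_induct)
    (auto intro: smooth_on_const smooth_on_add[OF assms(1)])

lemma smooth_on_prod:
  fixes f :: "_ \<Rightarrow> _ \<Rightarrow> real"
  assumes "open S" "\<And>i. i \<in> I \<Longrightarrow> smooth_on S (f i)"
  shows "smooth_on S (\<lambda>x. \<Prod>i\<in>I. f i x)"
  using assms(2) by (induction I rule: infinite_finite_induct)
    (auto intro: smooth_on_const smooth_on_mult[OF assms(1)])

text \<open>The derivative of 1/f contains only f' and 1/f, and 1/f is of class k by the induction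
  hypothesis.\<close>

lemma Ck_on_inverse:
  fixes f :: "_ \<Rightarrow> real"
  assumes "open S" "\<And>x. x \<in> S \<Longrightarrow> f x \<noteq> 0"
  shows "Ck_on k S f \<Longrightarrow> Ck_on k S (\<lambda>x. inverse (f x))"
proof (induction k)
  case 0
  then show ?case using assms by (auto intro: continuous_on_inverse)
next
  case (Suc k)
  note mult = bounded_bilinear.Ck_on_prod[OF bounded_bilinear_mult assms(1)]
  have IH: "Ck_on k S (\<lambda>x. inverse (f x))"
    using Suc Ck_on_SucD by blast
  have *: "((\<lambda>x. inverse (f x)) has_derivative
      (\<lambda>v. - (inverse (f x) * dird f x v * inverse (f x)))) (at x)" if "x \<in> S" for x
  proof -
    have "(f has_derivative dird f x) (at x)"
      using Suc.prems that by (auto intro: has_derivative_dird)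
    with assms(2)[OF that] show ?thesis
      by (rule Deriv.has_derivative_inverse)
  qed
  have "Ck_on k S (\<lambda>x. dird (\<lambda>x. inverse (f x)) x v)" for v
  proof -
    have "Ck_on k S (\<lambda>x. (-1) * (inverse (f x) * dird f x v * inverse (f x)))"
      using Suc.prems IH by (intro mult Ck_on_const) auto
    moreover have "dird (\<lambda>x. inverse (f x)) x v = (-1) * (inverse (f x) * dird f x v * inverse (f x))"
      if "x \<in> S" for x
      using dird_eqI[OF *[OF that]] by simp
    ultimately show ?thesis
      by (rule Ck_on_transfer[OF assms(1)])
  qed
  then show ?case using * by (auto simp: differentiable_def)
qed

lemma smooth_on_divide:
  fixes f g :: "_ \<Rightarrow> real"
  assumes "open S" "smooth_on S f" "smooth_on S g" "\<And>x. x \<in> S \<Longrightarrow> g x \<noteq> 0"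
  shows "smooth_on S (\<lambda>x. f x / g x)"
proof -
  have "smooth_on S (\<lambda>x. inverse (g x))"
    using assms by (simp add: smooth_on_def Ck_on_inverse)
  then show ?thesis
    unfolding divide_inverse by (intro smooth_on_mult assms)
qed

text \<open>Composition with an affine map merely replaces the direction v of a derivative by l v,
  so no products arise in the induction. The map of interest is x -> (x, y) with y fixed.\<close>

lemma Ck_on_affine:
  assumes "bounded_linear l" "open S"
  shows "Ck_on k S f \<Longrightarrow> Ck_on k ((\<lambda>x. c + l x) -` S) (\<lambda>x. f (c + l x))"
proof (induction k arbitrary: f)
  have cont: "continuous_on X (\<lambda>x. c + l x)" for X
    using assms(1) by (intro continuous_intros linear_continuous_on)
  case 0
  then show ?case
    using continuous_on_compose2[OF _ cont, of S f] by auto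
next
  case (Suc k)
  have *: "((\<lambda>x. f (c + l x)) has_derivative (\<lambda>v. dird f (c + l x) (l v))) (at x)"
    if "c + l x \<in> S" for x
  proof -
    have "((\<lambda>x. c + l x) has_derivative l) (at x)"
      using has_derivative_add[OF has_derivative_const bounded_linear_imp_has_derivative[OF assms(1)]]
      by auto
    moreover have "(f has_derivative dird f (c + l x)) (at (c + l x))"
      using Suc.prems that by (auto intro: has_derivative_dird)
    ultimately show ?thesis
      by (rule has_derivative_compose[where g=f])
  qed
  have op: "open ((\<lambda>x. c + l x) -` S)"
    using assms by (intro open_vimage continuous_intros linear_continuous_on) auto
  have "Ck_on k ((\<lambda>x. c + l x) -` S) (\<lambda>x. dird (\<lambda>x. f (c + l x)) x v)" for v
  proof -
    have "Ck_on k ((\<lambda>x. c + l x) -` S) (\<lambda>x. dird f (c + l x) (l v))"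
      by (rule Suc.IH) (use Suc.prems in auto)
    moreover have "dird (\<lambda>x. f (c + l x)) x v = dird f (c + l x) (l v)"
      if "x \<in> (\<lambda>x. c + l x) -` S" for x
      using dird_eqI[OF *] that by auto
    ultimately show ?thesis
      by (rule Ck_on_transfer[OF op])
  qed
  then show ?case using * by (auto simp: differentiable_def)
qed

lemma smooth_on_affine:
  assumes "bounded_linear l" "open S" "smooth_on S f"
  shows "smooth_on ((\<lambda>x. c + l x) -` S) (\<lambda>x. f (c + l x))"
  using assms by (simp add: smooth_on_def Ck_on_affine)

lemma smooth_on_vec_nth: "smooth_on S f \<Longrightarrow> open S \<Longrightarrow> smooth_on S (\<lambda>x. f x $ i)"
proof -
  have *: "open S \<Longrightarrow> Ck_on k S f \<Longrightarrow> Ck_on k S (\<lambda>x. f x $ i)" for k S and f :: "_ \<Rightarrow> _"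
  proof (induction k arbitrary: f)
    case 0
    then show ?case by (auto intro: continuous_on_component)
  next
    case (Suc k)
    have d: "((\<lambda>x. f x $ i) has_derivative (\<lambda>v. dird f x v $ i)) (at x)" if "x \<in> S" for x
      by (rule bounded_linear.has_derivative[OF bounded_linear_vec_nth], rule has_derivative_dird)
        (use Suc.prems that in simp)
    have "Ck_on k S (\<lambda>x. dird (\<lambda>x. f x $ i) x v)" for v
      by (rule Ck_on_transfer[OF Suc.prems(1), of _ "\<lambda>x. dird f x v $ i"])
        (use Suc dird_eqI[OF d] in auto)
    then show ?case using d by (auto simp: differentiable_def)
  qed
  show "smooth_on S f \<Longrightarrow> open S \<Longrightarrow> smooth_on S (\<lambda>x. f x $ i)"
    using * by (auto simp: smooth_on_def)
qed

lemma smooth_on_vec: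
  fixes f :: "'a::real_normed_vector \<Rightarrow> real^'n::finite"
  assumes "open S" "\<And>i. smooth_on S (\<lambda>x. f x $ i)"
  shows "smooth_on S f"
proof -
  have "smooth_on S (\<lambda>x. \<Sum>i\<in>UNIV. f x $ i *\<^sub>R (axis i 1 :: real^'n))"
    by (intro smooth_on_sum smooth_on_scaleR smooth_on_const assms)
  moreover have "(\<lambda>x. \<Sum>i\<in>UNIV. f x $ i *\<^sub>R axis i 1) = f"
    using basis_expansion[of "f x" for x] by (simp add: scalar_mult_eq_scaleR fun_eq_iff)
  ultimately show ?thesis by simp
qed

section \<open>Matrices depending smoothly on a parameter\<close>

lemma smooth_on_det:
  fixes f :: "'a::real_normed_vector \<Rightarrow> real^'n::finite^'n"
  assumes "open S" "\<And>i j. smooth_on S (\<lambda>x. f x $ i $ j)"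
  shows "smooth_on S (\<lambda>x. det (f x))"
  unfolding det_def by (intro smooth_on_sum smooth_on_mult smooth_on_prod smooth_on_const assms)

lemma matrix_inv_mult:
  fixes A :: "real^'n::finite^'n"
  assumes "invertible A"
  shows "A ** matrix_inv A = mat 1" "matrix_inv A ** A = mat 1"
proof -
  have "A ** matrix_inv A = mat 1 \<and> matrix_inv A ** A = mat 1"
    unfolding matrix_inv_def by (rule someI_ex) (use assms in \<open>simp add: invertible_def\<close>)
  then show "A ** matrix_inv A = mat 1" "matrix_inv A ** A = mat 1" by simp_all
qed

text \<open>Column l of the inverse solves A v = e_l. As a quotient of determinants its entries are
  visibly smooth in those of A.\<close>

lemma matrix_inv_cramer:
  fixes A :: "real^'n::finite^'n"
  assumes "invertible A"
  shows "matrix_inv A $ k $ l =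
    det (\<chi> i j. if j = k then axis l 1 $ i else A $ i $ j) / det A"
proof -
  have d: "det A \<noteq> 0"
    using assms invertible_det_nz by blast
  have "A *v (matrix_inv A *v axis l 1) = axis l 1"
    by (simp add: matrix_vector_mul_assoc matrix_inv_mult(1) assms)
  then have "matrix_inv A *v axis l 1 =
      (\<chi> k. det (\<chi> i j. if j = k then axis l 1 $ i else A $ i $ j) / det A)"
    using cramer[OF d] by blast
  moreover have "(matrix_inv A *v axis l 1) $ k = matrix_inv A $ k $ l"
    by (simp add: matrix_vector_mul_component inner_axis)
  ultimately show ?thesis by simp
qed

lemma smooth_on_matrix_inv:
  fixes f :: "'a::real_normed_vector \<Rightarrow> real^'n::finite^'n"
  assumes "open S" "\<And>i j. smooth_on S (\<lambda>x. f x $ i $ j)" "\<And>x. x \<in> S \<Longrightarrow> invertible (f x)"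
  shows "smooth_on S (\<lambda>x. matrix_inv (f x) $ k $ l)"
proof -
  have "smooth_on S (\<lambda>x. det (\<chi> i j. if j = k then axis l 1 $ i else f x $ i $ j) / det (f x))"
  proof (rule smooth_on_divide)
    show "smooth_on S (\<lambda>x. det (\<chi> i j. if j = k then axis l 1 $ i else f x $ i $ j))"
    proof (rule smooth_on_det)
      show "smooth_on S (\<lambda>x. (\<chi> i j. if j = k then axis l 1 $ i else f x $ i $ j) $ i $ j)" for i j
        using assms(2) by (cases "j = k") (auto intro: smooth_on_const)
    qed fact
    show "smooth_on S (\<lambda>x. det (f x))"
      by (rule smooth_on_det[OF assms(1,2)])
    show "det (f x) \<noteq> 0" if "x \<in> S" for x
      using assms(3)[OF that] invertible_det_nz by blast
  qed fact
  then show ?thesis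
    by (rule smooth_on_transfer[OF assms(1)]) (simp add: matrix_inv_cramer assms(3))
qed

text \<open>The second difference is symmetric in u and v, while the right-hand side is a mixed
  derivative in one particular order; \<open>dird_commute\<close> compares the two orders.\<close>

lemma second_difference_mvt:
  fixes h :: "'a::real_normed_vector \<Rightarrow> real"
  assumes "s > 0" "\<And>p q. 0 \<le> p \<Longrightarrow> p \<le> s \<Longrightarrow> 0 \<le> q \<Longrightarrow> q \<le> s \<Longrightarrow> x + p *\<^sub>R u + q *\<^sub>R v \<in> S"
    and h: "\<And>z. z \<in> S \<Longrightarrow> h differentiable (at z)"
    and h': "\<And>z. z \<in> S \<Longrightarrow> (\<lambda>z. dird h z u) differentiable (at z)"
  obtains p q where "0 < p" "p < s" "0 < q" "q < s"
    "h (x + s *\<^sub>R u + s *\<^sub>R v) - h (x + s *\<^sub>R u) - h (x + s *\<^sub>R v) + h x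
      = s * s * dird (\<lambda>z. dird h z u) (x + p *\<^sub>R u + q *\<^sub>R v) v"
proof -
  have chain: "((\<lambda>p. f (c + p *\<^sub>R w)) has_real_derivative dird f (c + p *\<^sub>R w) w) (at p)"
    if "f differentiable (at (c + p *\<^sub>R w))" for f :: "'a \<Rightarrow> real" and c w p
  proof -
    have "((\<lambda>p. c + p *\<^sub>R w) has_derivative (\<lambda>p. p *\<^sub>R w)) (at p)"
      by (auto intro!: derivative_eq_intros)
    from has_derivative_compose[OF this has_derivative_dird[OF that]]
    show ?thesis
      using linear_cmul[OF linear_dird[OF that]]
      by (simp add: has_field_derivative_def mult.commute[of _ "dird f _ w"])
  qed
  \<comment> \<open>The increment of this function over [0, s] is the second difference. The mean
    value theorem is applied to it in direction u, and then to the resulting derivative in direction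
    v.\<close>
  let ?\<phi> = "\<lambda>p. h (x + s *\<^sub>R v + p *\<^sub>R u) - h (x + p *\<^sub>R u)"
  have mem: "x + s *\<^sub>R v + p *\<^sub>R u \<in> S" "x + p *\<^sub>R u \<in> S" if "0 \<le> p" "p \<le> s" for p
    using assms(2)[of p s] assms(2)[of p 0] that assms(1) by (auto simp: algebra_simps)
  have "\<exists>p>0. p < s \<and> ?\<phi> s - ?\<phi> 0 = (s - 0) *
      (dird h (x + s *\<^sub>R v + p *\<^sub>R u) u - dird h (x + p *\<^sub>R u) u)"
    by (rule MVT2[OF assms(1)]) (auto intro!: derivative_intros chain h mem)
  then obtain p where p: "0 < p" "p < s" and p': "?\<phi> s - ?\<phi> 0 = (s - 0) *
      (dird h (x + s *\<^sub>R v + p *\<^sub>R u) u - dird h (x + p *\<^sub>R u) u)" by blast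
  let ?\<psi> = "\<lambda>q. dird h (x + p *\<^sub>R u + q *\<^sub>R v) u"
  have "\<exists>q>0. q < s \<and> ?\<psi> s - ?\<psi> 0 = (s - 0) * dird (\<lambda>z. dird h z u) (x + p *\<^sub>R u + q *\<^sub>R v) v"
    by (rule MVT2[OF assms(1)]) (use p in \<open>auto intro!: chain h' assms(2)\<close>)
  then obtain q where q: "0 < q" "q < s" and
    q': "?\<psi> s - ?\<psi> 0 = (s - 0) * dird (\<lambda>z. dird h z u) (x + p *\<^sub>R u + q *\<^sub>R v) v" by blast
  have "h (x + s *\<^sub>R u + s *\<^sub>R v) - h (x + s *\<^sub>R u) - h (x + s *\<^sub>R v) + h x = s * (?\<psi> s - ?\<psi> 0)"
    using p' by (simp add: algebra_simps)
  then show thesis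
    using that[OF p q] q' by simp
qed

lemma dird_commute:
  fixes h :: "'a::real_normed_vector \<Rightarrow> real"
  assumes "open S" "smooth_on S h" "x \<in> S"
  shows "dird (\<lambda>z. dird h z u) x v = dird (\<lambda>z. dird h z v) x u"
proof (rule ccontr)
  let ?f = "\<lambda>u v z. dird (\<lambda>z. dird h z u) z v"
  assume ne: "\<not> ?thesis"
  \<comment> \<open>Half the gap: both mixed derivatives at nearby points are within e of their
    values at x, yet two such points give equal values.\<close>
  define e where "e = \<bar>?f u v x - ?f v u x\<bar> / 2"
  have e: "e > 0" using ne by (simp add: e_def)
  have diff: "h differentiable (at z)" "(\<lambda>z. dird h z w) differentiable (at z)" if "z \<in> S" for z w
    using that smooth_on_differentiable smooth_on_dird assms by blast+
  have cont: "continuous (at x) (?f u v)" for u v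
    using assms smooth_on_continuous_on[OF smooth_on_dird[OF smooth_on_dird]]
    by (metis continuous_on_eq_continuous_at)
  obtain r0 where r0: "r0 > 0" "ball x r0 \<subseteq> S"
    using assms by (meson openE)
  obtain r1 where r1: "r1 > 0" "\<And>z. dist z x < r1 \<Longrightarrow> \<bar>?f u v z - ?f u v x\<bar> < e"
    using cont[of u v] e unfolding continuous_at_eps_delta dist_real_def by metis
  obtain r2 where r2: "r2 > 0" "\<And>z. dist z x < r2 \<Longrightarrow> \<bar>?f v u z - ?f v u x\<bar> < e"
    using cont[of v u] e unfolding continuous_at_eps_delta dist_real_def by metis
  define r where "r = min r0 (min r1 r2)"
  \<comment> \<open>The whole parallelogram with sides s u and s v lies within r of x; the summand 1
    keeps the denominator positive and the factor 2 makes the bound strict.\<close>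
  define s where "s = r / (norm u + norm v + 1) / 2"
  have r: "r > 0" using r0 r1 r2 by (simp add: r_def)
  have k: "norm u + norm v + 1 > 0"
    by (smt (verit) norm_ge_zero)
  have s: "s > 0" using r k by (simp add: s_def)
  have near: "dist (x + p *\<^sub>R u' + q *\<^sub>R v') x < r"
    if "0 \<le> p" "p \<le> s" "0 \<le> q" "q \<le> s" "norm u' + norm v' = norm u + norm v" for p q u' v'
  proof -
    have "dist (x + p *\<^sub>R u' + q *\<^sub>R v') x \<le> p * norm u' + q * norm v'"
      using norm_triangle_ineq[of "p *\<^sub>R u'" "q *\<^sub>R v'"] that by (simp add: dist_norm add.assoc)
    also have "\<dots> \<le> s * norm u' + s * norm v'"
      using that by (intro add_mono mult_right_mono) auto
    also have "\<dots> = s * (norm u + norm v)" using that(5) by (metis distrib_left)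
    also have "\<dots> < s * ((norm u + norm v + 1) * 2)" using s by (intro mult_strict_left_mono) (auto simp: add_nonneg_pos)
    also have "\<dots> = r" using k by (simp add: s_def)
    finally show ?thesis .
  qed
  have memS: "z \<in> S" if "dist z x < r" for z
    using that r0 by (auto simp: r_def dist_commute subset_iff)
  obtain p q where 1: "0 < p" "p < s" "0 < q" "q < s"
    "h (x + s *\<^sub>R u + s *\<^sub>R v) - h (x + s *\<^sub>R u) - h (x + s *\<^sub>R v) + h x
      = s * s * ?f u v (x + p *\<^sub>R u + q *\<^sub>R v)"
    by (rule second_difference_mvt[of s x u v S h]) (use s near memS diff in auto)
  obtain p' q' where 2: "0 < p'" "p' < s" "0 < q'" "q' < s"
    "h (x + s *\<^sub>R v + s *\<^sub>R u) - h (x + s *\<^sub>R v) - h (x + s *\<^sub>R u) + h x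
      = s * s * ?f v u (x + p' *\<^sub>R v + q' *\<^sub>R u)"
    by (rule second_difference_mvt[of s x v u S h]) (use s near memS diff in auto)
  have "s * s * ?f u v (x + p *\<^sub>R u + q *\<^sub>R v) = s * s * ?f v u (x + p' *\<^sub>R v + q' *\<^sub>R u)"
    using 1(5) 2(5) by (simp add: algebra_simps)
  then have "?f u v (x + p *\<^sub>R u + q *\<^sub>R v) = ?f v u (x + p' *\<^sub>R v + q' *\<^sub>R u)"
    using s by simp
  moreover have "\<bar>?f u v (x + p *\<^sub>R u + q *\<^sub>R v) - ?f u v x\<bar> < e"
    using r1(2) near[of p q u v] 1 by (simp add: r_def)
  moreover have "\<bar>?f v u (x + p' *\<^sub>R v + q' *\<^sub>R u) - ?f v u x\<bar> < e"
    using r2(2) near[of p' q' v u] 2 by (simp add: r_def)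
  ultimately show False
    unfolding e_def by (smt (verit) field_sum_of_halves)
qed

section \<open>The canonical connection in coordinates\<close>

lemma dird_cong_at:
  assumes "open S" "x \<in> S" "\<And>z. z \<in> S \<Longrightarrow> f z = g z"
  shows "dird f x v = dird g x v"
  using dird_cong[OF assms] by simp

lemma dird_mult:
  fixes f g :: "'a::real_normed_vector \<Rightarrow> real"
  assumes "f differentiable (at z)" "g differentiable (at z)"
  shows "dird (\<lambda>z. f z * g z) z v = f z * dird g z v + dird f z v * g z"
  by (rule dird_eqI) (intro has_derivative_mult has_derivative_dird assms)

lemma dird_sum:
  fixes f :: "_ \<Rightarrow> 'a::real_normed_vector \<Rightarrow> 'b::real_normed_vector"
  assumes "\<And>i. i \<in> I \<Longrightarrow> f i differentiable (at z)"
  shows "dird (\<lambda>z. \<Sum>i\<in>I. f i z) z v = (\<Sum>i\<in>I. dird (f i) z v)"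
  by (rule dird_eqI) (intro has_derivative_sum has_derivative_dird assms)

lemma dird_cmult:
  fixes f :: "'a::real_normed_vector \<Rightarrow> real"
  assumes "f differentiable (at z)"
  shows "dird (\<lambda>z. c * f z) z v = c * dird f z v"
  by (rule dird_eqI) (intro has_derivative_mult_right has_derivative_dird assms)

lemma dird_bounded_linear: "bounded_linear f \<Longrightarrow> dird f x v = f v"
  by (rule dird_eqI) (rule bounded_linear_imp_has_derivative)

lemma dird_basis_expansion:
  fixes f :: "real^'n::finite \<Rightarrow> 'b::real_normed_vector"
  assumes "f differentiable (at x)"
  shows "dird f x v = (\<Sum>i\<in>UNIV. v $ i *\<^sub>R dird f x (axis i 1))"
proof -
  interpret linear "dird f x" by (rule linear_dird[OF assms])
  have "dird f x (\<Sum>i\<in>UNIV. v $ i *\<^sub>R axis i 1) = (\<Sum>i\<in>UNIV. v $ i *\<^sub>R dird f x (axis i 1))"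
    by (simp add: sum scaleR)
  then show ?thesis
    using basis_expansion[of v] by (simp add: scalar_mult_eq_scaleR)
qed

text \<open>\<open>px\<close> and \<open>py\<close> are the derivatives with respect to x^i and y^i.
  Both are directional derivatives of one function on the product, so \<open>dird_commute\<close>
  applies to mixed ones.\<close>

abbreviation px :: "'n \<Rightarrow> ((real^'n::finite) \<times> (real^'n) \<Rightarrow> real) \<Rightarrow> (real^'n) \<times> (real^'n) \<Rightarrow> real" where
  "px i h z \<equiv> dird h z (axis i 1, 0)"

abbreviation py :: "'n \<Rightarrow> ((real^'n::finite) \<times> (real^'n) \<Rightarrow> real) \<Rightarrow> (real^'n) \<times> (real^'n) \<Rightarrow> real" where
  "py i h z \<equiv> dird h z (0, axis i 1)"

lemma dird_fst:
  assumes "h differentiable (at (x, y))"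
  shows "dird (\<lambda>x. h (x, y)) x u = dird h (x, y) (u, 0)"
proof -
  have "((\<lambda>x. (x, y)) has_derivative (\<lambda>u. (u, 0))) (at x)"
    by (auto intro!: derivative_eq_intros)
  from has_derivative_compose[OF this has_derivative_dird[OF assms]]
  show ?thesis by (rule dird_eqI)
qed

lemma dird_snd:
  assumes "h differentiable (at (x, y))"
  shows "dird (\<lambda>y. h (x, y)) y u = dird h (x, y) (0, u)"
proof -
  have "((\<lambda>y. (x, y)) has_derivative (\<lambda>u. (0, u))) (at y)"
    by (auto intro!: derivative_eq_intros)
  from has_derivative_compose[OF this has_derivative_dird[OF assms]]
  show ?thesis by (rule dird_eqI)
qed

lemma dird_Pair:
  fixes h :: "(real^'n::finite) \<times> (real^'n) \<Rightarrow> real"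
  assumes "h differentiable (at z)"
  shows "dird h z (u, v) = (\<Sum>i\<in>UNIV. u $ i * px i h z) + (\<Sum>i\<in>UNIV. v $ i * py i h z)"
proof -
  interpret linear "dird h z" by (rule linear_dird[OF assms])
  have eq: "(u, v) = (\<Sum>i\<in>UNIV. u $ i *\<^sub>R (axis i 1, 0)) + (\<Sum>i\<in>UNIV. v $ i *\<^sub>R (0, axis i 1))"
    using basis_expansion[of u] basis_expansion[of v]
    by (simp add: sum_prod scalar_mult_eq_scaleR)
  show ?thesis
    unfolding eq by (simp add: add sum scaleR del: scaleR_Pair)
qed

lemma bounded_linear_snd_nth: "bounded_linear (\<lambda>z. snd z $ k)"
  by (intro bounded_linear_compose[OF bounded_linear_vec_nth] bounded_linear_snd)

lemma smooth_on_snd_nth: "smooth_on S (\<lambda>z. snd z $ k)"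
  by (intro smooth_on_bounded_linear bounded_linear_snd_nth)

lemma has_derivative_nth: "((\<lambda>y. y $ k) has_derivative (\<lambda>v. v $ k)) F"
  by (rule bounded_linear_imp_has_derivative[OF bounded_linear_vec_nth])

lemma differentiable_snd_nth: "(\<lambda>z. snd z $ k) differentiable (at z)"
  using bounded_linear_snd_nth bounded_linear_imp_differentiable by blast

text \<open>Product rule for contractions y^k f_k. The second sum appears because the coefficient
  y^k is itself a coordinate; it produces the extra terms in the derivatives of Euler's
  identity.\<close>

lemma dird_snd_contraction:
  fixes f :: "'n::finite \<Rightarrow> (real^'n) \<times> (real^'n) \<Rightarrow> real"
  assumes "\<And>k. f k differentiable (at z)"
  shows "dird (\<lambda>z. \<Sum>k\<in>UNIV. snd z $ k * f k z) z (u, v) =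
    (\<Sum>k\<in>UNIV. snd z $ k * dird (f k) z (u, v)) + (\<Sum>k\<in>UNIV. v $ k * f k z)"
proof -
  have "dird (\<lambda>z. \<Sum>k\<in>UNIV. snd z $ k * f k z) z (u, v) =
      (\<Sum>k\<in>UNIV. snd z $ k * dird (f k) z (u, v) + v $ k * f k z)"
    by (subst dird_sum)
      (auto intro!: differentiable_mult differentiable_snd_nth assms
        simp: dird_mult differentiable_snd_nth assms dird_bounded_linear[OF bounded_linear_snd_nth])
  then show ?thesis by (simp add: sum.distrib)
qed

lemma sum_axis_mult: "(\<Sum>k\<in>UNIV. axis i 1 $ k * f k) = (f i :: real)" for i :: "'n::finite"
  by (simp add: axis_def if_distrib[of "\<lambda>t. t * _"] cong: if_cong)

lemma py_contraction:
  fixes f :: "'n::finite \<Rightarrow> (real^'n) \<times> (real^'n) \<Rightarrow> real"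
  assumes "\<And>k. f k differentiable (at z)"
  shows "py i (\<lambda>z. \<Sum>k\<in>UNIV. snd z $ k * f k z) z =
    (\<Sum>k\<in>UNIV. snd z $ k * py i (f k) z) + f i z"
  by (simp add: dird_snd_contraction assms sum_axis_mult)

lemma px_contraction:
  fixes f :: "'n::finite \<Rightarrow> (real^'n) \<times> (real^'n) \<Rightarrow> real"
  assumes "\<And>k. f k differentiable (at z)"
  shows "px i (\<lambda>z. \<Sum>k\<in>UNIV. snd z $ k * f k z) z = (\<Sum>k\<in>UNIV. snd z $ k * px i (f k) z)"
  by (simp add: dird_snd_contraction assms)

definition fund :: "((real^'n::finite) \<times> (real^'n) \<Rightarrow> real) \<Rightarrow> (real^'n) \<times> (real^'n) \<Rightarrow> real^'n^'n" where
  "fund L z = (\<chi> i j. 1/2 * py i (py j L) z)"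

text \<open>The Euler-Lagrange equations of L read 2 g_kl x''^l + \<open>semispray L k\<close> = 0.
  Hence geodesics satisfy x''^j = - 1/2 \<open>spray L j\<close>, and \<open>spray\<close> is four
  times the usual spray coefficient.\<close>

definition semispray where
  "semispray L k z = (\<Sum>m\<in>UNIV. snd z $ m * px m (py k L) z) - px k L z"

definition spray where
  "spray L j z = (\<Sum>k\<in>UNIV. matrix_inv (fund L z) $ j $ k * semispray L k z)"

definition nlc where
  "nlc L z j i = 1/4 * py i (spray L j) z"

text \<open>The content of a Finsler metric in one chart, free of \<open>chart_inv\<close> and
  \<open>tvec\<close>: L is a function on an open cone in the product of two coordinate
  spaces.\<close>

locale local_finsler =
  fixes L :: "(real^'n::finite) \<times> (real^'n) \<Rightarrow> real" and C :: "((real^'n) \<times> (real^'n)) set"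
  assumes open_C: "open C"
    and smooth_L: "smooth_on C L"
    and cone_C: "(x, y) \<in> C \<Longrightarrow> r > 0 \<Longrightarrow> (x, r *\<^sub>R y) \<in> C"
    and homogeneous_L: "(x, y) \<in> C \<Longrightarrow> r > 0 \<Longrightarrow> L (x, r *\<^sub>R y) = r\<^sup>2 * L (x, y)"
    and invertible_fund: "z \<in> C \<Longrightarrow> invertible (fund L z)"
begin

lemmas smooth_C = smooth_on_mult[OF open_C] smooth_on_diff[OF open_C] smooth_on_add[OF open_C]
  smooth_on_sum[OF open_C] smooth_on_const smooth_on_dird smooth_on_snd_nth

lemma smooth_semispray: "smooth_on C (semispray L k)"
  unfolding semispray_def[abs_def] by (intro smooth_C smooth_L)

lemma smooth_fund: "smooth_on C (\<lambda>z. fund L z $ i $ j)"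
  unfolding fund_def vec_lambda_beta by (intro smooth_C smooth_L)

lemma smooth_spray: "smooth_on C (spray L j)"
  unfolding spray_def[abs_def]
  by (intro smooth_C smooth_semispray smooth_on_matrix_inv open_C smooth_fund invertible_fund)

lemmas diff_L = smooth_on_differentiable[OF smooth_L]
lemmas diff_dL = smooth_on_differentiable[OF smooth_on_dird[OF smooth_L]]
lemmas diff_ddL = smooth_on_differentiable[OF smooth_on_dird[OF smooth_on_dird[OF smooth_L]]]

section \<open>Euler's identities and contractions of the semispray\<close>

lemma fund_sym: "z \<in> C \<Longrightarrow> py i (py j L) z = py j (py i L) z"
  by (rule dird_commute[OF open_C smooth_L])

text \<open>The function r -> L(x, r y) is differentiated at r = 1, once by the chain rule and once
  by homogeneity.\<close>

lemma euler:
  assumes "z \<in> C"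
  shows "(\<Sum>k\<in>UNIV. snd z $ k * py k L z) = 2 * L z"
proof -
  obtain x y where z: "z = (x, y)" by (cases z)
  have d: "((\<lambda>r. (x, r *\<^sub>R y)) has_derivative (\<lambda>r. (0, r *\<^sub>R y))) (at 1)"
    by (auto intro!: derivative_eq_intros)
  have "((\<lambda>r. L (x, r *\<^sub>R y)) has_derivative (\<lambda>r. dird L z (0, r *\<^sub>R y))) (at 1)"
    using has_derivative_compose[OF d, of L "dird L z"] has_derivative_dird[OF diff_L[OF assms]]
    by (simp add: z)
  moreover have "((\<lambda>r. L (x, r *\<^sub>R y)) has_derivative (\<lambda>r. 2 * r * L (x, y))) (at 1)"
  proof (rule has_derivative_transform_within_open)
    show "((\<lambda>r. r\<^sup>2 * L (x, y)) has_derivative (\<lambda>r. 2 * r * L (x, y))) (at 1)"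
      by (auto intro!: derivative_eq_intros simp: power2_eq_square)
    show "open {(0::real)<..}" "(1::real) \<in> {0<..}" by auto
  qed (use homogeneous_L assms z in auto)
  ultimately have "(\<lambda>r. dird L z (0, r *\<^sub>R y)) = (\<lambda>r. 2 * r * L (x, y))"
    by (rule has_derivative_unique)
  from fun_cong[OF this, of 1] have "dird L z (0, y) = 2 * L z" by (simp add: z)
  then show ?thesis
    using dird_Pair[OF diff_L[OF assms], of 0 y] by (simp add: z)
qed

lemma px_euler:
  assumes "z \<in> C"
  shows "(\<Sum>k\<in>UNIV. snd z $ k * px i (py k L) z) = 2 * px i L z"
proof -
  have "px i (\<lambda>z. \<Sum>k\<in>UNIV. snd z $ k * py k L z) z = px i (\<lambda>z. 2 * L z) z"
    by (rule dird_cong_at[OF open_C assms euler])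
  then show ?thesis
    by (simp add: px_contraction diff_dL[OF assms] dird_cmult diff_L[OF assms])
qed

lemma py_euler:
  assumes "z \<in> C"
  shows "(\<Sum>k\<in>UNIV. snd z $ k * py i (py k L) z) = py i L z"
proof -
  have "py i (\<lambda>z. \<Sum>k\<in>UNIV. snd z $ k * py k L z) z = py i (\<lambda>z. 2 * L z) z"
    by (rule dird_cong_at[OF open_C assms euler])
  then show ?thesis
    by (simp add: py_contraction diff_dL[OF assms] dird_cmult diff_L[OF assms])
qed

text \<open>The second fibre derivatives of L are homogeneous of degree 0.\<close>

lemma py_py_euler:
  assumes "z \<in> C"
  shows "(\<Sum>k\<in>UNIV. snd z $ k * py j (py i (py k L)) z) = 0"
proof -
  have "py j (\<lambda>z. \<Sum>k\<in>UNIV. snd z $ k * py i (py k L) z) z = py j (py i L) z"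
    by (rule dird_cong_at[OF open_C assms py_euler])
  then show ?thesis
    by (simp add: py_contraction diff_ddL[OF assms] fund_sym[OF assms])
qed

lemma semispray_contraction:
  assumes "z \<in> C"
  shows "(\<Sum>k\<in>UNIV. snd z $ k * semispray L k z) = (\<Sum>k\<in>UNIV. snd z $ k * px k L z)"
proof -
  have "(\<Sum>k\<in>UNIV. snd z $ k * (\<Sum>m\<in>UNIV. snd z $ m * px m (py k L) z)) =
      (\<Sum>m\<in>UNIV. snd z $ m * (\<Sum>k\<in>UNIV. snd z $ k * px m (py k L) z))"
    unfolding sum_distrib_left by (subst sum.swap) (simp add: mult.left_commute)
  also have "\<dots> = 2 * (\<Sum>m\<in>UNIV. snd z $ m * px m L z)"
    by (simp add: px_euler[OF assms] sum_distrib_left mult.left_commute)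
  finally show ?thesis
    by (simp add: semispray_def right_diff_distrib sum_subtractf)
qed

text \<open>Differentiating y^k S_k = y^k px_k L adds S_i on the left and px_i L on the right. By
  the definition of S_i, everything except 2 px_i L cancels.\<close>

lemma semispray_py_contraction:
  assumes "z \<in> C"
  shows "(\<Sum>k\<in>UNIV. snd z $ k * py i (semispray L k) z) = 2 * px i L z"
proof -
  have "py i (\<lambda>z. \<Sum>k\<in>UNIV. snd z $ k * semispray L k z) z =
      py i (\<lambda>z. \<Sum>k\<in>UNIV. snd z $ k * px k L z) z"
    by (rule dird_cong_at[OF open_C assms semispray_contraction])
  then have "(\<Sum>k\<in>UNIV. snd z $ k * py i (semispray L k) z) + semispray L i z =
      (\<Sum>k\<in>UNIV. snd z $ k * py i (px k L) z) + px i L z"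
    by (simp add: py_contraction diff_dL[OF assms]
        smooth_on_differentiable[OF smooth_semispray assms])
  moreover have "py i (px k L) z = px k (py i L) z" for k
    by (rule dird_commute[OF open_C smooth_L assms])
  ultimately show ?thesis by (simp add: semispray_def)
qed

lemma fund_spray:
  assumes "z \<in> C"
  shows "(\<Sum>l\<in>UNIV. fund L z $ k $ l * spray L l z) = semispray L k z"
proof -
  have "fund L z *v (matrix_inv (fund L z) *v (\<chi> k. semispray L k z)) = (\<chi> k. semispray L k z)"
    by (simp add: matrix_vector_mul_assoc matrix_inv_mult invertible_fund assms)
  moreover have "matrix_inv (fund L z) *v (\<chi> k. semispray L k z) = (\<chi> l. spray L l z)"
    by (simp add: vec_eq_iff matrix_vector_mult_def spray_def)
  ultimately show ?thesis
    by (simp add: vec_eq_iff matrix_vector_mult_def)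
qed

text \<open>Contracting the derivative of \<open>g\<^sub>k\<^sub>l G\<^sup>l = S\<^sub>k\<close> with \<open>y\<^sup>k\<close> removes the derivative of \<open>g\<close>.\<close>

theorem nlc_parallel:
  assumes "z \<in> C"
  shows "px i L z = (\<Sum>l\<in>UNIV. nlc L z l i * py l L z)"
proof -
  have dfund: "(\<lambda>z. fund L z $ k $ l) differentiable (at z)"
    and dspray: "spray L l differentiable (at z)" for k l
    using smooth_on_differentiable assms smooth_fund smooth_spray by blast+
  have contract_g: "(\<Sum>k\<in>UNIV. snd z $ k * fund L z $ k $ l) = 1/2 * py l L z" for l
    by (simp add: fund_def fund_sym[OF assms, of _ l] flip: py_euler[OF assms] sum_divide_distrib)
  have contract_dg: "(\<Sum>k\<in>UNIV. snd z $ k * py i (\<lambda>z. fund L z $ k $ l) z) = 0" for l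
  proof -
    have "py i (\<lambda>z. fund L z $ k $ l) z = py i (\<lambda>z. 1/2 * py l (py k L) z) z" for k
      by (rule dird_cong_at[OF open_C assms]) (simp add: fund_def fund_sym[of _ k l])
    also have "\<dots> k = 1/2 * py i (py l (py k L)) z" for k
      by (rule dird_cmult[OF diff_ddL[OF assms]])
    finally have "py i (\<lambda>z. fund L z $ k $ l) z = 1/2 * py i (py l (py k L)) z" for k .
    then have "(\<Sum>k\<in>UNIV. snd z $ k * py i (\<lambda>z. fund L z $ k $ l) z) =
        (\<Sum>k\<in>UNIV. snd z $ k * (1/2 * py i (py l (py k L)) z))"
      by (simp only:)
    then show ?thesis
      using py_py_euler[OF assms, of l i] by (simp flip: sum_divide_distrib)
  qed
  have "py i (semispray L k) z = py i (\<lambda>z. \<Sum>l\<in>UNIV. fund L z $ k $ l * spray L l z) z" for k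
    by (rule dird_cong_at[OF open_C assms fund_spray[symmetric]])
  also have "\<dots> k = (\<Sum>l\<in>UNIV. fund L z $ k $ l * py i (spray L l) z +
      py i (\<lambda>z. fund L z $ k $ l) z * spray L l z)" for k
    by (subst dird_sum) (auto simp: dird_mult dfund dspray intro!: differentiable_mult)
  finally have "(\<Sum>k\<in>UNIV. snd z $ k * py i (semispray L k) z) =
     (\<Sum>k\<in>UNIV. \<Sum>l\<in>UNIV. snd z $ k * fund L z $ k $ l * py i (spray L l) z) +
     (\<Sum>k\<in>UNIV. \<Sum>l\<in>UNIV. snd z $ k * py i (\<lambda>z. fund L z $ k $ l) z * spray L l z)"
    by (simp add: sum.distrib sum_distrib_left distrib_left mult.assoc)
  also have "\<dots> = (\<Sum>l\<in>UNIV. (\<Sum>k\<in>UNIV. snd z $ k * fund L z $ k $ l) * py i (spray L l) z) +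
     (\<Sum>l\<in>UNIV. (\<Sum>k\<in>UNIV. snd z $ k * py i (\<lambda>z. fund L z $ k $ l) z) * spray L l z)"
    by (simp add: sum_distrib_right) (subst (1 2) sum.swap, rule refl)
  finally have "2 * px i L z = (\<Sum>l\<in>UNIV. (1/2 * py l L z) * py i (spray L l) z)"
    by (simp add: semispray_py_contraction[OF assms] contract_g contract_dg)
  then show ?thesis
    by (simp add: nlc_def sum_divide_distrib[symmetric] mult.commute)
qed

text \<open>Converse of \<open>nlc_parallel\<close>. Differentiating parallelism along the fibre
  gives S_l = 2 g_lk \<Gamma>^k_mj y^m y^j. So the spray is the quadratic 2 \<Gamma>^k_mj y^m y^j,
  and a quarter of its derivative is \<Gamma>^k_ij y^j. An open part \<open>W\<close> of a single
  fibre suffices.\<close>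

theorem nlc_unique:
  fixes \<Gamma> :: "'n \<Rightarrow> 'n \<Rightarrow> 'n \<Rightarrow> real"
  assumes W: "open W" "\<And>y. y \<in> W \<Longrightarrow> (x, y) \<in> C"
    and sym: "\<And>k i j. \<Gamma> k i j = \<Gamma> k j i"
    and parallel: "\<And>y i. y \<in> W \<Longrightarrow>
      px i L (x, y) = (\<Sum>k\<in>UNIV. \<Sum>j\<in>UNIV. \<Gamma> k i j * y $ j * py k L (x, y))"
    and y: "y \<in> W"
  shows "nlc L (x, y) k i = (\<Sum>j\<in>UNIV. \<Gamma> k i j * y $ j)"
proof -
  define Q where "Q k y = (\<Sum>m\<in>UNIV. \<Sum>j\<in>UNIV. \<Gamma> k m j * (y $ m * y $ j))" for k and y :: "real^'n"
  have spray: "spray L j (x, y) = 2 * Q j y" if y: "y \<in> W" for y j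
  proof -
    note C = W(2)[OF y]
    have dnth: "(\<lambda>y. y $ j) differentiable (at y)" for j
      by (simp add: bounded_linear_imp_differentiable bounded_linear_vec_nth)
    have dd: "(\<lambda>y. py k L (x, y)) differentiable (at y)" for k
      using differentiable_chain_at[of "\<lambda>y. (x, y)" y "py k L"] diff_dL[OF C]
      by (auto simp: o_def intro!: differentiable_Pair)
    have dpy: "dird (\<lambda>y. py k L (x, y)) y v = dird (py k L) (x, y) (0, v)" for k v
      by (rule dird_snd[OF diff_dL[OF C]])
    have "px m (py l L) (x, y) = (\<Sum>k\<in>UNIV. \<Gamma> k m l * py k L (x, y)) +
        (\<Sum>k\<in>UNIV. \<Sum>j\<in>UNIV. \<Gamma> k m j * y $ j * py l (py k L) (x, y))" for m l
    proof -
      \<comment> \<open>Parallelism is known only over the given x and cannot be differentiated in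
        x. After the exchange of derivatives it is differentiated along the fibre instead.\<close>
      have "px m (py l L) (x, y) = py l (px m L) (x, y)"
        by (rule dird_commute[OF open_C smooth_L C])
      also have "\<dots> = dird (\<lambda>y. px m L (x, y)) y (axis l 1)"
        by (rule dird_snd[symmetric, OF diff_dL[OF C]])
      also have "\<dots> = dird (\<lambda>y. \<Sum>k\<in>UNIV. \<Sum>j\<in>UNIV. \<Gamma> k m j * y $ j * py k L (x, y)) y (axis l 1)"
        by (rule dird_cong_at[OF W(1) y parallel])
      also have "\<dots> = (\<Sum>k\<in>UNIV. \<Sum>j\<in>UNIV. dird (\<lambda>y. \<Gamma> k m j * y $ j * py k L (x, y)) y (axis l 1))"
        by (subst dird_sum; (subst dird_sum)?)
          (auto intro!: differentiable_mult differentiable_sum dnth dd)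
      also have "\<dots> = (\<Sum>k\<in>UNIV. \<Sum>j\<in>UNIV. axis l 1 $ j * (\<Gamma> k m j * py k L (x, y)) +
          \<Gamma> k m j * y $ j * py l (py k L) (x, y))"
        by (intro sum.cong refl)
          (simp add: dird_mult dird_cmult dnth dd dpy differentiable_mult
            dird_bounded_linear bounded_linear_vec_nth)
      finally show ?thesis
        by (simp only: sum.distrib sum_axis_mult)
    qed
    then have "semispray L l (x, y) = (\<Sum>m\<in>UNIV. y $ m * (\<Sum>k\<in>UNIV. \<Gamma> k m l * py k L (x, y))) +
        (\<Sum>m\<in>UNIV. y $ m * (\<Sum>k\<in>UNIV. \<Sum>j\<in>UNIV. \<Gamma> k m j * y $ j * py l (py k L) (x, y)))
        - px l L (x, y)" for l
      by (simp add: semispray_def distrib_left sum.distrib)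
    \<comment> \<open>By symmetry of \<Gamma> the contraction with y^m is again the right-hand side
      of parallelism, and the term cancels against the last one of the semispray.\<close>
    moreover have "(\<Sum>m\<in>UNIV. y $ m * (\<Sum>k\<in>UNIV. \<Gamma> k m l * py k L (x, y))) = px l L (x, y)" for l
      unfolding parallel[OF y] sum_distrib_left
      by (subst sum.swap) (simp add: sym[of _ _ l] mult_ac)
    moreover have "(\<Sum>m\<in>UNIV. y $ m * (\<Sum>k\<in>UNIV. \<Sum>j\<in>UNIV. \<Gamma> k m j * y $ j * py l (py k L) (x, y))) =
        (\<Sum>k\<in>UNIV. fund L (x, y) $ l $ k * (2 * Q k y))" for l
      unfolding sum_distrib_left Q_def fund_def vec_lambda_beta
      by (subst sum.swap) (simp add: mult_ac)
    ultimately have "(\<chi> l. semispray L l (x, y)) = fund L (x, y) *v (\<chi> k. 2 * Q k y)"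
      by (simp add: vec_eq_iff matrix_vector_mult_def)
    then have "matrix_inv (fund L (x, y)) *v (\<chi> l. semispray L l (x, y)) = (\<chi> k. 2 * Q k y)"
      by (simp add: matrix_vector_mul_assoc matrix_inv_mult invertible_fund C)
    then show ?thesis
      by (simp add: vec_eq_iff matrix_vector_mult_def spray_def)
  qed
  have "py i (spray L k) (x, y) = dird (\<lambda>y. spray L k (x, y)) y (axis i 1)"
    by (rule dird_snd[symmetric]) (use smooth_on_differentiable[OF smooth_spray] W(2) y in auto)
  also have "\<dots> = dird (\<lambda>y. 2 * Q k y) y (axis i 1)"
    by (rule dird_cong_at[OF W(1) y spray])
  also have "\<dots> = 2 * (\<Sum>m\<in>UNIV. \<Sum>j\<in>UNIV. \<Gamma> k m j * (y $ m * axis i 1 $ j + axis i 1 $ m * y $ j))"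
    unfolding Q_def
    by (rule dird_eqI) (auto intro!: derivative_eq_intros has_derivative_nth)
  also have "\<dots> = 2 * ((\<Sum>m\<in>UNIV. \<Sum>j\<in>UNIV. axis i 1 $ j * (\<Gamma> k m j * y $ m)) +
      (\<Sum>j\<in>UNIV. \<Sum>m\<in>UNIV. axis i 1 $ m * (\<Gamma> k m j * y $ j)))"
    by (subst (3) sum.swap) (simp add: sum.distrib[symmetric] algebra_simps)
  also have "\<dots> = 4 * (\<Sum>j\<in>UNIV. \<Gamma> k i j * y $ j)"
    by (simp only: sum_axis_mult) (simp add: sym[of k _ i])
  finally show ?thesis by (simp add: nlc_def)
qed

text \<open>Berwald coefficients are introduced as arbitrary functions of x. As second fibre
  derivatives of the smooth function \<open>spray\<close> they turn out to be symmetric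
  (\<open>nlc_linear_symmetric\<close>) and smooth (\<open>nlc_linear_smooth\<close>).\<close>

lemma nlc_linear_coefficients:
  fixes \<Gamma> :: "real^'n \<Rightarrow> 'n \<Rightarrow> 'n \<Rightarrow> 'n \<Rightarrow> real"
  assumes "\<And>x y k i. (x, y) \<in> C \<Longrightarrow> nlc L (x, y) k i = (\<Sum>j\<in>UNIV. \<Gamma> x k i j * y $ j)"
    and C: "(x, y) \<in> C"
  shows "\<Gamma> x k i j = 1/4 * py j (py i (spray L k)) (x, y)"
proof -
  let ?W = "{y. (x, y) \<in> C}"
  have W: "open ?W" "y \<in> ?W"
    using continuous_open_vimage[OF open_C, of "\<lambda>y. (x, y)"] C
    by (auto simp: vimage_def continuous_on_eq_continuous_at intro!: continuous_intros)
  have d: "py i (spray L k) differentiable (at (x, y))"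
    using smooth_on_differentiable[OF smooth_on_dird[OF smooth_spray] C] .
  have "1/4 * py j (py i (spray L k)) (x, y) = py j (\<lambda>z. nlc L z k i) (x, y)"
    unfolding nlc_def by (rule dird_cmult[symmetric, OF d])
  also have "\<dots> = dird (\<lambda>y. nlc L (x, y) k i) y (axis j 1)"
    by (rule dird_snd[symmetric]) (use d in \<open>simp add: nlc_def\<close>)
  also have "\<dots> = dird (\<lambda>y. \<Sum>j\<in>UNIV. \<Gamma> x k i j * y $ j) y (axis j 1)"
    by (rule dird_cong_at[OF W]) (simp add: assms(1))
  also have "\<dots> = (\<Sum>l\<in>UNIV. \<Gamma> x k i l * axis j 1 $ l)"
    by (rule dird_eqI) (auto intro!: derivative_eq_intros has_derivative_nth)
  also have "\<dots> = \<Gamma> x k i j"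
    using sum_axis_mult[of j "\<Gamma> x k i"] by (simp add: mult.commute)
  finally show ?thesis by simp
qed

lemma nlc_linear_symmetric:
  fixes \<Gamma> :: "real^'n \<Rightarrow> 'n \<Rightarrow> 'n \<Rightarrow> 'n \<Rightarrow> real"
  assumes "\<And>x y k i. (x, y) \<in> C \<Longrightarrow> nlc L (x, y) k i = (\<Sum>j\<in>UNIV. \<Gamma> x k i j * y $ j)"
    and C: "(x, y) \<in> C"
  shows "\<Gamma> x k i j = \<Gamma> x k j i"
proof -
  have "\<Gamma> x k i j = 1/4 * py j (py i (spray L k)) (x, y)"
    by (rule nlc_linear_coefficients[OF assms])
  also have "py j (py i (spray L k)) (x, y) = py i (py j (spray L k)) (x, y)"
    by (rule dird_commute[OF open_C smooth_spray C])
  also have "1/4 * \<dots> = \<Gamma> x k j i"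
    by (rule nlc_linear_coefficients[OF assms, symmetric])
  finally show ?thesis .
qed

lemma nlc_linear_smooth:
  fixes \<Gamma> :: "real^'n \<Rightarrow> 'n \<Rightarrow> 'n \<Rightarrow> 'n \<Rightarrow> real"
  assumes "\<And>x y k i. (x, y) \<in> C \<Longrightarrow> nlc L (x, y) k i = (\<Sum>j\<in>UNIV. \<Gamma> x k i j * y $ j)"
    and U: "\<And>x. x \<in> U \<Longrightarrow> \<exists>y. (x, y) \<in> C"
  shows "smooth_on U (\<lambda>x. \<Gamma> x k i j)"
proof (rule smooth_on_local)
  fix x assume "x \<in> U"
  then obtain y where y: "(x, y) \<in> C" using U by blast
  have lin: "bounded_linear (\<lambda>x::real^'n. (x, 0::real^'n))"
    by (intro bounded_linear_Pair bounded_linear_ident bounded_linear_zero)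
  \<comment> \<open>With y held fixed, (x', y) stays in \<open>C\<close> for x' near x, and the
    formula for the coefficients is used at this same y throughout the neighbourhood.\<close>
  let ?T = "(\<lambda>x. (0, y) + (x, 0)) -` C"
  have T: "open ?T"
    by (intro open_vimage open_C continuous_intros)
  have "smooth_on ?T (\<lambda>x. 1/4 * py j (py i (spray L k)) ((0, y) + (x, 0)))"
    by (intro smooth_on_affine[OF lin open_C, of "\<lambda>z. 1/4 * py j (py i (spray L k)) z"]
        smooth_C smooth_spray)
  then have "smooth_on ?T (\<lambda>x. \<Gamma> x k i j)"
    by (rule smooth_on_transfer[OF T]) (use nlc_linear_coefficients[of \<Gamma>, OF assms(1)] in auto)
  then show "\<exists>T. open T \<and> x \<in> T \<and> smooth_on T (\<lambda>x. \<Gamma> x k i j)"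
    using T y by (intro exI[of _ ?T]) auto
qed

end

section \<open>Changes of coordinates\<close>

text \<open>The pair (u, - \<open>gam \<Gamma> u y\<close>) is the horizontal lift of u to the point
  (x, y). A function is parallel if its derivative along all these pairs is 0.\<close>

definition gam :: "('n::finite \<Rightarrow> 'n \<Rightarrow> 'n \<Rightarrow> real) \<Rightarrow> real^'n \<Rightarrow> real^'n \<Rightarrow> real^'n" where
  "gam \<Gamma> u y = (\<chi> k. \<Sum>i\<in>UNIV. \<Sum>j\<in>UNIV. \<Gamma> k i j * u $ i * y $ j)"

lemma gam_axis: "gam \<Gamma> (axis i 1) y $ k = (\<Sum>j\<in>UNIV. \<Gamma> k i j * y $ j)"
proof -
  have "gam \<Gamma> (axis i 1) y $ k = (\<Sum>l\<in>UNIV. axis i 1 $ l * (\<Sum>j\<in>UNIV. \<Gamma> k l j * y $ j))"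
    by (simp add: gam_def sum_distrib_left mult_ac)
  then show ?thesis by (simp only: sum_axis_mult)
qed

lemma gam_axis_axis: "gam \<Gamma> (axis i 1) (axis j 1) $ k = \<Gamma> k i j"
  using sum_axis_mult[of j "\<Gamma> k i"] by (simp add: gam_axis mult.commute)

lemma gam_eq_sum: "gam \<Gamma> u y = (\<Sum>i\<in>UNIV. u $ i *\<^sub>R gam \<Gamma> (axis i 1) y)"
  by (simp add: vec_eq_iff gam_axis sum_distrib_left sum_component) (simp add: gam_def mult_ac)

lemma bilinear_gam: "bilinear (gam \<Gamma>)"
  unfolding bilinear_def
  by (intro conjI allI linearI)
    (simp_all add: vec_eq_iff gam_def sum.distrib distrib_left distrib_right sum_distrib_left mult_ac)

text \<open>This allows connection coefficients to be defined through a bilinear map without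
  coordinates, as for the pulled back connection in \<open>berwald_transformation\<close>.\<close>

lemma bilinear_eq_gam:
  assumes "bilinear (B :: real^'n::finite \<Rightarrow> real^'n \<Rightarrow> real^'n)"
  shows "gam (\<lambda>k i j. B (axis i 1) (axis j 1) $ k) u y = B u y"
proof -
  have lin: "linear (\<lambda>u. B u y)" "linear (B u)" for u y
    using assms by (auto simp: bilinear_def)
  have expand: "f v = (\<Sum>i\<in>UNIV. v $ i *\<^sub>R f (axis i 1))" if "linear f" for f :: "real^'n \<Rightarrow> real^'n" and v
  proof -
    interpret linear f by fact
    have "f (\<Sum>i\<in>UNIV. v $ i *\<^sub>R axis i 1) = (\<Sum>i\<in>UNIV. v $ i *\<^sub>R f (axis i 1))"
      by (simp add: sum scaleR)
    then show ?thesis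
      using basis_expansion[of v] by (simp add: scalar_mult_eq_scaleR)
  qed
  have "B u y = (\<Sum>i\<in>UNIV. u $ i *\<^sub>R B (axis i 1) y)"
    by (rule expand[OF lin(1)])
  also have "\<dots> = (\<Sum>i\<in>UNIV. u $ i *\<^sub>R (\<Sum>j\<in>UNIV. y $ j *\<^sub>R B (axis i 1) (axis j 1)))"
    by (subst expand[OF lin(2), of _ y]) (rule refl)
  finally have "B u y = (\<Sum>i\<in>UNIV. u $ i *\<^sub>R (\<Sum>j\<in>UNIV. y $ j *\<^sub>R B (axis i 1) (axis j 1)))" .
  then show ?thesis
    by (simp add: vec_eq_iff gam_def sum_component sum_distrib_left mult_ac)
qed

lemma linear_eq_on_open:
  fixes f :: "real^'n::finite \<Rightarrow> real"
  assumes "linear f" "open W" "y \<in> W" "\<And>z. z \<in> W \<Longrightarrow> f z = 0"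
  shows "f v = 0"
proof -
  obtain e where e: "e > 0" "ball y e \<subseteq> W"
    using assms openE by blast
  \<comment> \<open>Chosen so that t v is shorter than e; the summand 1 covers v = 0.\<close>
  define t where "t = e / (2 * (norm v + 1))"
  have pos: "norm v + 1 > 0" by (simp add: add_nonneg_pos)
  then have t: "t > 0" using e by (simp add: t_def)
  have "t * norm v < t * (2 * (norm v + 1))"
    using t pos by (intro mult_strict_left_mono) (auto simp: add_pos_nonneg)
  then have t': "t * norm v < e"
    using pos by (simp add: t_def)
  have "y + t *\<^sub>R v \<in> ball y e"
    using t t' by (simp add: dist_norm)
  then have "f (y + t *\<^sub>R v) = 0"
    using e assms by blast
  then show ?thesis
    using assms(3,4) t by (simp add: linear_add[OF assms(1)] linear_scale[OF assms(1)])
qed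

lemma coefficients_eq_on_open:
  fixes p q :: "'n::finite \<Rightarrow> real"
  assumes "open W" "y \<in> W"
    "\<And>y::real^'n. y \<in> W \<Longrightarrow> (\<Sum>j\<in>UNIV. p j * y $ j) = (\<Sum>j\<in>UNIV. q j * y $ j)"
  shows "p j = q j"
proof -
  let ?f = "\<lambda>y::real^'n. \<Sum>j\<in>UNIV. (p j - q j) * y $ j"
  have "linear ?f"
    by (rule linearI) (simp_all add: sum.distrib distrib_left sum_distrib_left mult_ac)
  then have "?f (axis j 1) = 0"
    by (rule linear_eq_on_open[OF _ assms(1,2)])
      (use assms(3) in \<open>simp add: left_diff_distrib sum_subtractf\<close>)
  then show ?thesis
    using sum_axis_mult[of j "\<lambda>j. p j - q j"] by (simp add: mult.commute)
qed

lemma dird_gam_expand: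
  fixes h :: "(real^'n::finite) \<times> (real^'n) \<Rightarrow> real"
  assumes "h differentiable (at (x, y))"
  shows "dird h (x, y) (u, - gam \<Gamma> u y) =
    (\<Sum>i\<in>UNIV. u $ i * dird h (x, y) (axis i 1, - gam \<Gamma> (axis i 1) y))"
proof -
  interpret linear "dird h (x, y)" by (rule linear_dird[OF assms])
  have pair: "(u, - gam \<Gamma> u y) = (\<Sum>i\<in>UNIV. u $ i *\<^sub>R (axis i 1, - gam \<Gamma> (axis i 1) y))"
    using basis_expansion[of u] gam_eq_sum[of \<Gamma> u y]
    by (simp add: sum_prod scalar_mult_eq_scaleR sum_negf)
  show ?thesis
    by (subst pair) (simp add: sum scaleR del: scaleR_Pair)
qed

lemma parallel_iff_axis:
  fixes h :: "(real^'n::finite) \<times> (real^'n) \<Rightarrow> real"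
  assumes "h differentiable (at (x, y))"
  shows "(\<forall>u. dird h (x, y) (u, - gam \<Gamma> u y) = 0) \<longleftrightarrow>
    (\<forall>i. dird h (x, y) (axis i 1, - gam \<Gamma> (axis i 1) y) = 0)" (is "?l \<longleftrightarrow> ?r")
proof
  assume ?r
  then show ?l by (subst dird_gam_expand[OF assms]) simp
qed blast

text \<open>Links the horizontal lifts, which behave well under coordinate changes, with the index
  form in \<open>nlc_parallel\<close> and \<open>nlc_unique\<close>.\<close>

lemma parallel_iff:
  assumes "h differentiable (at (x, y))"
  shows "(\<forall>u. dird h (x, y) (u, - gam \<Gamma> u y) = 0) \<longleftrightarrow>
    (\<forall>i. px i h (x, y) = (\<Sum>k\<in>UNIV. \<Sum>j\<in>UNIV. \<Gamma> k i j * y $ j * py k h (x, y)))"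
proof -
  have *: "dird h (x, y) (axis i 1, - gam \<Gamma> (axis i 1) y) =
      px i h (x, y) - (\<Sum>k\<in>UNIV. \<Sum>j\<in>UNIV. \<Gamma> k i j * y $ j * py k h (x, y))" for i
    by (subst dird_Pair[OF assms]) (simp add: sum_axis_mult gam_axis sum_distrib_right sum_negf)
  show ?thesis
    unfolding parallel_iff_axis[OF assms] * by simp
qed

section \<open>The tangent map of a coordinate change\<close>

lemma dird_nth:
  "f differentiable (at x) \<Longrightarrow> dird (\<lambda>x. f x $ c) x v = dird f x v $ c"
  by (rule dird_eqI)
    (rule bounded_linear.has_derivative[OF bounded_linear_vec_nth has_derivative_dird])

lemma dird_dird_nth:
  assumes "open S" "smooth_on S X" "x \<in> S"
  shows "dird (\<lambda>x. dird (\<lambda>x. X x $ c) x v) x u = dird (\<lambda>x. dird X x v) x u $ c"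
proof -
  have "dird (\<lambda>x. dird (\<lambda>x. X x $ c) x v) x u = dird (\<lambda>x. dird X x v $ c) x u"
    by (rule dird_cong_at[OF assms(1,3)]) (rule dird_nth[OF smooth_on_differentiable[OF assms(2)]])
  also have "\<dots> = dird (\<lambda>x. dird X x v) x u $ c"
    by (rule dird_nth) (rule smooth_on_differentiable[OF smooth_on_dird[OF assms(2)] assms(3)])
  finally show ?thesis .
qed

lemma dird_commute_vec:
  fixes X :: "'a::real_normed_vector \<Rightarrow> real^'m::finite"
  assumes "open S" "smooth_on S X" "x \<in> S"
  shows "dird (\<lambda>x. dird X x v) x u = dird (\<lambda>x. dird X x u) x v"
  using dird_commute[OF assms(1) smooth_on_vec_nth[OF assms(2,1)] assms(3)]
  by (simp add: vec_eq_iff flip: dird_dird_nth[OF assms])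

lemma dird_dird_eq_sum:
  fixes X :: "real^'n::finite \<Rightarrow> real^'m::finite"
  assumes "open S" "smooth_on S X" "x \<in> S"
  shows "dird (\<lambda>x. dird X x y) x u = (\<Sum>i\<in>UNIV. y $ i *\<^sub>R dird (\<lambda>x. dird X x (axis i 1)) x u)"
proof -
  have "dird (\<lambda>x. dird X x y) x u = dird (\<lambda>x. \<Sum>i\<in>UNIV. y $ i *\<^sub>R dird X x (axis i 1)) x u"
    by (rule dird_cong_at[OF assms(1,3)])
      (rule dird_basis_expansion[OF smooth_on_differentiable[OF assms(2)]])
  also have "\<dots> = (\<Sum>i\<in>UNIV. y $ i *\<^sub>R dird (\<lambda>x. dird X x (axis i 1)) x u)"
    by (rule dird_eqI) (intro has_derivative_sum has_derivative_scaleR_right has_derivative_dird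
        smooth_on_differentiable[OF smooth_on_dird[OF assms(2)] assms(3)])
  finally show ?thesis .
qed

lemma linear_dird_dird:
  fixes X :: "real^'n::finite \<Rightarrow> real^'m::finite"
  assumes "open S" "smooth_on S X" "x \<in> S"
  shows "linear (\<lambda>y. dird (\<lambda>x. dird X x y) x u)" "linear (\<lambda>u. dird (\<lambda>x. dird X x y) x u)"
proof -
  show "linear (\<lambda>u. dird (\<lambda>x. dird X x y) x u)" for y
    by (rule linear_dird[OF smooth_on_differentiable[OF smooth_on_dird[OF assms(2)] assms(3)]])
  then show "linear (\<lambda>y. dird (\<lambda>x. dird X x y) x u)"
    by (subst dird_commute_vec[OF assms])
qed

lemma has_derivative_pullback:
  fixes X :: "real^'n::finite \<Rightarrow> real^'n" and h :: "(real^'n) \<times> (real^'n) \<Rightarrow> real"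
  assumes "open S" "smooth_on S X" "x \<in> S" and h: "h differentiable (at (X x, dird X x y))"
  shows "((\<lambda>z. h (X (fst z), dird X (fst z) (snd z))) has_derivative
    (\<lambda>w. dird h (X x, dird X x y)
      (dird X x (fst w), dird (\<lambda>x. dird X x y) x (fst w) + dird X x (snd w)))) (at (x, y))"
proof -
  let ?D = "\<lambda>i x. dird X x (axis i 1)"
  have X: "X differentiable (at x)" and D: "?D i differentiable (at x)" for i
    using assms smooth_on_differentiable smooth_on_dird by blast+
  have 1: "((\<lambda>z::(real^'n)\<times>(real^'n). X (fst z)) has_derivative (\<lambda>w. dird X x (fst w))) (at (x, y))"
    by (rule has_derivative_compose[where f=fst and g=X])
      (auto intro!: derivative_eq_intros has_derivative_dird X)
  have D': "((\<lambda>z::(real^'n)\<times>(real^'n). ?D i (fst z)) has_derivative (\<lambda>w. dird (?D i) x (fst w))) (at (x, y))" for i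
    by (rule has_derivative_compose[where f=fst and g="?D i"])
      (auto intro!: derivative_eq_intros has_derivative_dird D)
  \<comment> \<open>Expanding \<open>dird X x y\<close> in the coordinate vectors separates x from
    y, so that joint differentiability follows from the product rule.\<close>
  have "((\<lambda>z. \<Sum>i\<in>UNIV. snd z $ i *\<^sub>R ?D i (fst z)) has_derivative
      (\<lambda>w. \<Sum>i\<in>UNIV. y $ i *\<^sub>R dird (?D i) x (fst w) + snd w $ i *\<^sub>R ?D i x)) (at (x, y))"
  proof (rule has_derivative_sum)
    fix i
    have "((\<lambda>z::(real^'n)\<times>(real^'n). snd z $ i) has_derivative (\<lambda>w. snd w $ i)) (at (x, y))"
      by (rule bounded_linear_imp_has_derivative[OF bounded_linear_snd_nth])
    from has_derivative_scaleR[OF this D'[of i]]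
    show "((\<lambda>z. snd z $ i *\<^sub>R ?D i (fst z)) has_derivative
      (\<lambda>w. y $ i *\<^sub>R dird (?D i) x (fst w) + snd w $ i *\<^sub>R ?D i x)) (at (x, y))"
      by simp
  qed
  then have 2: "((\<lambda>z. \<Sum>i\<in>UNIV. snd z $ i *\<^sub>R ?D i (fst z)) has_derivative
      (\<lambda>w. dird (\<lambda>x. dird X x y) x (fst w) + dird X x (snd w))) (at (x, y))"
    by (simp add: sum.distrib dird_dird_eq_sum[OF assms(1-3), of y] dird_basis_expansion[OF X, of "snd _"])
  have 3: "((\<lambda>z. dird X (fst z) (snd z)) has_derivative
      (\<lambda>w. dird (\<lambda>x. dird X x y) x (fst w) + dird X x (snd w))) (at (x, y))"
    by (rule has_derivative_transform_within_open[OF 2, of "S \<times> UNIV"])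
      (use assms(1-3) dird_basis_expansion[OF smooth_on_differentiable[OF assms(2)]] in
        \<open>auto intro: open_Times\<close>)
  show ?thesis
    using has_derivative_compose[OF has_derivative_Pair[OF 1 3], of h] has_derivative_dird[OF h]
    by simp
qed

text \<open>The hypothesis \<open>law\<close> is the transformation law of connection coefficients.
  It says that the tangent map of X sends the horizontal lift of u for \<open>\<Gamma>'\<close> to
  the horizontal lift of \<open>dird X x u\<close> for \<open>\<Gamma>\<close>.\<close>

lemma dird_pullback_parallel:
  fixes X :: "real^'n::finite \<Rightarrow> real^'n" and h h' :: "(real^'n) \<times> (real^'n) \<Rightarrow> real"
  assumes "open S" "smooth_on S X" "x \<in> S" and h: "h differentiable (at (X x, dird X x y))"
    and T: "open T" "(x, y) \<in> T" "\<And>x y. (x, y) \<in> T \<Longrightarrow> h' (x, y) = h (X x, dird X x y)"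
    and law: "dird X x (gam \<Gamma>' u y) =
      dird (\<lambda>x. dird X x y) x u + gam \<Gamma> (dird X x u) (dird X x y)"
  shows "dird h' (x, y) (u, - gam \<Gamma>' u y) =
    dird h (X x, dird X x y) (dird X x u, - gam \<Gamma> (dird X x u) (dird X x y))"
proof -
  have "dird h' (x, y) (u, - gam \<Gamma>' u y) =
      dird (\<lambda>z. h (X (fst z), dird X (fst z) (snd z))) (x, y) (u, - gam \<Gamma>' u y)"
    by (rule dird_cong_at[OF T(1,2)]) (use T(3) in auto)
  also have "\<dots> = dird h (X x, dird X x y)
      (dird X x u, dird (\<lambda>x. dird X x y) x u + dird X x (- gam \<Gamma>' u y))"
    by (simp add: dird_eqI[OF has_derivative_pullback[OF assms(1-3) h]])
  also have "dird X x (- gam \<Gamma>' u y) = - dird X x (gam \<Gamma>' u y)"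
    by (rule linear_neg[OF linear_dird[OF smooth_on_differentiable[OF assms(2,3)]]])
  finally show ?thesis by (simp add: law)
qed

section \<open>Charts and tangent vectors\<close>

abbreviation overlap :: "('m, 'n) chart \<Rightarrow> ('m, 'n) chart \<Rightarrow> (real^'n) set" where
  "overlap \<kappa> \<mu> \<equiv> chart_map \<kappa> ` (chart_dom \<kappa> \<inter> chart_dom \<mu>)"

locale smooth_manifold =
  fixes M :: "('m::{t2_space,second_countable_topology}, 'n::finite) chart set"
  assumes smooth_atlas: "smooth_atlas M"
begin

lemma is_chart: "\<kappa> \<in> M \<Longrightarrow> is_chart \<kappa>"
  using smooth_atlas by (simp add: smooth_atlas_def)

lemma chart_inv_mem: "x \<in> chart_img \<kappa> \<Longrightarrow> chart_inv \<kappa> x \<in> chart_dom \<kappa>"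
  by (rule inv_into_into)

lemma chart_map_inv: "x \<in> chart_img \<kappa> \<Longrightarrow> chart_map \<kappa> (chart_inv \<kappa> x) = x"
  by (rule f_inv_into_f)

lemma chart_inv_map: "\<kappa> \<in> M \<Longrightarrow> p \<in> chart_dom \<kappa> \<Longrightarrow> chart_inv \<kappa> (chart_map \<kappa> p) = p"
  using is_chart by (auto simp: is_chart_def homeomorphism_def)

lemma open_chart_img: "\<kappa> \<in> M \<Longrightarrow> open (chart_img \<kappa>)"
  using is_chart by (auto simp: is_chart_def)

lemma chart_exists: "\<exists>\<kappa>\<in>M. p \<in> chart_dom \<kappa>"
  using smooth_atlas by (auto simp: smooth_atlas_def)

lemma overlap_eq: "\<kappa> \<in> M \<Longrightarrow> overlap \<kappa> \<mu> = {x \<in> chart_img \<kappa>. chart_inv \<kappa> x \<in> chart_dom \<mu>}"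
  using chart_inv_map chart_map_inv chart_inv_mem by (auto 4 3 simp: image_iff)

lemma open_overlap:
  assumes "\<kappa> \<in> M" "\<mu> \<in> M"
  shows "open (overlap \<kappa> \<mu>)"
proof -
  have "continuous_on (chart_img \<kappa>) (chart_inv \<kappa>)" "open (chart_dom \<mu>)"
    using is_chart assms by (auto simp: is_chart_def homeomorphism_def)
  then have "open (chart_img \<kappa> \<inter> chart_inv \<kappa> -` chart_dom \<mu>)"
    using continuous_open_preimage open_chart_img assms(1) by blast
  then show ?thesis
    unfolding overlap_eq[OF assms(1)] by (simp add: vimage_def Int_def)
qed

lemma chart_inv_transition:
  assumes "\<kappa> \<in> M" "\<mu> \<in> M" "x \<in> overlap \<kappa> \<mu>"
  shows "chart_inv \<mu> (transition \<kappa> \<mu> x) = chart_inv \<kappa> x"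
  using assms chart_inv_map by (auto simp: transition_def)

lemma transition_overlap:
  assumes "\<kappa> \<in> M" "\<mu> \<in> M" "x \<in> overlap \<kappa> \<mu>"
  shows "transition \<kappa> \<mu> x \<in> overlap \<mu> \<kappa>"
  using assms chart_inv_map by (auto simp: transition_def)

lemma transition_cocycle:
  assumes "\<kappa> \<in> M" "\<mu> \<in> M" "x \<in> overlap \<kappa> \<mu>"
  shows "transition \<mu> \<nu> (transition \<kappa> \<mu> x) = transition \<kappa> \<nu> x"
  using chart_inv_transition[OF assms] by (simp add: transition_def)

lemma smooth_transition:
  assumes "\<kappa> \<in> M" "\<mu> \<in> M"
  shows "smooth_on (overlap \<kappa> \<mu>) (transition \<kappa> \<mu>)"
  using smooth_atlas assms by (auto simp: smooth_atlas_def)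

lemma differentiable_transition:
  assumes "\<kappa> \<in> M" "\<mu> \<in> M" "x \<in> overlap \<kappa> \<mu>"
  shows "transition \<kappa> \<mu> differentiable (at x)"
  using smooth_on_differentiable[OF smooth_transition] assms by blast

lemma linear_dird_transition:
  assumes "\<kappa> \<in> M" "\<mu> \<in> M" "x \<in> overlap \<kappa> \<mu>"
  shows "linear (dird (transition \<kappa> \<mu>) x)"
  using linear_dird[OF differentiable_transition[OF assms]] .

lemma dird_transition_cocycle:
  assumes "\<kappa> \<in> M" "\<mu> \<in> M" "\<nu> \<in> M" "x \<in> overlap \<kappa> \<mu>" "x \<in> overlap \<kappa> \<nu>"
  shows "dird (transition \<kappa> \<nu>) x v = dird (transition \<mu> \<nu>) (transition \<kappa> \<mu> x) (dird (transition \<kappa> \<mu>) x v)"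
proof -
  have "chart_inv \<kappa> x \<in> chart_dom \<mu> \<inter> chart_dom \<nu>"
    using assms(4,5) unfolding overlap_eq[OF assms(1)] by blast
  then have "transition \<kappa> \<mu> x \<in> overlap \<mu> \<nu>"
    unfolding transition_def o_def by (rule imageI)
  then have "((\<lambda>x. transition \<mu> \<nu> (transition \<kappa> \<mu> x)) has_derivative
      (\<lambda>v. dird (transition \<mu> \<nu>) (transition \<kappa> \<mu> x) (dird (transition \<kappa> \<mu>) x v))) (at x)"
    using assms by (intro has_derivative_compose[OF has_derivative_dird has_derivative_dird]
        differentiable_transition)
  then have "dird (\<lambda>x. transition \<mu> \<nu> (transition \<kappa> \<mu> x)) x v =
      dird (transition \<mu> \<nu>) (transition \<kappa> \<mu> x) (dird (transition \<kappa> \<mu>) x v)"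
    by (rule dird_eqI)
  moreover have "dird (\<lambda>x. transition \<mu> \<nu> (transition \<kappa> \<mu> x)) x v = dird (transition \<kappa> \<nu>) x v"
    by (rule dird_cong_at[OF open_overlap[OF assms(1,2)] assms(4)])
      (rule transition_cocycle[OF assms(1,2)])
  ultimately show ?thesis by simp
qed

lemma dird_transition_self:
  assumes "\<kappa> \<in> M" "x \<in> chart_img \<kappa>"
  shows "dird (transition \<kappa> \<kappa>) x v = v"
proof -
  have "dird (transition \<kappa> \<kappa>) x v = dird (\<lambda>x. x) x v"
    by (rule dird_cong_at[OF open_chart_img[OF assms(1)] assms(2)])
      (simp add: transition_def chart_map_inv)
  then show ?thesis by (simp add: dird_bounded_linear bounded_linear_ident)
qed

lemma dird_transition_inverse:
  assumes "\<kappa> \<in> M" "\<mu> \<in> M" "x \<in> overlap \<kappa> \<mu>"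
  shows "dird (transition \<mu> \<kappa>) (transition \<kappa> \<mu> x) (dird (transition \<kappa> \<mu>) x v) = v"
    "dird (transition \<kappa> \<mu>) x (dird (transition \<mu> \<kappa>) (transition \<kappa> \<mu> x) v) = v"
proof -
  have x: "x \<in> overlap \<kappa> \<kappa>" "x \<in> chart_img \<kappa>" and x': "transition \<kappa> \<mu> x \<in> overlap \<mu> \<kappa>"
    "transition \<kappa> \<mu> x \<in> overlap \<mu> \<mu>" "transition \<kappa> \<mu> x \<in> chart_img \<mu>"
    using assms(3) transition_overlap[OF assms] by auto
  show "dird (transition \<mu> \<kappa>) (transition \<kappa> \<mu> x) (dird (transition \<kappa> \<mu>) x v) = v"
    using dird_transition_cocycle[OF assms(1,2,1,3) x(1)] dird_transition_self assms(1) x(2) by simp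
  have "transition \<mu> \<kappa> (transition \<kappa> \<mu> x) = x"
    using transition_cocycle[OF assms] x(2) by (simp add: transition_def chart_map_inv)
  then show "dird (transition \<kappa> \<mu>) x (dird (transition \<mu> \<kappa>) (transition \<kappa> \<mu> x) v) = v"
    using dird_transition_cocycle[OF assms(2,1,2) x'(1,2)] dird_transition_self assms(2) x'(3) by simp
qed

lemma tvec_eval:
  assumes "\<kappa> \<in> M" "x \<in> chart_img \<kappa>"
  shows "tvec M \<kappa> x y \<mu> = (if \<mu> \<in> M \<and> x \<in> overlap \<kappa> \<mu> then dird (transition \<kappa> \<mu>) x y else 0)"
  using assms by (auto simp: tvec_def overlap_eq)

lemma tvec_self: "\<kappa> \<in> M \<Longrightarrow> x \<in> chart_img \<kappa> \<Longrightarrow> tvec M \<kappa> x y \<kappa> = y"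
  by (simp add: tvec_eval dird_transition_self)

lemma tvec_tangent:
  assumes "\<kappa> \<in> M" "x \<in> chart_img \<kappa>"
  shows "tvec M \<kappa> x y \<in> tangent_space M (chart_inv \<kappa> x)"
  unfolding tangent_space_def
proof (intro CollectI conjI allI ballI impI)
  show "tvec M \<kappa> x y \<mu> = 0" if "\<mu> \<notin> M \<or> chart_inv \<kappa> x \<notin> chart_dom \<mu>" for \<mu>
    using that by (auto simp: tvec_def)
  show "tvec M \<kappa> x y \<nu> = dird (transition \<mu> \<nu>) (chart_map \<mu> (chart_inv \<kappa> x)) (tvec M \<kappa> x y \<mu>)"
    if "\<mu> \<in> M" "\<nu> \<in> M" "chart_inv \<kappa> x \<in> chart_dom \<mu> \<and> chart_inv \<kappa> x \<in> chart_dom \<nu>" for \<mu> \<nu>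
  proof -
    have x: "x \<in> overlap \<kappa> \<mu>" "x \<in> overlap \<kappa> \<nu>"
      unfolding overlap_eq[OF assms(1)] using that assms(2) by blast+
    have 1: "tvec M \<kappa> x y \<mu> = dird (transition \<kappa> \<mu>) x y"
      "tvec M \<kappa> x y \<nu> = dird (transition \<kappa> \<nu>) x y"
      using that by (simp_all add: tvec_def)
    have 2: "transition \<kappa> \<mu> x = chart_map \<mu> (chart_inv \<kappa> x)"
      by (simp add: transition_def)
    show ?thesis
      unfolding 1 2[symmetric] by (rule dird_transition_cocycle[OF assms(1) that(1,2) x])
  qed
qed

text \<open>A tangent vector is a family over all charts, but the Jacobians determine it from one
  component. This is what permits working in a single chart.\<close>

lemma tangent_eq_tvec:
  assumes "v \<in> tangent_space M p" "\<kappa> \<in> M" "p \<in> chart_dom \<kappa>"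
  shows "v = tvec M \<kappa> (chart_map \<kappa> p) (v \<kappa>)"
proof (rule ext)
  fix \<mu>
  have eq: "tvec M \<kappa> (chart_map \<kappa> p) (v \<kappa>) \<mu> = (if \<mu> \<in> M \<and> p \<in> chart_dom \<mu>
      then dird (transition \<kappa> \<mu>) (chart_map \<kappa> p) (v \<kappa>) else 0)"
    unfolding tvec_def chart_inv_map[OF assms(2,3)] ..
  show "v \<mu> = tvec M \<kappa> (chart_map \<kappa> p) (v \<kappa>) \<mu>"
  proof (cases "\<mu> \<in> M \<and> p \<in> chart_dom \<mu>")
    case True
    then show ?thesis
      unfolding eq if_P[OF True] using assms unfolding tangent_space_def by blast
  next
    case False
    then show ?thesis
      unfolding eq if_not_P[OF False] using assms(1) unfolding tangent_space_def by blast
  qed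
qed

lemma tvec_change:
  assumes "\<kappa> \<in> M" "\<mu> \<in> M" "x \<in> overlap \<kappa> \<mu>"
  shows "tvec M \<kappa> x y = tvec M \<mu> (transition \<kappa> \<mu> x) (dird (transition \<kappa> \<mu>) x y)"
proof -
  have x: "x \<in> chart_img \<kappa>" "chart_inv \<kappa> x \<in> chart_dom \<mu>"
    using assms by (auto simp: overlap_eq)
  have 1: "tvec M \<kappa> x y \<mu> = dird (transition \<kappa> \<mu>) x y"
    using assms(2) x(2) by (simp add: tvec_def)
  have 2: "transition \<kappa> \<mu> x = chart_map \<mu> (chart_inv \<kappa> x)"
    by (simp add: transition_def)
  show ?thesis
    using tangent_eq_tvec[OF tvec_tangent[OF assms(1) x(1)] assms(2) x(2), of y]
    unfolding 1 2 .
qed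

lemma tvec_linear:
  assumes "\<kappa> \<in> M" "x \<in> chart_img \<kappa>"
  shows "linear (\<lambda>y. tvec M \<kappa> x y \<mu>)"
proof (cases "\<mu> \<in> M \<and> x \<in> overlap \<kappa> \<mu>")
  case True
  then show ?thesis
    using linear_dird_transition[OF assms(1), of \<mu> x] unfolding tvec_eval[OF assms] by simp
next
  case False
  then show ?thesis
    unfolding tvec_eval[OF assms] by (simp only: if_False linear_zero)
qed

lemma tvec_scale:
  assumes "\<kappa> \<in> M" "x \<in> chart_img \<kappa>"
  shows "tvec M \<kappa> x (r *\<^sub>R y) = (\<lambda>\<mu>. r *\<^sub>R tvec M \<kappa> x y \<mu>)"
  using linear_scale[OF tvec_linear[OF assms]] by (simp add: fun_eq_iff)

end

section \<open>Berwald manifolds\<close>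

lemma partial_fst: "h differentiable (at (x, y)) \<Longrightarrow> partial i (\<lambda>x. h (x, y)) x = px i h (x, y)"
  unfolding partial_def by (rule dird_fst)

lemma partial_snd: "h differentiable (at (x, y)) \<Longrightarrow> partial i (\<lambda>y. h (x, y)) y = py i h (x, y)"
  unfolding partial_def by (rule dird_snd)

lemma partial_cong:
  "open S \<Longrightarrow> x \<in> S \<Longrightarrow> (\<And>z. z \<in> S \<Longrightarrow> f z = g z) \<Longrightarrow> partial i f x = partial i g x"
  unfolding partial_def by (rule dird_cong_at)

lemma open_fibres:
  assumes "open C"
  shows "open {x. (x, y) \<in> C}" "open {y. (x, y) \<in> C}"
proof -
  have "open ((\<lambda>x. (x, y)) -` C)" "open (Pair x -` C)"
    using assms by (auto intro!: open_vimage continuous_intros)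
  then show "open {x. (x, y) \<in> C}" "open {y. (x, y) \<in> C}"
    by (simp_all add: vimage_def)
qed

text \<open>\<open>nonlinear_connection\<close> differentiates in one argument with the other one
  fixed, while derivatives are exchanged for functions on the product. The identification must hold
  on a neighbourhood, since the inner derivative is differentiated again.\<close>

lemma partial_partial:
  assumes "open C" "smooth_on C h" "(x, y) \<in> C"
  shows "partial i (\<lambda>y. partial j (\<lambda>y. h (x, y)) y) y = py i (py j h) (x, y)"
    and "partial i (\<lambda>x. partial j (\<lambda>y. h (x, y)) y) x = px i (py j h) (x, y)"
proof -
  note d = smooth_on_differentiable[OF assms(2)]
  have d': "py j h differentiable (at (x, y))"
    by (rule smooth_on_differentiable[OF smooth_on_dird[OF assms(2)] assms(3)])
  have "partial i (\<lambda>y. partial j (\<lambda>y. h (x, y)) y) y = partial i (\<lambda>y. py j h (x, y)) y"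
    by (rule partial_cong[OF open_fibres(2)[OF assms(1)]]) (use assms(3) d in \<open>auto intro: partial_snd\<close>)
  then show "partial i (\<lambda>y. partial j (\<lambda>y. h (x, y)) y) y = py i (py j h) (x, y)"
    using partial_snd[OF d'] by simp
  have "partial i (\<lambda>x. partial j (\<lambda>y. h (x, y)) y) x = partial i (\<lambda>x. py j h (x, y)) x"
    by (rule partial_cong[OF open_fibres(1)[OF assms(1)]]) (use assms(3) d in \<open>auto intro: partial_snd\<close>)
  then show "partial i (\<lambda>x. partial j (\<lambda>y. h (x, y)) y) x = px i (py j h) (x, y)"
    using partial_fst[OF d'] by simp
qed

locale finsler_manifold = smooth_manifold M
  for M :: "('m::{t2_space,second_countable_topology}, 'n::finite) chart set" +
  fixes A :: "('m \<times> ('m, 'n) tvector) set" and F :: "'m \<Rightarrow> ('m, 'n) tvector \<Rightarrow> real"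
  assumes conic: "conic_subbundle M A" and finsler: "finsler_metric M A F"
begin

abbreviation tcone where "tcone \<kappa> \<equiv> chart_cone M A \<kappa>"

definition LL where "LL \<kappa> z = Lcomp M F \<kappa> (fst z) (snd z)"

lemma LL_Pair: "LL \<kappa> (x, y) = Lcomp M F \<kappa> x y"
  by (simp add: LL_def)

lemma cone_img: "(x, y) \<in> tcone \<kappa> \<Longrightarrow> x \<in> chart_img \<kappa>"
  by (auto simp: chart_cone_def)

lemma open_cone: "\<kappa> \<in> M \<Longrightarrow> open (tcone \<kappa>)"
  using conic by (simp add: conic_subbundle_def)

lemma cone_nonempty:
  assumes "\<kappa> \<in> M" "x \<in> chart_img \<kappa>"
  obtains y where "(x, y) \<in> tcone \<kappa>"
proof -
  have "chart_inv \<kappa> x \<in> fst ` A"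
    using conic by (simp add: conic_subbundle_def)
  then obtain v where v: "(chart_inv \<kappa> x, v) \<in> A" by auto
  then have "v \<in> tangent_space M (chart_inv \<kappa> x)"
    using conic by (auto simp: conic_subbundle_def)
  then have "tvec M \<kappa> x (v \<kappa>) = v"
    using tangent_eq_tvec[OF _ assms(1) chart_inv_mem[OF assms(2)], of v]
    unfolding chart_map_inv[OF assms(2)] by (metis (no_types))
  then have "(x, v \<kappa>) \<in> tcone \<kappa>"
    using v assms(2) by (simp add: chart_cone_def)
  then show thesis by (rule that)
qed

lemma smooth_LL:
  assumes "\<kappa> \<in> M"
  shows "smooth_on (tcone \<kappa>) (LL \<kappa>)"
proof -
  have "smooth_on (tcone \<kappa>) (\<lambda>(x, y). Fcomp M F \<kappa> x y)"
    using finsler assms by (auto simp: finsler_metric_def)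
  from smooth_on_mult[OF open_cone[OF assms] this this] show ?thesis
    by (rule smooth_on_transfer[OF open_cone[OF assms]])
      (simp add: LL_def Lcomp_def power2_eq_square split_beta)
qed

lemma fundamental_tensor_eq:
  assumes "\<kappa> \<in> M" "(x, y) \<in> tcone \<kappa>"
  shows "fundamental_tensor M F \<kappa> x y = fund (LL \<kappa>) (x, y)"
  using partial_partial(1)[OF open_cone smooth_LL, OF assms(1,1,2)]
  by (simp add: fundamental_tensor_def fund_def LL_Pair)

lemma local_finsler:
  assumes "\<kappa> \<in> M"
  shows "local_finsler (LL \<kappa>) (tcone \<kappa>)"
proof
  show "open (tcone \<kappa>)" "smooth_on (tcone \<kappa>) (LL \<kappa>)"
    using assms open_cone smooth_LL by auto
  fix x y and r :: real
  assume xy: "(x, y) \<in> tcone \<kappa>" and r: "r > 0"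
  then have x: "x \<in> chart_img \<kappa>" and A: "(chart_inv \<kappa> x, tvec M \<kappa> x y) \<in> A"
    by (auto simp: chart_cone_def)
  from A r show "(x, r *\<^sub>R y) \<in> tcone \<kappa>"
    using conic x by (auto simp: conic_subbundle_def chart_cone_def tvec_scale assms)
  have "F (chart_inv \<kappa> x) (\<lambda>\<mu>. r *\<^sub>R tvec M \<kappa> x y \<mu>) = r * F (chart_inv \<kappa> x) (tvec M \<kappa> x y)"
    using finsler A r unfolding finsler_metric_def by blast
  then show "LL \<kappa> (x, r *\<^sub>R y) = r\<^sup>2 * LL \<kappa> (x, y)"
    by (simp add: LL_def Lcomp_def Fcomp_def tvec_scale assms x power_mult_distrib)
next
  fix z assume "z \<in> tcone \<kappa>"
  then obtain x y where z: "z = (x, y)" "(x, y) \<in> tcone \<kappa>" by (cases z) auto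
  then have "invertible (fundamental_tensor M F \<kappa> x y)"
    using finsler assms unfolding finsler_metric_def by blast
  then show "invertible (fund (LL \<kappa>) z)"
    using fundamental_tensor_eq[OF assms z(2)] z(1) by simp
qed

lemma nonlinear_connection_eq:
  assumes \<kappa>: "\<kappa> \<in> M" and xy: "(x, y) \<in> tcone \<kappa>"
  shows "nonlinear_connection M F \<kappa> x y k i = nlc (LL \<kappa>) (x, y) k i"
proof -
  interpret local_finsler "LL \<kappa>" "tcone \<kappa>" by (rule local_finsler[OF \<kappa>])
  have "(\<Sum>l\<in>UNIV. matrix_inv (fundamental_tensor M F \<kappa> x y) $ k $ l *
      ((\<Sum>m\<in>UNIV. y $ m * partial m (\<lambda>x. partial l (\<lambda>y. Lcomp M F \<kappa> x y) y) x)
        - partial l (\<lambda>x. Lcomp M F \<kappa> x y) x)) = spray (LL \<kappa>) k (x, y)"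
    if "(x, y) \<in> tcone \<kappa>" for y
    using partial_partial(2)[OF open_cone[OF \<kappa>] smooth_LL[OF \<kappa>] that]
      partial_fst[OF diff_L[OF that]] fundamental_tensor_eq[OF \<kappa> that]
    by (simp add: spray_def semispray_def LL_Pair)
  then have "nonlinear_connection M F \<kappa> x y k i = 1/4 * partial i (\<lambda>y. spray (LL \<kappa>) k (x, y)) y"
    unfolding nonlinear_connection_def
    by (intro arg_cong[of _ _ "\<lambda>t. 1/4 * t"] partial_cong[OF open_fibres(2)[OF open_cone[OF \<kappa>]]])
      (use xy in auto)
  also have "\<dots> = nlc (LL \<kappa>) (x, y) k i"
    using partial_snd[OF smooth_on_differentiable[OF smooth_spray xy]] by (simp add: nlc_def)
  finally show ?thesis .
qed

section \<open>Berwald coefficients and parallelism of L\<close>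

lemma berwald_coefficients_iff:
  "berwald_coefficients M A F \<Gamma> \<longleftrightarrow> (\<forall>\<kappa>\<in>M. \<forall>x y k i. (x, y) \<in> tcone \<kappa> \<longrightarrow>
     nlc (LL \<kappa>) (x, y) k i = (\<Sum>j\<in>UNIV. \<Gamma> \<kappa> x k i j * y $ j))"
proof -
  have *: "(\<forall>(x, y)\<in>S. P x y) \<longleftrightarrow> (\<forall>x y. (x, y) \<in> S \<longrightarrow> P x y)"
    for S and P :: "real^'n \<Rightarrow> real^'n \<Rightarrow> bool"
    by auto
  have "(\<forall>k i. nonlinear_connection M F \<kappa> x y k i = (\<Sum>j\<in>UNIV. \<Gamma> \<kappa> x k i j * y $ j)) \<longleftrightarrow>
      (\<forall>k i. nlc (LL \<kappa>) (x, y) k i = (\<Sum>j\<in>UNIV. \<Gamma> \<kappa> x k i j * y $ j))"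
    if "\<kappa> \<in> M" "(x, y) \<in> tcone \<kappa>" for \<kappa> x y
    unfolding nonlinear_connection_eq[OF that] ..
  then show ?thesis
    unfolding berwald_coefficients_def * by blast
qed

lemma LL_parallel:
  assumes \<Gamma>: "berwald_coefficients M A F \<Gamma>" and \<kappa>: "\<kappa> \<in> M" and xy: "(x, y) \<in> tcone \<kappa>"
  shows "dird (LL \<kappa>) (x, y) (u, - gam (\<Gamma> \<kappa> x) u y) = 0"
proof -
  interpret local_finsler "LL \<kappa>" "tcone \<kappa>" by (rule local_finsler[OF \<kappa>])
  have "px i (LL \<kappa>) (x, y) = (\<Sum>k\<in>UNIV. \<Sum>j\<in>UNIV. \<Gamma> \<kappa> x k i j * y $ j * py k (LL \<kappa>) (x, y))" for i
    unfolding nlc_parallel[OF xy] using \<Gamma> \<kappa> xy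
    by (simp add: berwald_coefficients_iff sum_distrib_right)
  then show ?thesis
    using parallel_iff[OF diff_L[OF xy]] by blast
qed

text \<open>\<open>W\<close> may be a part of the fibre: the coefficients obtained from the Kropina
  condition make L parallel on the vectors of one sign.\<close>

lemma nlc_eq_of_parallel:
  assumes \<kappa>: "\<kappa> \<in> M" and W: "open W" "\<And>y. y \<in> W \<Longrightarrow> (x, y) \<in> tcone \<kappa>"
    and sym: "\<And>k i j. \<Gamma> k i j = \<Gamma> k j i"
    and parallel: "\<And>y u. y \<in> W \<Longrightarrow> dird (LL \<kappa>) (x, y) (u, - gam \<Gamma> u y) = 0"
    and y: "y \<in> W"
  shows "nlc (LL \<kappa>) (x, y) k i = (\<Sum>j\<in>UNIV. \<Gamma> k i j * y $ j)"
proof -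
  interpret local_finsler "LL \<kappa>" "tcone \<kappa>" by (rule local_finsler[OF \<kappa>])
  show ?thesis
    by (rule nlc_unique[OF W sym _ y])
      (use parallel parallel_iff[OF diff_L[OF W(2)]] in blast)+
qed

text \<open>With either set of coefficients N is linear in y, so agreement on an open part of the
  fibre is enough.\<close>

lemma berwald_coefficients_unique:
  assumes \<Gamma>: "berwald_coefficients M A F \<Gamma>" and \<kappa>: "\<kappa> \<in> M"
    and W: "open W" "\<And>y. y \<in> W \<Longrightarrow> (x, y) \<in> tcone \<kappa>"
    and sym: "\<And>k i j. \<Gamma>' k i j = \<Gamma>' k j i"
    and parallel: "\<And>y u. y \<in> W \<Longrightarrow> dird (LL \<kappa>) (x, y) (u, - gam \<Gamma>' u y) = 0"
    and y: "y \<in> W"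
  shows "\<Gamma> \<kappa> x k i j = \<Gamma>' k i j"
proof (rule coefficients_eq_on_open[OF W(1) y])
  fix y assume "y \<in> W"
  then show "(\<Sum>j\<in>UNIV. \<Gamma> \<kappa> x k i j * y $ j) = (\<Sum>j\<in>UNIV. \<Gamma>' k i j * y $ j)"
    using nlc_eq_of_parallel[OF \<kappa> W sym parallel] \<Gamma> \<kappa> W(2) unfolding berwald_coefficients_iff
    by metis
qed

lemma berwald_symmetric:
  assumes \<Gamma>: "berwald_coefficients M A F \<Gamma>" and \<kappa>: "\<kappa> \<in> M" and x: "x \<in> chart_img \<kappa>"
  shows "\<Gamma> \<kappa> x k i j = \<Gamma> \<kappa> x k j i"
proof -
  interpret local_finsler "LL \<kappa>" "tcone \<kappa>" by (rule local_finsler[OF \<kappa>])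
  obtain y where "(x, y) \<in> tcone \<kappa>" using cone_nonempty[OF \<kappa> x] .
  then show ?thesis
    using nlc_linear_symmetric[of "\<Gamma> \<kappa>" x y] \<Gamma> \<kappa> unfolding berwald_coefficients_iff by blast
qed

lemma berwald_smooth:
  assumes \<Gamma>: "berwald_coefficients M A F \<Gamma>" and \<kappa>: "\<kappa> \<in> M"
  shows "smooth_on (chart_img \<kappa>) (\<lambda>x. \<Gamma> \<kappa> x k i j)"
proof -
  interpret local_finsler "LL \<kappa>" "tcone \<kappa>" by (rule local_finsler[OF \<kappa>])
  show ?thesis
  proof (rule nlc_linear_smooth)
    show "nlc (LL \<kappa>) (x, y) k i = (\<Sum>j\<in>UNIV. \<Gamma> \<kappa> x k i j * y $ j)"
      if "(x, y) \<in> tcone \<kappa>" for x y k i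
      using \<Gamma> \<kappa> that unfolding berwald_coefficients_iff by blast
    show "\<exists>y. (x, y) \<in> tcone \<kappa>" if "x \<in> chart_img \<kappa>" for x
      using cone_nonempty[OF \<kappa> that] by blast
  qed
qed

section \<open>Berwald coefficients under changes of coordinates\<close>

lemma cone_change:
  assumes "\<kappa> \<in> M" "\<mu> \<in> M" "x \<in> overlap \<kappa> \<mu>" "(x, y) \<in> tcone \<kappa>"
  shows "(transition \<kappa> \<mu> x, dird (transition \<kappa> \<mu>) x y) \<in> tcone \<mu>"
  using assms transition_overlap[OF assms(1-3)]
  by (auto simp: chart_cone_def tvec_change[OF assms(1-3)] chart_inv_transition[OF assms(1-3)])

lemma LL_change:
  assumes "\<kappa> \<in> M" "\<mu> \<in> M" "x \<in> overlap \<kappa> \<mu>"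
  shows "LL \<kappa> (x, y) = LL \<mu> (transition \<kappa> \<mu> x, dird (transition \<kappa> \<mu>) x y)"
  unfolding LL_Pair Lcomp_def Fcomp_def chart_inv_transition[OF assms] tvec_change[OF assms] ..

lemma open_cone_overlap:
  assumes "\<kappa> \<in> M" "\<mu> \<in> M"
  shows "open (tcone \<kappa> \<inter> overlap \<kappa> \<mu> \<times> UNIV)"
  using open_cone[OF assms(1)] open_overlap[OF assms] by (intro open_Int open_Times) auto

text \<open>The transformation law holds because the pulled back coefficients also make \<open>L\<close> parallel.\<close>

lemma berwald_transformation:
  assumes \<Gamma>: "berwald_coefficients M A F \<Gamma>" and M: "\<kappa> \<in> M" "\<mu> \<in> M" and x: "x \<in> overlap \<kappa> \<mu>"
  defines "X \<equiv> transition \<kappa> \<mu>"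
  shows "dird X x (gam (\<Gamma> \<kappa> x) u y) =
    dird (\<lambda>x. dird X x y) x u + gam (\<Gamma> \<mu> (X x)) (dird X x u) (dird X x y)"
proof -
  note smooth = smooth_transition[OF M, folded X_def]
  note open_dom = open_overlap[OF M]
  define K where "K = dird (transition \<mu> \<kappa>) (X x)"
  define V where "V u y = dird (\<lambda>x. dird X x y) x u + gam (\<Gamma> \<mu> (X x)) (dird X x u) (dird X x y)" for u y
  \<comment> \<open>As K inverts the Jacobian, \<Gamma>' satisfies the transformation law by
    construction; it remains to identify it with \<Gamma> by uniqueness.\<close>
  define \<Gamma>' where "\<Gamma>' k i j = K (V (axis i 1) (axis j 1)) $ k" for k i j
  have K: "dird X x (K v) = v" for v
    using dird_transition_inverse(2)[OF M x] by (simp add: K_def X_def)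
  have "linear K"
    unfolding K_def X_def by (rule linear_dird_transition[OF M(2,1) transition_overlap[OF M x]])
  have linX: "linear (dird X x)"
    unfolding X_def by (rule linear_dird_transition[OF M x])
  have "linear (\<lambda>u. V u y)" "linear (V u)" for u y
    unfolding V_def using bilinear_gam[of "\<Gamma> \<mu> (X x)"]
    by (auto intro!: linear_compose_add linear_dird_dird[OF open_dom smooth x]
        linear_compose[OF linX, unfolded o_def] simp: bilinear_def)
  then have "bilinear (\<lambda>u y. K (V u y))"
    using linear_compose[OF _ \<open>linear K\<close>] by (auto simp: bilinear_def o_def)
  from bilinear_eq_gam[OF this] have gam: "gam \<Gamma>' u y = K (V u y)" for u y
    by (simp add: \<Gamma>'_def[abs_def])
  have x': "x \<in> chart_img \<kappa>" and Xx: "X x \<in> chart_img \<mu>"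
    using x transition_overlap[OF M x] by (auto simp: X_def)
  \<comment> \<open>Uniqueness requires symmetric coefficients: the second derivatives of X commute,
    and \<Gamma> is symmetric in the other chart.\<close>
  have "V u y = V y u" for u y
    using dird_commute_vec[OF open_dom smooth x, of u y] berwald_symmetric[OF \<Gamma> M(2) Xx]
    by (simp add: V_def vec_eq_iff gam_def) (subst sum.swap, simp add: mult_ac)
  then have sym: "\<Gamma>' k i j = \<Gamma>' k j i" for k i j
    by (simp add: \<Gamma>'_def)
  have parallel: "dird (LL \<kappa>) (x, y) (u, - gam \<Gamma>' u y) = 0" if "(x, y) \<in> tcone \<kappa>" for y u
  proof -
    have "dird (LL \<kappa>) (x, y) (u, - gam \<Gamma>' u y) =
        dird (LL \<mu>) (X x, dird X x y) (dird X x u, - gam (\<Gamma> \<mu> (X x)) (dird X x u) (dird X x y))"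
    proof (rule dird_pullback_parallel[OF open_dom smooth x _ open_cone_overlap[OF M]])
      show "LL \<mu> differentiable (at (X x, dird X x y))"
        using smooth_on_differentiable[OF smooth_LL[OF M(2)] cone_change[OF M x that]]
        by (simp add: X_def)
      show "dird X x (gam \<Gamma>' u y) =
          dird (\<lambda>x. dird X x y) x u + gam (\<Gamma> \<mu> (X x)) (dird X x u) (dird X x y)"
        by (simp add: gam K) (simp add: V_def)
    qed (use that x LL_change[OF M] in \<open>auto simp: X_def\<close>)
    also have "\<dots> = 0"
      by (rule LL_parallel[OF \<Gamma> M(2)]) (use cone_change[OF M x that] in \<open>simp add: X_def\<close>)
    finally show ?thesis .
  qed
  obtain y0 where y0: "(x, y0) \<in> tcone \<kappa>" using cone_nonempty[OF M(1) x'] .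
  have "\<Gamma> \<kappa> x k i j = \<Gamma>' k i j" for k i j
    by (rule berwald_coefficients_unique[OF \<Gamma> M(1), of "{y. (x, y) \<in> tcone \<kappa>}"])
      (use y0 sym parallel open_fibres[OF open_cone[OF M(1)]] in auto)
  then have "\<Gamma> \<kappa> x = \<Gamma>'" by (simp add: fun_eq_iff)
  then show ?thesis by (simp add: gam K) (simp add: V_def)
qed

theorem berwald_torsion_free:
  assumes \<Gamma>: "berwald_coefficients M A F \<Gamma>"
  shows "torsion_free_affine_connection M \<Gamma>"
  unfolding torsion_free_affine_connection_def Let_def
proof (intro conjI ballI allI)
  show "smooth_on (chart_img \<kappa>) (\<lambda>x. \<Gamma> \<kappa> x k i j)" if "\<kappa> \<in> M" for \<kappa> k i j
    by (rule berwald_smooth[OF \<Gamma> that])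
  show "\<Gamma> \<kappa> x k i j = \<Gamma> \<kappa> x k j i" if "\<kappa> \<in> M" "x \<in> chart_img \<kappa>" for \<kappa> x k i j
    by (rule berwald_symmetric[OF \<Gamma> that])
  fix \<kappa> \<mu> x c i j
  assume M: "\<kappa> \<in> M" "\<mu> \<in> M" and x: "x \<in> overlap \<kappa> \<mu>"
  let ?X = "transition \<kappa> \<mu>"
  note smooth = smooth_transition[OF M]
  have J: "partial i (\<lambda>x. ?X x $ c) x = dird ?X x (axis i 1) $ c" for i c
    unfolding partial_def by (rule dird_nth[OF differentiable_transition[OF M x]])
  have H: "partial i (\<lambda>x. partial j (\<lambda>x. ?X x $ c) x) x =
      dird (\<lambda>x. dird ?X x (axis j 1)) x (axis i 1) $ c"
    unfolding partial_def by (rule dird_dird_nth[OF open_overlap[OF M] smooth x])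
  have "dird ?X x (gam (\<Gamma> \<kappa> x) (axis i 1) (axis j 1)) $ c =
      dird (\<lambda>x. dird ?X x (axis j 1)) x (axis i 1) $ c +
      gam (\<Gamma> \<mu> (?X x)) (dird ?X x (axis i 1)) (dird ?X x (axis j 1)) $ c"
    using berwald_transformation[OF \<Gamma> M x] by simp
  moreover have "dird ?X x (gam (\<Gamma> \<kappa> x) (axis i 1) (axis j 1)) $ c =
      (\<Sum>k\<in>UNIV. \<Gamma> \<kappa> x k i j * dird ?X x (axis k 1) $ c)"
    by (subst dird_basis_expansion[OF differentiable_transition[OF M x]])
      (simp add: gam_axis_axis sum_component)
  ultimately show "(\<Sum>k\<in>UNIV. \<Gamma> \<kappa> x k i j * partial k (\<lambda>x. ?X x $ c) x) =
      partial i (\<lambda>x. partial j (\<lambda>x. ?X x $ c) x) x +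
      (\<Sum>a\<in>UNIV. \<Sum>b\<in>UNIV. \<Gamma> \<mu> (?X x) c a b * partial i (\<lambda>x. ?X x $ a) x *
        partial j (\<lambda>x. ?X x $ b) x)"
    unfolding J H by (simp add: gam_def)
qed

end

section \<open>Algebra in a tangent space\<close>

lemma symmetric_matrix_inner:
  fixes a :: "real^'n::finite^'n"
  assumes "transpose a = a"
  shows "v \<bullet> (a *v w) = w \<bullet> (a *v v)"
  by (metis assms dot_lmul_matrix inner_commute transpose_matrix_vector)

lemma quadratic_form_expand:
  fixes a :: "real^'n::finite^'n"
  shows "(y + t *\<^sub>R z) \<bullet> (a *v (y + t *\<^sub>R z)) =
    y \<bullet> (a *v y) + t * (y \<bullet> (a *v z) + z \<bullet> (a *v y)) + t^2 * (z \<bullet> (a *v z))"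
  by (simp add: matrix_vector_right_distrib inner_add_left inner_add_right power2_eq_square
      matrix_vector_mult_scaleR algebra_simps)

lemma symmetric_matrix_eq_0:
  fixes a :: "real^'n::finite^'n"
  assumes "transpose a = a" "\<And>y. y \<bullet> (a *v y) = 0"
  shows "a = 0"
proof -
  have "v \<bullet> (a *v w) = 0" for v w
    \<comment> \<open>Polarization; the scalar 1 brings the sum into the form of
      \<open>quadratic_form_expand\<close>.\<close>
    using assms(2)[of "v + 1 *\<^sub>R w"] assms(2)[of v] assms(2)[of w]
      symmetric_matrix_inner[OF assms(1), of v w]
    unfolding quadratic_form_expand by simp
  then have "a *v w = 0 *v w" for w
    by (metis inner_eq_zero_iff matrix_vector_mult_0)
  then show ?thesis
    by (metis matrix_eq)
qed

text \<open>The part of l orthogonal to b lies in the kernel of b, hence is orthogonal to l, to b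
  and so to itself. Here b and l are covectors, and the Euclidean product only expresses their
  evaluation.\<close>

lemma proportional_of_kernel:
  fixes b l :: "'a::real_inner"
  assumes "b \<noteq> 0" "\<And>y. b \<bullet> y = 0 \<Longrightarrow> l \<bullet> y = 0"
  shows "l = ((l \<bullet> b) / (b \<bullet> b)) *\<^sub>R b"
proof -
  let ?r = "l - ((l \<bullet> b) / (b \<bullet> b)) *\<^sub>R b"
  have 1: "b \<bullet> ?r = 0"
    using assms(1) by (simp add: inner_diff_right inner_commute)
  then have "l \<bullet> ?r = 0" by (rule assms(2))
  then have "?r \<bullet> ?r = 0"
    using 1 by (simp add: inner_diff_left)
  then show ?thesis by simp
qed

text \<open>A totally isotropic hyperplane \<open>ker b\<close> would be contained in the line spanned by \<open>a\<^sup>-\<^sup>1 b\<close>.\<close>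

lemma hyperplane_not_isotropic:
  fixes a :: "real^'n::finite^'n"
  assumes n: "CARD('n) > 2" and sym: "transpose a = a" and inv: "invertible a" and b: "b \<noteq> 0"
  obtains y where "b \<bullet> y = 0" "y \<bullet> (a *v y) \<noteq> 0"
proof (rule ccontr)
  assume "\<not> thesis"
  with that have iso: "y \<bullet> (a *v y) = 0" if "b \<bullet> y = 0" for y using that by blast
  have "{y. b \<bullet> y = 0} \<subseteq> span {matrix_inv a *v b}"
  proof
    fix v assume "v \<in> {y. b \<bullet> y = 0}"
    then have v: "b \<bullet> v = 0" by simp
    have "(a *v v) \<bullet> w = 0" if w: "b \<bullet> w = 0" for w
    proof -
      have "b \<bullet> (v + 1 *\<^sub>R w) = 0" using v w by (simp add: inner_add_right)
      from iso[OF this] iso[OF v] iso[OF w] show ?thesis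
        using symmetric_matrix_inner[OF sym, of v w]
        unfolding quadratic_form_expand by (simp add: inner_commute)
    qed
    from proportional_of_kernel[OF b this] obtain c where "a *v v = c *\<^sub>R b" by blast
    then have "matrix_inv a *v (a *v v) = c *\<^sub>R (matrix_inv a *v b)"
      by (simp add: matrix_vector_mult_scaleR)
    then have "v = c *\<^sub>R (matrix_inv a *v b)"
      by (simp add: matrix_vector_mul_assoc matrix_inv_mult inv)
    then show "v \<in> span {matrix_inv a *v b}"
      by (simp add: span_base span_scale)
  qed
  then have "dim {y. b \<bullet> y = 0} \<le> dim (span {matrix_inv a *v b})"
    by (rule dim_subset)
  also have "\<dots> \<le> 1"
    using dim_le_card[of "{matrix_inv a *v b}" "{matrix_inv a *v b}"] by (simp add: span_superset)
  finally show False
    using dim_hyperplane[OF b] n by simp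
qed

text \<open>Along a line y + t z the function p is a cubic polynomial in t whose leading coefficient
  is p z, and a third difference extracts it.\<close>

lemma cubic_eq_0_on_open:
  fixes a q :: "real^'n::finite^'n" and b l :: "real^'n" and r1 r2 d e :: real
  defines "p \<equiv> \<lambda>y. r1 * (e * (y \<bullet> (a *v y)) + d * (b \<bullet> y)^2) * (l \<bullet> y)
      - r2 * (b \<bullet> y) * (e * (y \<bullet> (q *v y)) + 2 * d * (b \<bullet> y) * (l \<bullet> y))"
  assumes W: "open W" "y \<in> W" and zero: "\<And>y. y \<in> W \<Longrightarrow> p y = 0"
  shows "p z = 0"
proof -
  obtain \<epsilon> where \<epsilon>: "\<epsilon> > 0" "ball y \<epsilon> \<subseteq> W"
    using W openE by blast
  \<comment> \<open>The evaluation points reach as far as 2 s z from y and have to stay in the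
    ball.\<close>
  define s where "s = \<epsilon> / (4 * (norm z + 1))"
  have pos: "norm z + 1 > 0" by (simp add: add_nonneg_pos)
  have s: "s > 0" using \<epsilon> pos by (simp add: s_def)
  have "2 * s * norm z < s * (4 * (norm z + 1))"
    using s pos by (simp add: algebra_simps add_pos_nonneg)
  also have "\<dots> = \<epsilon>" using pos by (simp add: s_def)
  finally have s2: "2 * s * norm z < \<epsilon>" .
  have small: "p (y + t *\<^sub>R z) = 0" if "\<bar>t\<bar> \<le> 2 * s" for t
  proof (rule zero)
    have "\<bar>t\<bar> * norm z \<le> 2 * s * norm z"
      using that by (intro mult_right_mono) auto
    then have "y + t *\<^sub>R z \<in> ball y \<epsilon>"
      using s2 by (simp add: dist_norm)
    then show "y + t *\<^sub>R z \<in> W" using \<epsilon> by blast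
  qed
  have *: "p (y + s *\<^sub>R z) = 0" "p (y + (- s) *\<^sub>R z) = 0"
    "p (y + (2 * s) *\<^sub>R z) = 0" "p (y + (- (2 * s)) *\<^sub>R z) = 0"
    using small[of s] small[of "- s"] small[of "2 * s"] small[of "- (2 * s)"] s by simp_all
  have lin: "c \<bullet> (y + t *\<^sub>R z) = c \<bullet> y + t * (c \<bullet> z)" for c t
    by (simp add: inner_add_right)
  \<comment> \<open>The weights 1, -2, 2, -1 at 2s, s, -s, -2s annihilate 1, t and t^2 and send t^3
    to 12 s^3.\<close>
  have "p (y + (2 * s) *\<^sub>R z) - 2 * p (y + s *\<^sub>R z) + 2 * p (y + (- s) *\<^sub>R z) - p (y + (- (2 * s)) *\<^sub>R z)
      = 12 * s^3 * p z"
    unfolding p_def quadratic_form_expand lin by algebra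
  then show ?thesis
    using * s by simp
qed

text \<open>Applied for a fixed i with l = D_i b, q = D_i a and e = c \<epsilon>. The identity,
  given where L is defined, is first extended to all y, which makes its restriction to the kernel of
  b available.\<close>

theorem parallel_kropina_tensors:
  fixes a q :: "real^'n::finite^'n" and b l :: "real^'n"
  assumes n: "CARD('n) > 2" and sym: "transpose a = a" and inv: "invertible a" and b: "b \<noteq> 0"
    and q: "transpose q = q" and m: "m \<noteq> 0" "m \<noteq> -1" and e: "e \<noteq> 0"
    and W: "open W" "y0 \<in> W"
    and zero: "\<And>y. y \<in> W \<Longrightarrow> 2 * m * (e * (y \<bullet> (a *v y)) + d * (b \<bullet> y)^2) * (l \<bullet> y) =
      (m + 1) * (b \<bullet> y) * (e * (y \<bullet> (q *v y)) + 2 * d * (b \<bullet> y) * (l \<bullet> y))"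
  obtains w where "l = w *\<^sub>R b"
    "\<And>j k. (m + 1) * e * q $ j $ k = 2 * w * (m * e * a $ j $ k - d * b $ j * b $ k)"
proof -
  have all: "2 * m * (e * (y \<bullet> (a *v y)) + d * (b \<bullet> y)^2) * (l \<bullet> y) =
      (m + 1) * (b \<bullet> y) * (e * (y \<bullet> (q *v y)) + 2 * d * (b \<bullet> y) * (l \<bullet> y))" for y
    using cubic_eq_0_on_open[OF W, of "2 * m" e a d b l "m + 1" q y] zero by simp
  obtain y1 where y1: "b \<bullet> y1 = 0" "y1 \<bullet> (a *v y1) \<noteq> 0"
    using hyperplane_not_isotropic[OF n sym inv b] .
  have ker: "(y \<bullet> (a *v y)) * (l \<bullet> y) = 0" if "b \<bullet> y = 0" for y
    using all[of y] that m e by simp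
  \<comment> \<open>If l did not vanish at z, the quadratic form of a would vanish at z, y1 + z and
    y1 - z, hence also at y1.\<close>
  have "l \<bullet> z = 0" if z: "b \<bullet> z = 0" for z
  proof (rule ccontr)
    assume lz: "l \<bullet> z \<noteq> 0"
    have l1: "l \<bullet> y1 = 0" using ker[OF y1(1)] y1(2) by simp
    have "(y1 + t *\<^sub>R z) \<bullet> (a *v (y1 + t *\<^sub>R z)) = 0" if "t \<noteq> 0" for t
      using ker[of "y1 + t *\<^sub>R z"] that lz l1 y1(1) z by (simp add: inner_add_right)
    from this[of 1] this[of "-1"] ker[OF z] lz y1(2) show False
      unfolding quadratic_form_expand by simp
  qed
  from proportional_of_kernel[OF b this] obtain w where w: "l = w *\<^sub>R b" by blast
  define X where "X = (\<chi> j k. (m + 1) * e * q $ j $ k - 2 * w * (m * e * a $ j $ k - d * b $ j * b $ k))"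
  have X: "y \<bullet> (X *v y) = (m + 1) * e * (y \<bullet> (q *v y)) - 2 * w * (m * e * (y \<bullet> (a *v y)) - d * (b \<bullet> y)^2)" for y
  proof -
    have "(b \<bullet> y)^2 = (\<Sum>j\<in>UNIV. \<Sum>k\<in>UNIV. b $ j * b $ k * y $ j * y $ k)"
      by (simp add: inner_vec_def power2_eq_square sum_product mult_ac)
    then show ?thesis
      by (simp add: X_def inner_vec_def matrix_vector_mult_def sum_distrib_left algebra_simps
          sum_subtractf sum.distrib)
  qed
  have X0: "y \<bullet> (X *v y) = 0" if "b \<bullet> y \<noteq> 0" for y
  proof -
    \<comment> \<open>With l = w b both sides of the cubic identity have the factor b y, and their
      difference is b y times the quadratic form of X.\<close>
    have "(b \<bullet> y) * (y \<bullet> (X *v y)) = 0"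
      using all[of y] unfolding X w inner_scaleR_left by algebra
    then show ?thesis using that by simp
  qed
  have "y \<bullet> (X *v y) = 0" for y
  proof (cases "b \<bullet> y = 0")
    case True
    \<comment> \<open>The points y + b, y - b and b lie off the hyperplane, and the parallelogram
      law for the quadratic form of X yields the value at y.\<close>
    have "b \<bullet> (y + t *\<^sub>R b) \<noteq> 0" if "t \<noteq> 0" for t
      using True b that by (simp add: inner_add_right)
    from X0[OF this[of 1]] X0[OF this[of "-1"]] X0[of b] b show ?thesis
      unfolding quadratic_form_expand by simp
  qed (rule X0)
  moreover have "transpose X = X"
    using sym q by (simp add: X_def transpose_def vec_eq_iff mult_ac)
  ultimately have "X = 0" using symmetric_matrix_eq_0 by blast
  then have "(m + 1) * e * q $ j $ k = 2 * w * (m * e * a $ j $ k - d * b $ j * b $ k)" for j k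
    by (simp add: X_def vec_eq_iff)
  with w show thesis by (rule that)
qed

text \<open>In the locale, \<open>da i j k\<close> and \<open>db i j\<close> stand for \<open>\<partial>\<^sub>i a\<^sub>j\<^sub>k\<close> and \<open>\<partial>\<^sub>i b\<^sub>j\<close>, \<open>\<epsilon>d\<close> for the
  product of \<open>\<epsilon>\<close> and \<open>d\<close>, and \<open>f\<close> for the covector with components \<open>f\<^sub>i\<close>.\<close>

locale kropina_algebra =
  fixes a :: "real^'n::finite^'n" and b :: "real^'n" and da :: "'n \<Rightarrow> 'n \<Rightarrow> 'n \<Rightarrow> real"
    and db :: "'n \<Rightarrow> 'n \<Rightarrow> real" and c m \<epsilon>d :: real and f :: "'n \<Rightarrow> real"
  assumes sym: "a $ i $ j = a $ j $ i" and inv: "invertible a" and da_sym: "da i j k = da i k j"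
begin

definition chr where "chr k i j = 1/2 * (\<Sum>l\<in>UNIV. matrix_inv a $ k $ l * (da i j l + da j i l - da l i j))"
definition nab where "nab i j = db i j - (\<Sum>k\<in>UNIV. chr k i j * b $ k)"
definition B where "B = (\<Sum>i\<in>UNIV. \<Sum>j\<in>UNIV. matrix_inv a $ i $ j * b $ i * b $ j)"
definition h where "h i j = \<epsilon>d * b $ i * b $ j - c * m * a $ i $ j"
text \<open>The correction to the lowered Christoffel symbols when D_i a_jk = 0 is replaced by D_i
  a_jk = -2 f_i h_jk.\<close>

definition T where "T l i j = f i * h j l + f j * h i l - f l * h i j"
definition kcon where "kcon k i j = chr k i j + (\<Sum>l\<in>UNIV. matrix_inv a $ k $ l * T l i j)"
text \<open>The components b^k, so that \<open>B\<close> is |b|^2 and \<open>fb\<close> is f_k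
  b^k.\<close>

definition bs where "bs k = (\<Sum>l\<in>UNIV. matrix_inv a $ k $ l * b $ l)"
definition fb where "fb = (\<Sum>k\<in>UNIV. f k * bs k)"
definition low where "low \<Gamma> p i j = (\<Sum>k\<in>UNIV. a $ p $ k * \<Gamma> k i j)"
definition Db where "Db \<Gamma> i j = db i j - (\<Sum>k\<in>UNIV. \<Gamma> k i j * b $ k)"
text \<open>\<open>Db\<close> and \<open>Da\<close> are the covariant derivatives of b and a for
  arbitrary coefficients, the latter through coefficients whose upper index has been
  lowered.\<close>

definition Da where "Da \<Gamma> i j k = da i j k - low \<Gamma> k i j - low \<Gamma> j i k"

lemma transpose_a: "transpose a = a"
  by (simp add: transpose_def vec_eq_iff sym)

lemma lower_raise: "(\<Sum>k\<in>UNIV. a $ p $ k * (\<Sum>l\<in>UNIV. matrix_inv a $ k $ l * v l)) = v p"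
proof -
  have "a *v (matrix_inv a *v (\<chi> l. v l)) = (\<chi> l. v l)"
    by (simp add: matrix_vector_mul_assoc matrix_inv_mult inv)
  then show ?thesis by (simp add: vec_eq_iff matrix_vector_mult_def)
qed

lemma lower_bs: "(\<Sum>k\<in>UNIV. a $ p $ k * bs k) = b $ p"
  unfolding bs_def by (rule lower_raise)

text \<open>A contraction v^k b_k equals b^p v_p; thus contractions of connection coefficients with
  b can be computed from \<open>low\<close>.\<close>

lemma bs_lower: "(\<Sum>p\<in>UNIV. bs p * (\<Sum>k\<in>UNIV. a $ p $ k * v k)) = (\<Sum>k\<in>UNIV. v k * b $ k)"
proof -
  have "(\<Sum>p\<in>UNIV. bs p * (\<Sum>k\<in>UNIV. a $ p $ k * v k)) = (\<Sum>k\<in>UNIV. v k * (\<Sum>p\<in>UNIV. a $ k $ p * bs p))"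
    unfolding sum_distrib_left by (subst sum.swap) (simp add: mult_ac sym)
  then show ?thesis by (simp add: lower_bs)
qed

lemma B_eq: "B = (\<Sum>i\<in>UNIV. bs i * b $ i)"
  by (simp add: B_def bs_def sum_distrib_left sum_distrib_right mult_ac)

lemma low_chr: "low chr p i j = 1/2 * (da i j p + da j i p - da p i j)"
proof -
  have "low chr p i j = 1/2 * (\<Sum>k\<in>UNIV. a $ p $ k *
      (\<Sum>l\<in>UNIV. matrix_inv a $ k $ l * (da i j l + da j i l - da l i j)))"
    by (simp add: low_def chr_def sum_distrib_left mult_ac)
  then show ?thesis unfolding lower_raise .
qed

lemma low_kcon: "low kcon p i j = low chr p i j + T p i j"
  using lower_raise[of p "\<lambda>l. T l i j"]
  by (simp add: low_def kcon_def distrib_left sum.distrib)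

lemma h_sym: "h i j = h j i"
  by (simp add: h_def sym[of i j])

lemma chr_sym: "chr k i j = chr k j i"
  by (simp add: chr_def da_sym[of _ i j] add.commute)

lemma kcon_sym: "kcon k i j = kcon k j i"
  by (simp add: kcon_def chr_sym[of k i j] T_def h_sym[of i j] add.commute)

lemma h_bs: "(\<Sum>l\<in>UNIV. bs l * h j l) = (\<epsilon>d * B - c * m) * b $ j"
proof -
  have "(\<Sum>l\<in>UNIV. bs l * h j l) = \<epsilon>d * b $ j * (\<Sum>l\<in>UNIV. bs l * b $ l) - c * m * (\<Sum>l\<in>UNIV. a $ j $ l * bs l)"
    by (simp add: h_def sum_distrib_left sum_subtractf algebra_simps)
  then show ?thesis by (simp add: lower_bs flip: B_eq) (simp add: algebra_simps)
qed

lemma T_bs: "(\<Sum>l\<in>UNIV. bs l * T l i j) =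
    (\<epsilon>d * B - c * m) * (f i * b $ j + f j * b $ i) - fb * h i j"
proof -
  have "(\<Sum>l\<in>UNIV. bs l * T l i j) = f i * (\<Sum>l\<in>UNIV. bs l * h j l) + f j * (\<Sum>l\<in>UNIV. bs l * h i l)
      - (\<Sum>l\<in>UNIV. f l * bs l) * h i j"
    by (simp add: T_def sum_distrib_left sum_distrib_right sum_subtractf sum.distrib algebra_simps)
  then show ?thesis unfolding h_bs by (simp add: fb_def algebra_simps)
qed

text \<open>As for the Levi-Civita connection: in
  \<open>Da \<Gamma> i j p + Da \<Gamma> j i p - Da \<Gamma> p i j\<close> all coefficients of
  \<Gamma> cancel by symmetry except -2 \<open>low \<Gamma> p i j\<close>.\<close>

lemma low_eq_iff:
  assumes "\<And>k i j. \<Gamma> k i j = \<Gamma> k j i"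
  shows "(\<forall>p i j. low \<Gamma> p i j = low chr p i j + T p i j) \<longleftrightarrow> (\<forall>i j k. Da \<Gamma> i j k = - 2 * f i * h j k)"
proof -
  have low_sym: "low \<Gamma> p i j = low \<Gamma> p j i" for p i j
    using assms by (simp add: low_def)
  show ?thesis
  proof (intro iffI allI)
    fix p i j
    assume "\<forall>i j k. Da \<Gamma> i j k = - 2 * f i * h j k"
    then have "Da \<Gamma> i j p + Da \<Gamma> j i p - Da \<Gamma> p i j =
        - 2 * f i * h j p - 2 * f j * h i p + 2 * f p * h i j"
      by simp
    then show "low \<Gamma> p i j = low chr p i j + T p i j"
      unfolding Da_def low_chr T_def
      using low_sym[of j p i] low_sym[of i p j] low_sym[of p i j] by (simp add: algebra_simps)
  next
    fix i j k
    assume *: "\<forall>p i j. low \<Gamma> p i j = low chr p i j + T p i j"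
    show "Da \<Gamma> i j k = - 2 * f i * h j k"
      unfolding Da_def *[rule_format] low_chr T_def h_sym[of k j] da_sym[of i k j]
      by (simp add: algebra_simps)
  qed
qed

lemma Db_eq:
  assumes "\<And>p i j. low \<Gamma> p i j = low chr p i j + T p i j"
  shows "Db \<Gamma> i j = nab i j - ((\<epsilon>d * B - c * m) * (f i * b $ j + f j * b $ i) - fb * h i j)"
proof -
  have "(\<Sum>k\<in>UNIV. \<Gamma> k i j * b $ k) = (\<Sum>p\<in>UNIV. bs p * low \<Gamma> p i j)"
    unfolding low_def by (rule bs_lower[symmetric])
  also have "\<dots> = (\<Sum>p\<in>UNIV. bs p * low chr p i j) + (\<Sum>p\<in>UNIV. bs p * T p i j)"
    by (simp add: assms distrib_left sum.distrib)
  also have "(\<Sum>p\<in>UNIV. bs p * low chr p i j) = (\<Sum>k\<in>UNIV. chr k i j * b $ k)"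
    unfolding low_def by (rule bs_lower)
  finally show ?thesis
    by (simp add: Db_def nab_def T_bs)
qed

definition condition where
  "condition i j \<longleftrightarrow> nab i j = c * m * fb * a $ i $ j + (c + \<epsilon>d * B) * f i * b $ j
     - (c * m - \<epsilon>d * B) * b $ i * f j - \<epsilon>d * fb * b $ i * b $ j"

text \<open>The origin of the condition: it is D_i b_j = c (m + 1) f_i b_j solved for the
  Levi-Civita derivative.\<close>

lemma condition_iff:
  assumes "\<And>p i j. low \<Gamma> p i j = low chr p i j + T p i j"
  shows "condition i j \<longleftrightarrow> Db \<Gamma> i j = c * (m + 1) * f i * b $ j"
  unfolding Db_eq[OF assms] condition_def h_def by (auto simp: algebra_simps)

lemma kcon_parallel:
  assumes "\<And>i j. condition i j"
  shows "Db kcon i j = c * (m + 1) * f i * b $ j" "Da kcon i j k = - 2 * f i * h j k"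
  using condition_iff[of kcon] low_kcon assms low_eq_iff[of kcon] kcon_sym by blast+

text \<open>In this contraction all multiples of b_i cancel. Since b^j \<open>nab i j\<close> is
  half the derivative of |b|^2, the result determines f_i wherever the factor is not 0.\<close>

lemma nab_bs:
  assumes "\<And>i j. condition i j"
  shows "(\<Sum>j\<in>UNIV. bs j * nab i j) = (c + \<epsilon>d * B) * B * f i"
proof -
  have "(\<Sum>j\<in>UNIV. bs j * nab i j) = c * m * fb * (\<Sum>j\<in>UNIV. a $ i $ j * bs j)
      + (c + \<epsilon>d * B) * f i * (\<Sum>j\<in>UNIV. bs j * b $ j)
      - (c * m - \<epsilon>d * B) * b $ i * (\<Sum>j\<in>UNIV. f j * bs j) - \<epsilon>d * fb * b $ i * (\<Sum>j\<in>UNIV. bs j * b $ j)"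
  proof -
    have "bs j * nab i j = c * m * fb * (a $ i $ j * bs j)
      + (c + \<epsilon>d * B) * f i * (bs j * b $ j)
      - (c * m - \<epsilon>d * B) * b $ i * (f j * bs j) - \<epsilon>d * fb * b $ i * (bs j * b $ j)" for j
      unfolding assms[of i j, unfolded condition_def] by algebra
    then show ?thesis
      by (simp only: sum_subtractf sum.distrib sum_distrib_left)
  qed
  then show ?thesis
    by (simp add: lower_bs fb_def[symmetric] flip: B_eq) (simp add: algebra_simps)
qed

text \<open>Of the lowered Christoffel symbols, the part antisymmetric in j and p drops out under
  contraction with b^j b^p.\<close>

lemma nab_bs_eq:
  "(\<Sum>j\<in>UNIV. bs j * nab i j) =
    (\<Sum>j\<in>UNIV. bs j * db i j) - 1/2 * (\<Sum>j\<in>UNIV. \<Sum>p\<in>UNIV. bs j * bs p * da i j p)"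
proof -
  have "(\<Sum>k\<in>UNIV. chr k i j * b $ k) = (\<Sum>p\<in>UNIV. bs p * low chr p i j)" for j
    unfolding low_def by (rule bs_lower[symmetric])
  then have "(\<Sum>j\<in>UNIV. bs j * nab i j) = (\<Sum>j\<in>UNIV. bs j * db i j) -
      (\<Sum>j\<in>UNIV. \<Sum>p\<in>UNIV. bs j * (bs p * low chr p i j))"
    by (simp add: nab_def right_diff_distrib sum_subtractf sum_distrib_left)
  also have "(\<Sum>j\<in>UNIV. \<Sum>p\<in>UNIV. bs j * (bs p * low chr p i j)) =
      1/2 * (\<Sum>j\<in>UNIV. \<Sum>p\<in>UNIV. bs j * bs p * da i j p) +
      (1/2 * (\<Sum>j\<in>UNIV. \<Sum>p\<in>UNIV. bs j * bs p * da j i p) -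
       1/2 * (\<Sum>j\<in>UNIV. \<Sum>p\<in>UNIV. bs j * bs p * da p i j))"
    by (simp add: low_chr sum_distrib_left sum.distrib[symmetric] sum_subtractf[symmetric] algebra_simps)
  also have "(\<Sum>j\<in>UNIV. \<Sum>p\<in>UNIV. bs j * bs p * da j i p) = (\<Sum>j\<in>UNIV. \<Sum>p\<in>UNIV. bs j * bs p * da p i j)"
    by (subst sum.swap) (simp only: mult.commute)
  finally show ?thesis by simp
qed

end

section \<open>Generalized Kropina metrics in coordinates\<close>

lemma linear_axis_expand:
  fixes f :: "real^'n::finite \<Rightarrow> real"
  assumes "linear f"
  shows "f y = (\<Sum>i\<in>UNIV. f (axis i 1) * y $ i)"
proof -
  interpret linear f by fact
  have "f (\<Sum>i\<in>UNIV. y $ i *\<^sub>R axis i 1) = (\<Sum>i\<in>UNIV. f (axis i 1) * y $ i)"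
    by (simp add: sum scaleR mult.commute)
  then show ?thesis
    using basis_expansion[of y] by (simp add: scalar_mult_eq_scaleR)
qed

lemma inner_matrix_vector: "y \<bullet> (A *v z) = (\<Sum>i\<in>UNIV. \<Sum>j\<in>UNIV. A $ i $ j * y $ i * z $ j)"
  for A :: "real^'n::finite^'n"
  by (simp add: inner_vec_def matrix_vector_mult_def sum_distrib_left mult_ac)

text \<open>The powers of \<alpha> outside the last factor are \<alpha>^2 and \<alpha>^(2m);
  together they turn c + d s^2 into c \<alpha>^2 + d \<beta>^2 under the exponent m + 1.\<close>

lemma kropina_square:
  fixes \<alpha> \<beta> c d m \<sigma> :: real
  assumes \<alpha>: "\<alpha> > 0" and \<beta>: "\<beta> > 0" and pos: "c + d * (\<beta> / \<alpha>)\<^sup>2 > 0" and \<sigma>: "\<sigma> \<in> {1, -1}"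
  shows "(\<alpha> * kropina_phi \<sigma> m c d (\<beta> / \<alpha>))\<^sup>2 = \<beta> powr (- 2 * m) * (c * \<alpha>\<^sup>2 + d * \<beta>\<^sup>2) powr (m + 1)"
proof -
  have P: "c * \<alpha>\<^sup>2 + d * \<beta>\<^sup>2 = \<alpha>\<^sup>2 * (c + d * (\<beta> / \<alpha>)\<^sup>2)"
    using \<alpha> by (simp add: field_simps)
  have half: "(u powr (t / 2))\<^sup>2 = u powr t" for u t :: real
    by (simp add: power2_eq_square flip: powr_add)
  have "(\<alpha> * kropina_phi \<sigma> m c d (\<beta> / \<alpha>))\<^sup>2 =
      \<alpha>\<^sup>2 * ((\<beta> / \<alpha>) powr (- 2 * m) * (c + d * (\<beta> / \<alpha>)\<^sup>2) powr (m + 1))"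
    using \<sigma> half[of "\<beta> / \<alpha>" "- 2 * m"] half[of "c + d * (\<beta> / \<alpha>)\<^sup>2" "m + 1"]
    by (auto simp: kropina_phi_def power_mult_distrib)
  moreover define Q where "Q = c + d * (\<beta> / \<alpha>)\<^sup>2"
  then have "Q > 0" "c * \<alpha>\<^sup>2 + d * \<beta>\<^sup>2 = \<alpha>\<^sup>2 * Q"
    using pos P by auto
  \<comment> \<open>Both sides are positive, so their logarithms may be compared.\<close>
  moreover from \<open>Q > 0\<close> have "ln (\<alpha>\<^sup>2 * ((\<beta> / \<alpha>) powr (- 2 * m) * Q powr (m + 1))) =
      ln (\<beta> powr (- 2 * m) * (\<alpha>\<^sup>2 * Q) powr (m + 1))"
    using \<alpha> \<beta> by (simp add: ln_mult ln_div ln_powr ln_realpow algebra_simps)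
  then have "\<alpha>\<^sup>2 * ((\<beta> / \<alpha>) powr (- 2 * m) * Q powr (m + 1)) =
      \<beta> powr (- 2 * m) * (\<alpha>\<^sup>2 * Q) powr (m + 1)"
    using \<alpha> \<beta> \<open>Q > 0\<close> by (subst (asm) ln_inj_iff) auto
  ultimately show ?thesis by (simp add: Q_def)
qed

locale kropina_manifold = finsler_manifold M A F
  for M :: "('m::{t2_space,second_countable_topology}, 'n::finite) chart set"
    and A :: "('m \<times> ('m, 'n) tvector) set" and F :: "'m \<Rightarrow> ('m, 'n) tvector \<Rightarrow> real" +
  fixes a :: "'m \<Rightarrow> ('m, 'n) tvector \<Rightarrow> ('m, 'n) tvector \<Rightarrow> real"
    and b :: "'m \<Rightarrow> ('m, 'n) tvector \<Rightarrow> real" and \<sigma> m c d :: real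
  assumes dim: "CARD('n) > 2" and metric: "pseudo_riemannian_metric M a"
    and form: "smooth_one_form M b" and kropina: "generalized_kropina A a b F \<sigma> m c d"
    and proper: "properly_finslerian M A F"
begin

section \<open>Components of a and b in a chart\<close>

definition am :: "('m, 'n) chart \<Rightarrow> real^'n \<Rightarrow> real^'n^'n" where
  "am \<kappa> x = (\<chi> i j. acomp M a \<kappa> x i j)"

definition bv :: "('m, 'n) chart \<Rightarrow> real^'n \<Rightarrow> real^'n" where
  "bv \<kappa> x = (\<chi> i. bcomp M b \<kappa> x i)"

abbreviation "da \<kappa> x \<equiv> \<lambda>i j k. partial i (\<lambda>x. acomp M a \<kappa> x j k) x"
abbreviation "db \<kappa> x \<equiv> \<lambda>i j. partial i (\<lambda>x. bcomp M b \<kappa> x j) x"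

definition AA where "AA \<kappa> z = snd z \<bullet> (am \<kappa> (fst z) *v snd z)"
definition beta where "beta \<kappa> z = bv \<kappa> (fst z) \<bullet> snd z"

lemma b_tvec:
  assumes "\<kappa> \<in> M" "x \<in> chart_img \<kappa>"
  shows "b (chart_inv \<kappa> x) (tvec M \<kappa> x y) = bv \<kappa> x \<bullet> y"
proof -
  have "linear (\<lambda>y. b (chart_inv \<kappa> x) (tvec M \<kappa> x y))"
    using form assms unfolding smooth_one_form_def by blast
  from linear_axis_expand[OF this, of y] show ?thesis
    by (simp add: bv_def bcomp_def inner_vec_def)
qed

lemma a_tvec:
  assumes "\<kappa> \<in> M" "x \<in> chart_img \<kappa>"
  shows "a (chart_inv \<kappa> x) (tvec M \<kappa> x y) (tvec M \<kappa> x z) = y \<bullet> (am \<kappa> x *v z)"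
proof -
  have "bilinear (\<lambda>y z. a (chart_inv \<kappa> x) (tvec M \<kappa> x y) (tvec M \<kappa> x z))"
    using metric assms unfolding pseudo_riemannian_metric_def bilinear_forms_def by blast
  then have lin: "linear (\<lambda>z. a (chart_inv \<kappa> x) (tvec M \<kappa> x y) (tvec M \<kappa> x z))"
    "linear (\<lambda>y. a (chart_inv \<kappa> x) (tvec M \<kappa> x y) (tvec M \<kappa> x z))" for y z
    by (auto simp: bilinear_def)
  have "a (chart_inv \<kappa> x) (tvec M \<kappa> x y) (tvec M \<kappa> x z) =
      (\<Sum>i\<in>UNIV. a (chart_inv \<kappa> x) (tvec M \<kappa> x (axis i 1)) (tvec M \<kappa> x z) * y $ i)"
    by (rule linear_axis_expand[OF lin(2)])
  also have "\<dots> = (\<Sum>i\<in>UNIV. (\<Sum>j\<in>UNIV. acomp M a \<kappa> x i j * z $ j) * y $ i)"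
    unfolding acomp_def by (subst linear_axis_expand[OF lin(1), of _ z]) (rule refl)
  also have "\<dots> = y \<bullet> (am \<kappa> x *v z)"
    by (simp add: inner_matrix_vector am_def sum_distrib_right sum_distrib_left mult_ac)
  finally show ?thesis .
qed

lemma acomp_sym:
  assumes "\<kappa> \<in> M" "x \<in> chart_img \<kappa>"
  shows "acomp M a \<kappa> x i j = acomp M a \<kappa> x j i"
  using metric tvec_tangent[OF assms] unfolding pseudo_riemannian_metric_def acomp_def by blast

text \<open>Nondegeneracy is stated for families in \<open>tangent_space\<close>. Each of these is
  \<open>tvec\<close> of its component, so a kernel vector of the matrix yields a tangent vector
  orthogonal to all others.\<close>

lemma invertible_am:
  assumes "\<kappa> \<in> M" "x \<in> chart_img \<kappa>"
  shows "invertible (am \<kappa> x)"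
proof -
  have "v = 0" if v: "am \<kappa> x *v v = 0" for v
  proof -
    have "transpose (am \<kappa> x) = am \<kappa> x"
      by (simp add: transpose_def am_def vec_eq_iff acomp_sym[OF assms])
    note sym = symmetric_matrix_inner[OF this]
    have "a (chart_inv \<kappa> x) (tvec M \<kappa> x v) w = 0" if w: "w \<in> tangent_space M (chart_inv \<kappa> x)" for w
    proof -
      have eq: "w = tvec M \<kappa> x (w \<kappa>)"
        using tangent_eq_tvec[OF w assms(1) chart_inv_mem[OF assms(2)]]
        unfolding chart_map_inv[OF assms(2)] .
      show ?thesis
        by (subst eq) (simp add: a_tvec[OF assms] sym[of v] v)
    qed
    then have "tvec M \<kappa> x v = (\<lambda>\<kappa>. 0)"
      using metric tvec_tangent[OF assms] unfolding pseudo_riemannian_metric_def by blast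
    then show ?thesis
      using tvec_self[OF assms, of v] by simp
  qed
  then show ?thesis
    using invertible_left_inverse matrix_left_invertible_ker by blast
qed

lemma smooth_acomp: "\<kappa> \<in> M \<Longrightarrow> smooth_on (chart_img \<kappa>) (\<lambda>x. acomp M a \<kappa> x i j)"
  using metric unfolding pseudo_riemannian_metric_def by blast

lemma smooth_bcomp: "\<kappa> \<in> M \<Longrightarrow> smooth_on (chart_img \<kappa>) (\<lambda>x. bcomp M b \<kappa> x i)"
  using form unfolding smooth_one_form_def by blast

lemma kropina_algebra:
  assumes "\<kappa> \<in> M" "x \<in> chart_img \<kappa>"
  shows "kropina_algebra (am \<kappa> x) (da \<kappa> x)"
proof
  show "am \<kappa> x $ i $ j = am \<kappa> x $ j $ i" for i j
    using acomp_sym[OF assms] by (simp add: am_def)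
  show "invertible (am \<kappa> x)"
    by (rule invertible_am[OF assms])
  show "da \<kappa> x i j k = da \<kappa> x i k j" for i j k
    by (rule partial_cong[OF open_chart_img[OF assms(1)] assms(2)]) (rule acomp_sym[OF assms(1)])
qed

lemma beta_change:
  assumes "\<kappa> \<in> M" "\<mu> \<in> M" "x \<in> overlap \<kappa> \<mu>"
  shows "bv \<kappa> x \<bullet> y = bv \<mu> (transition \<kappa> \<mu> x) \<bullet> dird (transition \<kappa> \<mu>) x y"
proof -
  have "x \<in> chart_img \<kappa>" "transition \<kappa> \<mu> x \<in> chart_img \<mu>"
    using assms transition_overlap[OF assms] by auto
  then show ?thesis
    using b_tvec[OF assms(1), of x y] b_tvec[OF assms(2), of "transition \<kappa> \<mu> x"]
    unfolding tvec_change[OF assms] chart_inv_transition[OF assms] by simp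
qed

lemma am_change:
  assumes "\<kappa> \<in> M" "\<mu> \<in> M" "x \<in> overlap \<kappa> \<mu>"
  shows "y \<bullet> (am \<kappa> x *v z) =
    dird (transition \<kappa> \<mu>) x y \<bullet> (am \<mu> (transition \<kappa> \<mu> x) *v dird (transition \<kappa> \<mu>) x z)"
proof -
  have "x \<in> chart_img \<kappa>" "transition \<kappa> \<mu> x \<in> chart_img \<mu>"
    using assms transition_overlap[OF assms] by auto
  then show ?thesis
    using a_tvec[OF assms(1), of x y z] a_tvec[OF assms(2), of "transition \<kappa> \<mu> x"]
    unfolding tvec_change[OF assms] chart_inv_transition[OF assms] by simp
qed

section \<open>The metric on vectors of one sign\<close>

lemma on_A:
  assumes "(p, v) \<in> A"
  shows "a p v v \<noteq> 0" "b p v > 0" "c * \<bar>a p v v\<bar> + d * (b p v)\<^sup>2 > 0"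
    "(F p v)\<^sup>2 = b p v powr (- 2 * m) * (c * \<bar>a p v v\<bar> + d * (b p v)\<^sup>2) powr (m + 1)"
proof -
  define \<alpha> where "\<alpha> = sqrt \<bar>a p v v\<bar>"
  have k: "\<sigma> \<in> {1, -1}" "\<alpha> \<noteq> 0" "b p v / \<alpha> > 0" "c + d * (b p v / \<alpha>)\<^sup>2 > 0"
    "F p v = \<alpha> * kropina_phi \<sigma> m c d (b p v / \<alpha>)"
    using kropina assms unfolding generalized_kropina_def Let_def \<alpha>_def by auto
  have \<alpha>: "\<alpha> > 0" "\<alpha>\<^sup>2 = \<bar>a p v v\<bar>"
    using k(2) by (auto simp: \<alpha>_def)
  show "a p v v \<noteq> 0" using k(2) by (auto simp: \<alpha>_def)
  show \<beta>: "b p v > 0" using k(3) \<alpha>(1) by (simp add: zero_less_divide_iff)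
  have "c * \<alpha>\<^sup>2 + d * (b p v)\<^sup>2 = \<alpha>\<^sup>2 * (c + d * (b p v / \<alpha>)\<^sup>2)"
    using \<alpha>(1) by (simp add: field_simps)
  then show "c * \<bar>a p v v\<bar> + d * (b p v)\<^sup>2 > 0"
    using k(4) \<alpha> by (metis mult_pos_pos zero_less_power)
  show "(F p v)\<^sup>2 = b p v powr (- 2 * m) * (c * \<bar>a p v v\<bar> + d * (b p v)\<^sup>2) powr (m + 1)"
    unfolding k(5) kropina_square[OF \<alpha>(1) \<beta> k(4,1)] \<alpha>(2) ..
qed

text \<open>For \<epsilon> = 1 and \<epsilon> = -1 these are two open sets that cover the cone, on
  each of which L is given by one formula.\<close>

definition sign_cone :: "real \<Rightarrow> ('m, 'n) chart \<Rightarrow> ((real^'n) \<times> (real^'n)) set" where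
  "sign_cone \<epsilon> \<kappa> = {z \<in> tcone \<kappa>. \<epsilon> * AA \<kappa> z > 0}"

text \<open>On the sign cone \<epsilon> a(y, y) is |a(y, y)|, but in this form P is a polynomial in
  y.\<close>

definition PP where "PP \<epsilon> \<kappa> z = c * \<epsilon> * AA \<kappa> z + d * (beta \<kappa> z)\<^sup>2"

lemma AA_eq: "\<kappa> \<in> M \<Longrightarrow> (x, y) \<in> tcone \<kappa> \<Longrightarrow> AA \<kappa> (x, y) = a (chart_inv \<kappa> x) (tvec M \<kappa> x y) (tvec M \<kappa> x y)"
  by (simp add: AA_def a_tvec cone_img)

lemma beta_eq: "\<kappa> \<in> M \<Longrightarrow> (x, y) \<in> tcone \<kappa> \<Longrightarrow> beta \<kappa> (x, y) = b (chart_inv \<kappa> x) (tvec M \<kappa> x y)"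
  by (simp add: beta_def b_tvec cone_img)

lemma eps_eq: "\<kappa> \<in> M \<Longrightarrow> (x, y) \<in> tcone \<kappa> \<Longrightarrow> eps M a \<kappa> x y = sgn (AA \<kappa> (x, y))"
  by (simp add: eps_def AA_eq)

lemma eps_cases:
  assumes "\<kappa> \<in> M" "(x, y) \<in> tcone \<kappa>"
  shows "eps M a \<kappa> x y = 1 \<or> eps M a \<kappa> x y = -1" "(x, y) \<in> sign_cone (eps M a \<kappa> x y) \<kappa>"
proof -
  have "AA \<kappa> (x, y) \<noteq> 0"
    unfolding AA_eq[OF assms] using on_A(1) assms(2) by (auto simp: chart_cone_def)
  then show "eps M a \<kappa> x y = 1 \<or> eps M a \<kappa> x y = -1" "(x, y) \<in> sign_cone (eps M a \<kappa> x y) \<kappa>"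
    using assms by (auto simp: eps_eq sign_cone_def sgn_real_def)
qed

lemma sign_cone_cone: "z \<in> sign_cone \<epsilon> \<kappa> \<Longrightarrow> z \<in> tcone \<kappa>"
  by (simp add: sign_cone_def)

lemma sign_cone_eps:
  assumes "\<kappa> \<in> M" "(x, y) \<in> sign_cone \<epsilon> \<kappa>" "\<epsilon> = 1 \<or> \<epsilon> = -1"
  shows "eps M a \<kappa> x y = \<epsilon>"
  using assms by (auto simp: sign_cone_def eps_eq)

lemma on_sign_cone:
  assumes \<kappa>: "\<kappa> \<in> M" and z: "z \<in> sign_cone \<epsilon> \<kappa>" and \<epsilon>: "\<epsilon> = 1 \<or> \<epsilon> = -1"
  shows "beta \<kappa> z > 0" "PP \<epsilon> \<kappa> z > 0" "LL \<kappa> z = beta \<kappa> z powr (- 2 * m) * PP \<epsilon> \<kappa> z powr (m + 1)"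
proof -
  obtain x y where xy: "z = (x, y)" by (cases z)
  have C: "(x, y) \<in> tcone \<kappa>" and pos: "\<epsilon> * AA \<kappa> (x, y) > 0"
    using z xy by (auto simp: sign_cone_def)
  have A: "(chart_inv \<kappa> x, tvec M \<kappa> x y) \<in> A"
    using C by (simp add: chart_cone_def)
  have "PP \<epsilon> \<kappa> (x, y) = c * \<bar>AA \<kappa> (x, y)\<bar> + d * (beta \<kappa> (x, y))\<^sup>2"
    using \<epsilon> pos by (auto simp: PP_def)
  then show "beta \<kappa> z > 0" "PP \<epsilon> \<kappa> z > 0"
    "LL \<kappa> z = beta \<kappa> z powr (- 2 * m) * PP \<epsilon> \<kappa> z powr (m + 1)"
    using on_A[OF A] unfolding xy LL_Pair Lcomp_def Fcomp_def AA_eq[OF \<kappa> C] beta_eq[OF \<kappa> C]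
    by simp_all
qed

section \<open>Derivatives along horizontal lifts\<close>

lemma has_derivative_comp_fst:
  assumes "smooth_on S f" "x \<in> S"
  shows "((\<lambda>z::(real^'n) \<times> (real^'n). f (fst z)) has_derivative (\<lambda>w. dird f x (fst w))) (at (x, y))"
  by (rule has_derivative_compose[where f=fst and g=f])
    (auto intro!: derivative_eq_intros has_derivative_dird smooth_on_differentiable[OF assms])

lemma has_derivative_snd_nth:
  "((\<lambda>z::(real^'n) \<times> (real^'n). snd z $ i) has_derivative (\<lambda>w. snd w $ i)) net"
  by (rule bounded_linear_imp_has_derivative[OF bounded_linear_snd_nth])

lemma has_derivative_beta:
  assumes "\<kappa> \<in> M" "x \<in> chart_img \<kappa>"
  shows "(beta \<kappa> has_derivative (\<lambda>w. \<Sum>i\<in>UNIV. bcomp M b \<kappa> x i * snd w $ i +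
    dird (\<lambda>x. bcomp M b \<kappa> x i) x (fst w) * y $ i)) (at (x, y))"
proof -
  have "((\<lambda>z. \<Sum>i\<in>UNIV. bcomp M b \<kappa> (fst z) i * snd z $ i) has_derivative (\<lambda>w. \<Sum>i\<in>UNIV.
      bcomp M b \<kappa> (fst (x, y)) i * snd w $ i +
      dird (\<lambda>x. bcomp M b \<kappa> x i) x (fst w) * snd (x, y) $ i)) (at (x, y))"
    by (intro has_derivative_sum has_derivative_mult has_derivative_snd_nth
        has_derivative_comp_fst[OF smooth_bcomp[OF assms(1)] assms(2)])
  moreover have "beta \<kappa> = (\<lambda>z. \<Sum>i\<in>UNIV. bcomp M b \<kappa> (fst z) i * snd z $ i)"
    by (simp add: fun_eq_iff beta_def bv_def inner_vec_def)
  ultimately show ?thesis by simp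
qed

lemma has_derivative_AA:
  assumes "\<kappa> \<in> M" "x \<in> chart_img \<kappa>"
  shows "(AA \<kappa> has_derivative (\<lambda>w. \<Sum>i\<in>UNIV. \<Sum>j\<in>UNIV.
    acomp M a \<kappa> x i j * (y $ i * snd w $ j + snd w $ i * y $ j) +
    dird (\<lambda>x. acomp M a \<kappa> x i j) x (fst w) * (y $ i * y $ j))) (at (x, y))"
proof -
  have "((\<lambda>z. \<Sum>i\<in>UNIV. \<Sum>j\<in>UNIV. acomp M a \<kappa> (fst z) i j * (snd z $ i * snd z $ j)) has_derivative
      (\<lambda>w. \<Sum>i\<in>UNIV. \<Sum>j\<in>UNIV.
        acomp M a \<kappa> (fst (x, y)) i j * (snd (x, y) $ i * snd w $ j + snd w $ i * snd (x, y) $ j) +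
        dird (\<lambda>x. acomp M a \<kappa> x i j) x (fst w) * (snd (x, y) $ i * snd (x, y) $ j))) (at (x, y))"
    by (intro has_derivative_sum has_derivative_mult has_derivative_snd_nth
        has_derivative_comp_fst[OF smooth_acomp[OF assms(1)] assms(2)])
  moreover have "AA \<kappa> = (\<lambda>z. \<Sum>i\<in>UNIV. \<Sum>j\<in>UNIV. acomp M a \<kappa> (fst z) i j * (snd z $ i * snd z $ j))"
    by (simp add: fun_eq_iff AA_def am_def inner_matrix_vector mult_ac)
  ultimately show ?thesis by simp
qed

lemma open_sign_cone:
  assumes "\<kappa> \<in> M"
  shows "open (sign_cone \<epsilon> \<kappa>)"
proof -
  have "continuous_on (tcone \<kappa>) (\<lambda>z. \<epsilon> * AA \<kappa> z)"
  proof (intro continuous_at_imp_continuous_on ballI continuous_intros)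
    fix z assume "z \<in> tcone \<kappa>"
    then show "isCont (AA \<kappa>) z"
      using has_derivative_continuous[OF has_derivative_AA[OF assms cone_img]] by (cases z) auto
  qed
  then have "open (tcone \<kappa> \<inter> (\<lambda>z. \<epsilon> * AA \<kappa> z) -` {0<..})"
    by (rule continuous_open_preimage) (use open_cone[OF assms] in auto)
  moreover have "sign_cone \<epsilon> \<kappa> = tcone \<kappa> \<inter> (\<lambda>z. \<epsilon> * AA \<kappa> z) -` {0<..}"
    by (auto simp: sign_cone_def)
  ultimately show ?thesis by simp
qed

text \<open>For fixed i, the covector D_i b_j; with \<open>qmat\<close>, the matrix D_i a_jk, it
  gives the derivatives of \<beta> and a(y, y) along horizontal lifts.\<close>

definition lvec where "lvec \<kappa> x \<Gamma> i = (\<chi> j. kropina_algebra.Db (bv \<kappa> x) (db \<kappa> x) \<Gamma> i j)"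
definition qmat where "qmat \<kappa> x \<Gamma> i = (\<chi> j k. kropina_algebra.Da (am \<kappa> x) (da \<kappa> x) \<Gamma> i j k)"

lemma dird_beta_gam:
  assumes \<kappa>: "\<kappa> \<in> M" and x: "x \<in> chart_img \<kappa>"
  shows "dird (beta \<kappa>) (x, y) (axis i 1, - gam \<Gamma> (axis i 1) y) = lvec \<kappa> x \<Gamma> i \<bullet> y"
proof -
  interpret K: kropina_algebra "am \<kappa> x" "bv \<kappa> x" "da \<kappa> x" "db \<kappa> x"
    by (rule kropina_algebra[OF assms])
  have "(\<Sum>k\<in>UNIV. bv \<kappa> x $ k * gam \<Gamma> (axis i 1) y $ k) = (\<Sum>j\<in>UNIV. (\<Sum>k\<in>UNIV. \<Gamma> k i j * bv \<kappa> x $ k) * y $ j)"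
    unfolding gam_axis sum_distrib_left sum_distrib_right by (subst sum.swap) (simp add: mult_ac)
  moreover have "lvec \<kappa> x \<Gamma> i \<bullet> y = (\<Sum>j\<in>UNIV. (db \<kappa> x i j - (\<Sum>k\<in>UNIV. \<Gamma> k i j * bv \<kappa> x $ k)) * y $ j)"
    by (simp add: lvec_def K.Db_def inner_vec_def)
  ultimately show ?thesis
    unfolding dird_eqI[OF has_derivative_beta[OF assms]]
    by (simp add: partial_def bv_def sum.distrib sum_negf sum_subtractf left_diff_distrib)
qed

lemma dird_AA_gam:
  assumes \<kappa>: "\<kappa> \<in> M" and x: "x \<in> chart_img \<kappa>"
  shows "dird (AA \<kappa>) (x, y) (axis i 1, - gam \<Gamma> (axis i 1) y) = y \<bullet> (qmat \<kappa> x \<Gamma> i *v y)"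
proof -
  interpret K: kropina_algebra "am \<kappa> x" "bv \<kappa> x" "da \<kappa> x" "db \<kappa> x"
    by (rule kropina_algebra[OF assms])
  let ?g = "gam \<Gamma> (axis i 1) y"
  have 1: "(\<Sum>j\<in>UNIV. \<Sum>k\<in>UNIV. am \<kappa> x $ j $ k * (y $ j * ?g $ k)) =
      (\<Sum>j\<in>UNIV. \<Sum>k\<in>UNIV. K.low \<Gamma> j i k * (y $ j * y $ k))"
  proof (rule sum.cong[OF refl])
    fix j
    show "(\<Sum>k\<in>UNIV. am \<kappa> x $ j $ k * (y $ j * ?g $ k)) = (\<Sum>k\<in>UNIV. K.low \<Gamma> j i k * (y $ j * y $ k))"
      unfolding gam_axis K.low_def sum_distrib_left sum_distrib_right
      by (subst sum.swap) (simp add: mult_ac)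
  qed
  have 2: "(\<Sum>j\<in>UNIV. \<Sum>k\<in>UNIV. am \<kappa> x $ j $ k * (?g $ j * y $ k)) =
      (\<Sum>j\<in>UNIV. \<Sum>k\<in>UNIV. K.low \<Gamma> k i j * (y $ j * y $ k))"
  proof -
    have "(\<Sum>j\<in>UNIV. \<Sum>k\<in>UNIV. am \<kappa> x $ j $ k * (?g $ j * y $ k)) =
        (\<Sum>k\<in>UNIV. \<Sum>j\<in>UNIV. am \<kappa> x $ j $ k * (?g $ j * y $ k))"
      by (rule sum.swap)
    also have "\<dots> = (\<Sum>j\<in>UNIV. \<Sum>k\<in>UNIV. am \<kappa> x $ j $ k * (y $ j * ?g $ k))"
      by (intro sum.cong refl, subst K.sym) (simp only: mult_ac)
    also have "\<dots> = (\<Sum>k\<in>UNIV. \<Sum>j\<in>UNIV. K.low \<Gamma> j i k * (y $ j * y $ k))"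
      unfolding 1 by (rule sum.swap)
    also have "\<dots> = (\<Sum>j\<in>UNIV. \<Sum>k\<in>UNIV. K.low \<Gamma> k i j * (y $ j * y $ k))"
      by (intro sum.cong refl) (simp only: mult_ac)
    finally show ?thesis .
  qed
  have "dird (AA \<kappa>) (x, y) (axis i 1, - ?g) =
      (\<Sum>j\<in>UNIV. \<Sum>k\<in>UNIV. da \<kappa> x i j k * (y $ j * y $ k)) -
      (\<Sum>j\<in>UNIV. \<Sum>k\<in>UNIV. am \<kappa> x $ j $ k * (y $ j * ?g $ k)) -
      (\<Sum>j\<in>UNIV. \<Sum>k\<in>UNIV. am \<kappa> x $ j $ k * (?g $ j * y $ k))"
    unfolding dird_eqI[OF has_derivative_AA[OF assms]]
    by (simp add: partial_def am_def sum.distrib sum_subtractf algebra_simps)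
  also have "\<dots> = y \<bullet> (qmat \<kappa> x \<Gamma> i *v y)"
    unfolding 1 2 inner_matrix_vector
    by (simp add: qmat_def K.Da_def sum.distrib sum_subtractf algebra_simps)
  finally show ?thesis .
qed

text \<open>On the sign cone L is positive and its derivative is L times that of -2m ln \<beta> + (m
  + 1) ln P. Multiplication by \<beta> P leaves a polynomial identity in y.\<close>

lemma LL_parallel_iff:
  assumes \<kappa>: "\<kappa> \<in> M" and z: "(x, y) \<in> sign_cone \<epsilon> \<kappa>" and \<epsilon>: "\<epsilon> = 1 \<or> \<epsilon> = -1"
  shows "dird (LL \<kappa>) (x, y) (axis i 1, - gam \<Gamma> (axis i 1) y) = 0 \<longleftrightarrow>
    2 * m * (c * \<epsilon> * (y \<bullet> (am \<kappa> x *v y)) + d * (bv \<kappa> x \<bullet> y)\<^sup>2) * (lvec \<kappa> x \<Gamma> i \<bullet> y) =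
    (m + 1) * (bv \<kappa> x \<bullet> y) * (c * \<epsilon> * (y \<bullet> (qmat \<kappa> x \<Gamma> i *v y)) +
      2 * d * (bv \<kappa> x \<bullet> y) * (lvec \<kappa> x \<Gamma> i \<bullet> y))"
proof -
  let ?z = "(x, y)" and ?w = "(axis i 1, - gam \<Gamma> (axis i 1) y)"
  have x: "x \<in> chart_img \<kappa>"
    using z cone_img sign_cone_cone by blast
  note pos = on_sign_cone(1,2)[OF \<kappa> z \<epsilon>]
  have d\<beta>: "(beta \<kappa> has_derivative dird (beta \<kappa>) ?z) (at ?z)"
    and dA: "(AA \<kappa> has_derivative dird (AA \<kappa>) ?z) (at ?z)"
    by (rule has_derivative_dird, rule differentiableI, rule has_derivative_beta[OF \<kappa> x])
      (rule has_derivative_dird, rule differentiableI, rule has_derivative_AA[OF \<kappa> x])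
  have dP: "(PP \<epsilon> \<kappa> has_derivative
      (\<lambda>w. c * \<epsilon> * dird (AA \<kappa>) ?z w + d * (2 * beta \<kappa> ?z * dird (beta \<kappa>) ?z w))) (at ?z)"
    unfolding PP_def[abs_def]
    by (rule derivative_eq_intros d\<beta> dA refl | simp add: fun_eq_iff)+
  have "((\<lambda>z. exp (- 2 * m * ln (beta \<kappa> z) + (m + 1) * ln (PP \<epsilon> \<kappa> z))) has_derivative
      (\<lambda>w. exp (- 2 * m * ln (beta \<kappa> ?z) + (m + 1) * ln (PP \<epsilon> \<kappa> ?z)) *
        (- 2 * m * (inverse (beta \<kappa> ?z) * dird (beta \<kappa>) ?z w) + (m + 1) * (inverse (PP \<epsilon> \<kappa> ?z) *
        (c * \<epsilon> * dird (AA \<kappa>) ?z w + d * (2 * beta \<kappa> ?z * dird (beta \<kappa>) ?z w)))))) (at ?z)"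
    by (rule derivative_eq_intros d\<beta> dP pos refl | simp add: fun_eq_iff divide_inverse mult.commute)+
  from dird_eqI[OF this] have "dird (LL \<kappa>) ?z ?w =
      exp (- 2 * m * ln (beta \<kappa> ?z) + (m + 1) * ln (PP \<epsilon> \<kappa> ?z)) *
        (- 2 * m * (inverse (beta \<kappa> ?z) * dird (beta \<kappa>) ?z ?w) + (m + 1) * (inverse (PP \<epsilon> \<kappa> ?z) *
        (c * \<epsilon> * dird (AA \<kappa>) ?z ?w + d * (2 * beta \<kappa> ?z * dird (beta \<kappa>) ?z ?w))))"
    by (subst dird_cong_at[OF open_sign_cone[OF \<kappa>] z])
      (use on_sign_cone[OF \<kappa> _ \<epsilon>] in \<open>auto simp: powr_def exp_add[symmetric] less_imp_neq[symmetric]\<close>)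
  then have "dird (LL \<kappa>) ?z ?w = 0 \<longleftrightarrow>
      - 2 * m * (inverse (beta \<kappa> ?z) * dird (beta \<kappa>) ?z ?w) + (m + 1) * (inverse (PP \<epsilon> \<kappa> ?z) *
        (c * \<epsilon> * dird (AA \<kappa>) ?z ?w + d * (2 * beta \<kappa> ?z * dird (beta \<kappa>) ?z ?w))) = 0"
    by simp
  also have "\<dots> \<longleftrightarrow> 2 * m * PP \<epsilon> \<kappa> ?z * dird (beta \<kappa>) ?z ?w =
      (m + 1) * beta \<kappa> ?z * (c * \<epsilon> * dird (AA \<kappa>) ?z ?w + d * (2 * beta \<kappa> ?z * dird (beta \<kappa>) ?z ?w))"
  proof -
    have "- 2 * m * (inverse B * l) + (m + 1) * (inverse P * R) = 0 \<longleftrightarrow>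
        2 * m * P * l = (m + 1) * B * R" if "B > 0" "P > 0" for B P l R :: real
    proof -
      have "B * P * (- 2 * m * (inverse B * l) + (m + 1) * (inverse P * R)) =
          (m + 1) * B * R - 2 * m * P * l"
        using that by (simp add: distrib_left) (simp add: field_simps)
      then show ?thesis
        using that by (metis eq_iff_diff_eq_0 mult_eq_0_iff less_irrefl)
    qed
    then show ?thesis using pos by blast
  qed
  finally show ?thesis
    unfolding dird_beta_gam[OF \<kappa> x] dird_AA_gam[OF \<kappa> x]
    by (simp add: PP_def AA_def beta_def mult_ac)
qed

end

section \<open>The Berwald condition for generalized Kropina metrics\<close>

context kropina_manifold
begin

lemma cone_point:
  obtains \<kappa> x y where "\<kappa> \<in> M" "(x, y) \<in> tcone \<kappa>"
proof -
  \<comment> \<open>\<open>undefined\<close> merely serves as some point of the nonempty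
    type.\<close>
  obtain \<kappa> where \<kappa>: "\<kappa> \<in> M" "undefined \<in> chart_dom \<kappa>"
    using chart_exists by blast
  then have "chart_map \<kappa> undefined \<in> chart_img \<kappa>" by blast
  then show thesis
    using cone_nonempty[OF \<kappa>(1)] that[OF \<kappa>(1)] by metis
qed

section \<open>Excluded values of the parameters\<close>

lemma bv_nonzero:
  assumes "\<kappa> \<in> M" "x \<in> chart_img \<kappa>"
  shows "bv \<kappa> x \<noteq> 0"
proof -
  obtain y where y: "(x, y) \<in> tcone \<kappa>" using cone_nonempty[OF assms] .
  have "beta \<kappa> (x, y) > 0"
    by (rule on_sign_cone(1)[OF assms(1) eps_cases(2,1)[OF assms(1) y]])
  then show ?thesis by (auto simp: beta_def)
qed

text \<open>The fundamental tensor of K \<beta>^2 is K b_i b_j, of rank at most 1, hence not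
  invertible. For c = 0 and for m = -1 the function L has this form.\<close>

lemma not_square_of_beta:
  assumes \<kappa>: "\<kappa> \<in> M" and xy: "(x, y) \<in> sign_cone \<epsilon> \<kappa>"
    and L: "\<And>y. (x, y) \<in> sign_cone \<epsilon> \<kappa> \<Longrightarrow> LL \<kappa> (x, y) = K * (bv \<kappa> x \<bullet> y)\<^sup>2"
  shows False
proof -
  let ?W = "{y. (x, y) \<in> sign_cone \<epsilon> \<kappa>}"
  have W: "open ?W" "y \<in> ?W"
    using open_fibres(2)[OF open_sign_cone[OF \<kappa>]] xy by auto
  note C = sign_cone_cone[OF xy]
  note x = cone_img[OF C]
  have d2: "((\<lambda>y. K * (bv \<kappa> x \<bullet> y)\<^sup>2) has_derivative
      (\<lambda>v. 2 * K * (bv \<kappa> x \<bullet> y) * (bv \<kappa> x \<bullet> v))) (at y)" for y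
    by (auto intro!: derivative_eq_intros)
  have d3: "((\<lambda>y. 2 * K * (bv \<kappa> x \<bullet> y) * bv \<kappa> x $ j) has_derivative
      (\<lambda>v. 2 * K * (bv \<kappa> x \<bullet> v) * bv \<kappa> x $ j)) (at y)" for y j
    by (auto intro!: derivative_eq_intros)
  have d1: "partial j (\<lambda>y. LL \<kappa> (x, y)) y = 2 * K * (bv \<kappa> x \<bullet> y) * bv \<kappa> x $ j" if "y \<in> ?W" for y j
  proof -
    have "partial j (\<lambda>y. LL \<kappa> (x, y)) y = partial j (\<lambda>y. K * (bv \<kappa> x \<bullet> y)\<^sup>2) y"
      by (rule partial_cong[OF W(1) that]) (simp add: L)
    also have "\<dots> = 2 * K * (bv \<kappa> x \<bullet> y) * bv \<kappa> x $ j"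
      unfolding partial_def dird_eqI[OF d2] by (simp add: inner_axis)
    finally show ?thesis .
  qed
  have "fund (LL \<kappa>) (x, y) $ i $ j = K * bv \<kappa> x $ i * bv \<kappa> x $ j" for i j
  proof -
    have "py i (py j (LL \<kappa>)) (x, y) = partial i (\<lambda>y. partial j (\<lambda>y. LL \<kappa> (x, y)) y) y"
      using partial_partial(1)[OF open_cone[OF \<kappa>] smooth_LL[OF \<kappa>] C, of i j] by simp
    also have "\<dots> = partial i (\<lambda>y. 2 * K * (bv \<kappa> x \<bullet> y) * bv \<kappa> x $ j) y"
      by (rule partial_cong[OF W]) (rule d1)
    also have "\<dots> = 2 * K * bv \<kappa> x $ i * bv \<kappa> x $ j"
      unfolding partial_def dird_eqI[OF d3] by (simp add: inner_axis)
    finally show ?thesis by (simp add: fund_def)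
  qed
  note fund = this
  interpret K: kropina_algebra "am \<kappa> x" "bv \<kappa> x" "da \<kappa> x" "db \<kappa> x"
    by (rule kropina_algebra[OF \<kappa> x])
  \<comment> \<open>A vector of the kernel of b that is nonzero because a(v, v) is.\<close>
  obtain v where v: "bv \<kappa> x \<bullet> v = 0" "v \<bullet> (am \<kappa> x *v v) \<noteq> 0"
    using hyperplane_not_isotropic[OF dim K.transpose_a K.inv bv_nonzero[OF \<kappa> x]] .
  have "fund (LL \<kappa>) (x, y) *v v = 0"
  proof -
    have "(fund (LL \<kappa>) (x, y) *v v) $ i = K * bv \<kappa> x $ i * (bv \<kappa> x \<bullet> v)" for i
      by (simp add: matrix_vector_mult_def fund inner_vec_def sum_distrib_left mult_ac)
    then show ?thesis by (simp add: v(1) vec_eq_iff)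
  qed
  then have "matrix_inv (fund (LL \<kappa>) (x, y)) *v (fund (LL \<kappa>) (x, y) *v v) = 0"
    by simp
  moreover have "invertible (fund (LL \<kappa>) (x, y))"
    by (rule local_finsler.invertible_fund[OF local_finsler[OF \<kappa>] C])
  ultimately have "v = 0"
    by (simp add: matrix_vector_mul_assoc matrix_inv_mult)
  then show False using v(2) by simp
qed

lemma c_nonzero: "c \<noteq> 0"
proof
  assume c: "c = 0"
  obtain \<kappa> x y where \<kappa>: "\<kappa> \<in> M" and xy: "(x, y) \<in> tcone \<kappa>" using cone_point .
  note \<epsilon> = eps_cases[OF \<kappa> xy]
  have PP: "PP \<epsilon> \<kappa> z = d * (beta \<kappa> z)\<^sup>2" for \<epsilon> z
    unfolding PP_def by (simp add: c)
  \<comment> \<open>Here P = d \<beta>^2, and the exponents of \<beta> add up to -2m + 2(m + 1) = 2;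
    d > 0 because P > 0.\<close>
  have "LL \<kappa> (x, y') = d powr (m + 1) * (bv \<kappa> x \<bullet> y')\<^sup>2" if y': "(x, y') \<in> sign_cone (eps M a \<kappa> x y) \<kappa>" for y'
  proof -
    note L = on_sign_cone[OF \<kappa> y' \<epsilon>(1)]
    have \<beta>: "bv \<kappa> x \<bullet> y' > 0" and P: "d * (bv \<kappa> x \<bullet> y')\<^sup>2 > 0"
      using L unfolding PP by (auto simp: beta_def)
    then have d: "d > 0" by (simp add: zero_less_mult_iff)
    have "(bv \<kappa> x \<bullet> y')\<^sup>2 = (bv \<kappa> x \<bullet> y') powr 2"
      using \<beta> by simp
    then have "(bv \<kappa> x \<bullet> y') powr (- 2 * m) * ((bv \<kappa> x \<bullet> y')\<^sup>2) powr (m + 1) = (bv \<kappa> x \<bullet> y')\<^sup>2"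
      by (simp only: powr_powr flip: powr_add) simp
    then show ?thesis
      using L(3) \<beta> d unfolding PP by (simp add: beta_def powr_mult mult_ac)
  qed
  then show False by (rule not_square_of_beta[OF \<kappa> \<epsilon>(2)])
qed

lemma m_neq_minus_1: "m \<noteq> -1"
proof
  assume m: "m = -1"
  obtain \<kappa> x y where \<kappa>: "\<kappa> \<in> M" and xy: "(x, y) \<in> tcone \<kappa>" using cone_point .
  note \<epsilon> = eps_cases[OF \<kappa> xy]
  have "LL \<kappa> (x, y') = 1 * (bv \<kappa> x \<bullet> y')\<^sup>2" if y': "(x, y') \<in> sign_cone (eps M a \<kappa> x y) \<kappa>" for y'
    using on_sign_cone[OF \<kappa> y' \<epsilon>(1)] by (simp add: m beta_def)
  then show False by (rule not_square_of_beta[OF \<kappa> \<epsilon>(2)])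
qed

lemma m_nonzero: "m \<noteq> 0"
proof
  assume m: "m = 0"
  have bil: "bilinear_forms M (\<lambda>p v w. s * a p v w + d * (b p v * b p w))" for s
    unfolding bilinear_forms_def bilinear_def
    by (intro ballI conjI allI linearI)
      (simp_all add: a_tvec b_tvec inner_add_left inner_add_right matrix_vector_right_distrib
        matrix_vector_mult_scaleR algebra_simps)
  \<comment> \<open>Two sets cover \<open>A\<close> because a(v, v) does not vanish there, and on
    \<open>U s\<close> the absolute value of a(v, v) is the quadratic form s a(v, v).\<close>
  define U where "U s = {(p, v). (p, v) \<in> A \<and> s * a p v v > 0}" for s :: real
  have F: "(F p v)\<^sup>2 = (c * s) * a p v v + d * (b p v * b p v)"
    if "(p, v) \<in> U s" "s = 1 \<or> s = -1" for s p v
    using that on_A[of p v] by (auto simp: m power2_eq_square U_def)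
  have "\<exists>\<U>. finite \<U> \<and> \<Union>\<U> = A \<and>
      (\<forall>V\<in>\<U>. \<exists>Q. bilinear_forms M Q \<and> (\<forall>(p, v)\<in>V. (F p v)\<^sup>2 = Q p v v))"
  proof (intro exI[of _ "{U 1, U (-1)}"] conjI ballI)
    show "\<Union>{U 1, U (-1)} = A"
      using on_A(1) by (auto simp: U_def not_less_iff_gr_or_eq)
    fix V assume "V \<in> {U 1, U (-1)}"
    then obtain s where s: "V = U s" "s = 1 \<or> s = -1" by blast
    show "\<exists>Q. bilinear_forms M Q \<and> (\<forall>(p, v)\<in>V. (F p v)\<^sup>2 = Q p v v)"
      by (rule exI[of _ "\<lambda>p v w. (c * s) * a p v w + d * (b p v * b p w)"])
        (use bil F s in blast)
  qed simp
  then show False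
    using proper unfolding properly_finslerian_def by blast
qed

section \<open>The condition in matrix form\<close>

lemma condition_eq:
  assumes "\<kappa> \<in> M" "x \<in> chart_img \<kappa>"
  shows "nabla M a b \<kappa> x i j = kropina_algebra.nab (am \<kappa> x) (bv \<kappa> x) (da \<kappa> x) (db \<kappa> x) i j"
    and "bnorm2 M a b \<kappa> x = kropina_algebra.B (am \<kappa> x) (bv \<kappa> x)"
    and "pairing M b f \<kappa> x = kropina_algebra.fb (am \<kappa> x) (bv \<kappa> x) (vlower M a f \<kappa> x)"
    and "kropina_connection M a b m c d f \<epsilon> \<kappa> x k i j =
      kropina_algebra.kcon (am \<kappa> x) (bv \<kappa> x) (da \<kappa> x) c m (\<epsilon> * d) (vlower M a f \<kappa> x) k i j"
proof -
  interpret K: kropina_algebra "am \<kappa> x" "bv \<kappa> x" "da \<kappa> x" "db \<kappa> x" c m "\<epsilon> * d" "vlower M a f \<kappa> x"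
    by (rule kropina_algebra[OF assms])
  have ainv: "ainv M a \<kappa> x k l = matrix_inv (am \<kappa> x) $ k $ l" for k l
    by (simp add: ainv_def am_def)
  have chr: "christoffel M a \<kappa> x k i j = K.chr k i j" for k i j
    unfolding christoffel_def K.chr_def ainv ..
  show "nabla M a b \<kappa> x i j = K.nab i j"
    unfolding nabla_def K.nab_def chr by (simp add: bv_def)
  show "bnorm2 M a b \<kappa> x = K.B"
    unfolding bnorm2_def K.B_def ainv by (simp add: bv_def)
  have "vlower M a f \<kappa> x p = (\<Sum>k\<in>UNIV. am \<kappa> x $ p $ k * vcomp f \<kappa> x k)" for p
    by (simp add: vlower_def am_def)
  then have "(\<Sum>k\<in>UNIV. vcomp f \<kappa> x k * bv \<kappa> x $ k) = K.fb"
    unfolding K.bs_lower[symmetric] K.fb_def by (simp add: mult.commute)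
  then show "pairing M b f \<kappa> x = K.fb"
    unfolding pairing_def by (simp add: bv_def)
  have h: "kropina_h M a b m c d \<epsilon> \<kappa> x i j = K.h i j" for i j
    unfolding kropina_h_def K.h_def by (simp add: bv_def am_def)
  show "kropina_connection M a b m c d f \<epsilon> \<kappa> x k i j = K.kcon k i j"
    unfolding kropina_connection_def Let_def K.kcon_def K.T_def chr h ainv ..
qed

lemma kropina_condition_iff:
  "kropina_condition M A a b m c d f \<longleftrightarrow> (\<forall>\<kappa>\<in>M. \<forall>x y i j. (x, y) \<in> tcone \<kappa> \<longrightarrow>
    kropina_algebra.condition (am \<kappa> x) (bv \<kappa> x) (da \<kappa> x) (db \<kappa> x) c m (eps M a \<kappa> x y * d)
      (vlower M a f \<kappa> x) i j)"
proof -
  have *: "(\<forall>(x, y)\<in>S. P x y) \<longleftrightarrow> (\<forall>x y. (x, y) \<in> S \<longrightarrow> P x y)"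
    for S and P :: "real^'n \<Rightarrow> real^'n \<Rightarrow> bool"
    by auto
  have "nabla M a b \<kappa> x i j = c * m * pairing M b f \<kappa> x * acomp M a \<kappa> x i j
       + (c + \<epsilon> * d * bnorm2 M a b \<kappa> x) * vlower M a f \<kappa> x i * bcomp M b \<kappa> x j
       - (c * m - \<epsilon> * d * bnorm2 M a b \<kappa> x) * bcomp M b \<kappa> x i * vlower M a f \<kappa> x j
       - \<epsilon> * d * pairing M b f \<kappa> x * bcomp M b \<kappa> x i * bcomp M b \<kappa> x j \<longleftrightarrow>
      kropina_algebra.condition (am \<kappa> x) (bv \<kappa> x) (da \<kappa> x) (db \<kappa> x) c m (\<epsilon> * d)
        (vlower M a f \<kappa> x) i j" if "\<kappa> \<in> M" "(x, y) \<in> tcone \<kappa>" for \<kappa> x y \<epsilon> i j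
    unfolding condition_eq[OF that(1) cone_img[OF that(2)]]
      kropina_algebra.condition_def[OF kropina_algebra[OF that(1) cone_img[OF that(2)]]]
    by (simp add: am_def bv_def)
  then show ?thesis
    unfolding kropina_condition_def Let_def * by blast
qed

section \<open>The vector field of a Berwald metric\<close>

definition wv :: "('m, 'n) chart \<Rightarrow> real^'n \<Rightarrow> ('n \<Rightarrow> 'n \<Rightarrow> 'n \<Rightarrow> real) \<Rightarrow> real^'n" where
  "wv \<kappa> x \<Gamma> = (\<chi> i. (lvec \<kappa> x \<Gamma> i \<bullet> bv \<kappa> x) / (bv \<kappa> x \<bullet> bv \<kappa> x))"

text \<open>\<open>wv\<close> is an explicit quotient, which makes its smoothness in x visible. It
  depends on D_i b_j alone, so the same \<open>wv\<close> occurs in the second equation for each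
  sign attained in the fibre.\<close>

lemma berwald_tensors:
  assumes \<Gamma>: "berwald_coefficients M A F \<Gamma>" and \<kappa>: "\<kappa> \<in> M" and xy: "(x, y) \<in> tcone \<kappa>"
  shows "lvec \<kappa> x (\<Gamma> \<kappa> x) i = wv \<kappa> x (\<Gamma> \<kappa> x) $ i *\<^sub>R bv \<kappa> x"
    and "(m + 1) * (c * eps M a \<kappa> x y) * qmat \<kappa> x (\<Gamma> \<kappa> x) i $ j $ k = 2 * wv \<kappa> x (\<Gamma> \<kappa> x) $ i *
      (m * (c * eps M a \<kappa> x y) * am \<kappa> x $ j $ k - d * bv \<kappa> x $ j * bv \<kappa> x $ k)"
proof -
  note x = cone_img[OF xy]
  interpret K: kropina_algebra "am \<kappa> x" "bv \<kappa> x" "da \<kappa> x" "db \<kappa> x"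
    by (rule kropina_algebra[OF \<kappa> x])
  let ?\<epsilon> = "eps M a \<kappa> x y" and ?W = "{y'. (x, y') \<in> sign_cone (eps M a \<kappa> x y) \<kappa>}"
  note \<epsilon> = eps_cases[OF \<kappa> xy]
  have W: "open ?W" "y \<in> ?W"
    using open_fibres(2)[OF open_sign_cone[OF \<kappa>]] \<epsilon>(2) by auto
  have q: "transpose (qmat \<kappa> x (\<Gamma> \<kappa> x) i) = qmat \<kappa> x (\<Gamma> \<kappa> x) i"
    by (simp add: qmat_def transpose_def vec_eq_iff K.Da_def K.da_sym[of i] algebra_simps)
  have e: "c * ?\<epsilon> \<noteq> 0" using c_nonzero \<epsilon>(1) by auto
  have zero: "2 * m * (c * ?\<epsilon> * (y' \<bullet> (am \<kappa> x *v y')) + d * (bv \<kappa> x \<bullet> y')\<^sup>2) * (lvec \<kappa> x (\<Gamma> \<kappa> x) i \<bullet> y') =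
        (m + 1) * (bv \<kappa> x \<bullet> y') * (c * ?\<epsilon> * (y' \<bullet> (qmat \<kappa> x (\<Gamma> \<kappa> x) i *v y')) +
          2 * d * (bv \<kappa> x \<bullet> y') * (lvec \<kappa> x (\<Gamma> \<kappa> x) i \<bullet> y'))" if "y' \<in> ?W" for y'
  proof -
    have y': "(x, y') \<in> sign_cone ?\<epsilon> \<kappa>" using that by simp
    show ?thesis
      using LL_parallel_iff[OF \<kappa> y' \<epsilon>(1)] LL_parallel[OF \<Gamma> \<kappa> sign_cone_cone[OF y']] by blast
  qed
  obtain w where w: "lvec \<kappa> x (\<Gamma> \<kappa> x) i = w *\<^sub>R bv \<kappa> x"
    "\<And>j k. (m + 1) * (c * ?\<epsilon>) * qmat \<kappa> x (\<Gamma> \<kappa> x) i $ j $ k =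
      2 * w * (m * (c * ?\<epsilon>) * am \<kappa> x $ j $ k - d * bv \<kappa> x $ j * bv \<kappa> x $ k)"
  proof (rule parallel_kropina_tensors[OF dim K.transpose_a K.inv bv_nonzero[OF \<kappa> x] q m_nonzero
        m_neq_minus_1 e W zero])
    fix w
    assume "lvec \<kappa> x (\<Gamma> \<kappa> x) i = w *\<^sub>R bv \<kappa> x"
      "\<And>j k. (m + 1) * (c * ?\<epsilon>) * qmat \<kappa> x (\<Gamma> \<kappa> x) i $ j $ k =
        2 * w * (m * (c * ?\<epsilon>) * am \<kappa> x $ j $ k - d * bv \<kappa> x $ j * bv \<kappa> x $ k)"
    then show thesis by (rule that)
  qed
  have "wv \<kappa> x (\<Gamma> \<kappa> x) $ i = w"
    using bv_nonzero[OF \<kappa> x] by (simp add: wv_def w(1))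
  then show "lvec \<kappa> x (\<Gamma> \<kappa> x) i = wv \<kappa> x (\<Gamma> \<kappa> x) $ i *\<^sub>R bv \<kappa> x"
    "(m + 1) * (c * ?\<epsilon>) * qmat \<kappa> x (\<Gamma> \<kappa> x) i $ j $ k = 2 * wv \<kappa> x (\<Gamma> \<kappa> x) $ i *
      (m * (c * ?\<epsilon>) * am \<kappa> x $ j $ k - d * bv \<kappa> x $ j * bv \<kappa> x $ k)"
    using w by simp_all
qed

text \<open>Identifies \<open>wv\<close> as the 1-form D \<beta> / \<beta>, which has a meaning
  independent of the chart.\<close>

lemma beta_gam:
  assumes \<Gamma>: "berwald_coefficients M A F \<Gamma>" and \<kappa>: "\<kappa> \<in> M" and x: "x \<in> chart_img \<kappa>"
  shows "dird (beta \<kappa>) (x, y) (u, - gam (\<Gamma> \<kappa> x) u y) = (wv \<kappa> x (\<Gamma> \<kappa> x) \<bullet> u) * (bv \<kappa> x \<bullet> y)"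
proof -
  obtain y0 where y0: "(x, y0) \<in> tcone \<kappa>" using cone_nonempty[OF \<kappa> x] .
  have "beta \<kappa> differentiable (at (x, y))"
    by (rule differentiableI[OF has_derivative_beta[OF \<kappa> x]])
  then have "dird (beta \<kappa>) (x, y) (u, - gam (\<Gamma> \<kappa> x) u y) = (\<Sum>i\<in>UNIV. u $ i * (lvec \<kappa> x (\<Gamma> \<kappa> x) i \<bullet> y))"
    by (subst dird_gam_expand) (simp_all only: dird_beta_gam[OF \<kappa> x])
  then show ?thesis
    unfolding berwald_tensors(1)[OF \<Gamma> \<kappa> y0]
    by (simp add: inner_vec_def[of "wv _ _ _"] sum_distrib_left mult_ac)
qed

text \<open>\<beta> and its derivative along a horizontal lift have the same values in both charts.
  A vector y of the cone is chosen in order to divide by \<beta> > 0.\<close>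

lemma wv_change:
  assumes \<Gamma>: "berwald_coefficients M A F \<Gamma>" and M: "\<kappa> \<in> M" "\<mu> \<in> M" and x: "x \<in> overlap \<kappa> \<mu>"
  shows "wv \<kappa> x (\<Gamma> \<kappa> x) \<bullet> u =
    wv \<mu> (transition \<kappa> \<mu> x) (\<Gamma> \<mu> (transition \<kappa> \<mu> x)) \<bullet> dird (transition \<kappa> \<mu>) x u"
proof -
  let ?X = "transition \<kappa> \<mu>"
  have img: "x \<in> chart_img \<kappa>" "?X x \<in> chart_img \<mu>"
    using x transition_overlap[OF M x] by auto
  obtain y where y: "(x, y) \<in> tcone \<kappa>" using cone_nonempty[OF M(1) img(1)] .
  have "bv \<kappa> x \<bullet> y > 0"
    using on_sign_cone(1)[OF M(1) eps_cases(2,1)[OF M(1) y]] by (simp add: beta_def)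
  moreover have "dird (beta \<kappa>) (x, y) (u, - gam (\<Gamma> \<kappa> x) u y) =
      dird (beta \<mu>) (?X x, dird ?X x y) (dird ?X x u, - gam (\<Gamma> \<mu> (?X x)) (dird ?X x u) (dird ?X x y))"
  proof (rule dird_pullback_parallel[OF open_overlap[OF M] smooth_transition[OF M] x])
    show "beta \<mu> differentiable (at (?X x, dird ?X x y))"
      by (rule differentiableI[OF has_derivative_beta[OF M(2) img(2)]])
    show "open (overlap \<kappa> \<mu> \<times> (UNIV :: (real^'n) set))"
      by (intro open_Times open_overlap[OF M]) simp
    show "beta \<kappa> (x, y) = beta \<mu> (?X x, dird ?X x y)"
      if "(x, y) \<in> overlap \<kappa> \<mu> \<times> UNIV" for x y
      using beta_change[OF M, of x y] that by (simp add: beta_def)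
  qed (use x berwald_transformation[OF \<Gamma> M x] in auto)
  ultimately show ?thesis
    unfolding beta_gam[OF \<Gamma> M(1) img(1)] beta_gam[OF \<Gamma> M(2) img(2)] beta_change[OF M x, of y, symmetric]
    by simp
qed

text \<open>The factor comes from D_i b_j = c (m + 1) f_i b_j; the inverse matrix raises the index
  of f_i.\<close>

definition fv :: "('m, 'n) chart \<Rightarrow> real^'n \<Rightarrow> ('n \<Rightarrow> 'n \<Rightarrow> 'n \<Rightarrow> real) \<Rightarrow> real^'n" where
  "fv \<kappa> x \<Gamma> = matrix_inv (am \<kappa> x) *v ((1 / (c * (m + 1))) *\<^sub>R wv \<kappa> x \<Gamma>)"

lemma am_fv: "\<kappa> \<in> M \<Longrightarrow> x \<in> chart_img \<kappa> \<Longrightarrow> am \<kappa> x *v fv \<kappa> x \<Gamma> = (1 / (c * (m + 1))) *\<^sub>R wv \<kappa> x \<Gamma>"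
  by (simp only: fv_def matrix_vector_mul_assoc matrix_inv_mult invertible_am matrix_vector_mul_lid)

text \<open>A vector is determined by its a-products with all v. Each v is the image of some u under
  the Jacobian, and for these products \<open>am_change\<close> and \<open>wv_change\<close>
  apply.\<close>

lemma fv_change:
  assumes \<Gamma>: "berwald_coefficients M A F \<Gamma>" and M: "\<kappa> \<in> M" "\<mu> \<in> M" and x: "x \<in> overlap \<kappa> \<mu>"
  shows "fv \<mu> (transition \<kappa> \<mu> x) (\<Gamma> \<mu> (transition \<kappa> \<mu> x)) = dird (transition \<kappa> \<mu>) x (fv \<kappa> x (\<Gamma> \<kappa> x))"
proof -
  let ?X = "transition \<kappa> \<mu>" and ?f = "fv \<kappa> x (\<Gamma> \<kappa> x)" and ?g = "fv \<mu> (transition \<kappa> \<mu> x) (\<Gamma> \<mu> (transition \<kappa> \<mu> x))"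
  have img: "x \<in> chart_img \<kappa>" "?X x \<in> chart_img \<mu>"
    using x transition_overlap[OF M x] by auto
  have "v \<bullet> (am \<mu> (?X x) *v dird ?X x ?f) = v \<bullet> (am \<mu> (?X x) *v ?g)" for v
  proof -
    obtain u where u: "v = dird ?X x u"
      using dird_transition_inverse(2)[OF M x] by metis
    show ?thesis
      unfolding am_fv[OF M(2) img(2)] unfolding u am_change[OF M x, symmetric] am_fv[OF M(1) img(1)]
      using wv_change[OF \<Gamma> M x, of u] by (simp add: inner_commute)
  qed
  then have "am \<mu> (?X x) *v dird ?X x ?f = am \<mu> (?X x) *v ?g"
    using vector_eq_ldot[of "am \<mu> (?X x) *v dird ?X x ?f" "am \<mu> (?X x) *v ?g"] by blast
  then have "matrix_inv (am \<mu> (?X x)) *v (am \<mu> (?X x) *v ?g) =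
      matrix_inv (am \<mu> (?X x)) *v (am \<mu> (?X x) *v dird ?X x ?f)"
    by simp
  then show ?thesis
    unfolding matrix_vector_mul_assoc matrix_inv_mult(2)[OF invertible_am[OF M(2) img(2)]]
      matrix_vector_mul_lid .
qed

lemma smooth_matrix_inv_am:
  assumes \<kappa>: "\<kappa> \<in> M"
  shows "smooth_on (chart_img \<kappa>) (\<lambda>x. matrix_inv (am \<kappa> x) $ i $ j)"
  by (rule smooth_on_matrix_inv[OF open_chart_img[OF \<kappa>]])
    (use smooth_acomp[OF \<kappa>] invertible_am[OF \<kappa>] in \<open>auto simp: am_def\<close>)

lemma smooth_fv:
  assumes \<Gamma>: "berwald_coefficients M A F \<Gamma>" and \<kappa>: "\<kappa> \<in> M"
  shows "smooth_on (chart_img \<kappa>) (\<lambda>x. fv \<kappa> x (\<Gamma> \<kappa> x))"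
proof -
  note img = open_chart_img[OF \<kappa>]
  note intros = smooth_on_mult[OF img] smooth_on_sum[OF img] smooth_on_diff[OF img] smooth_on_const
    smooth_bcomp[OF \<kappa>] berwald_smooth[OF \<Gamma> \<kappa>] smooth_on_dird
  have l: "smooth_on (chart_img \<kappa>) (\<lambda>x. lvec \<kappa> x (\<Gamma> \<kappa> x) i $ j)" for i j
    by (rule smooth_on_transfer[OF img, of "\<lambda>x. dird (\<lambda>x. bcomp M b \<kappa> x j) x (axis i 1) -
        (\<Sum>k\<in>UNIV. \<Gamma> \<kappa> x k i j * bcomp M b \<kappa> x k)"])
      (intro intros, simp add: lvec_def kropina_algebra.Db_def[OF kropina_algebra[OF \<kappa>]] partial_def bv_def)
  have w: "smooth_on (chart_img \<kappa>) (\<lambda>x. wv \<kappa> x (\<Gamma> \<kappa> x) $ i)" for i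
    unfolding wv_def vec_lambda_beta
  proof (rule smooth_on_divide[OF img])
    have "smooth_on (chart_img \<kappa>) (\<lambda>x. \<Sum>j\<in>UNIV. lvec \<kappa> x (\<Gamma> \<kappa> x) i $ j * bcomp M b \<kappa> x j)"
      by (intro intros l)
    then show "smooth_on (chart_img \<kappa>) (\<lambda>x. lvec \<kappa> x (\<Gamma> \<kappa> x) i \<bullet> bv \<kappa> x)"
      by (simp add: inner_vec_def bv_def)
    have "smooth_on (chart_img \<kappa>) (\<lambda>x. \<Sum>j\<in>UNIV. bcomp M b \<kappa> x j * bcomp M b \<kappa> x j)"
      by (intro intros)
    then show "smooth_on (chart_img \<kappa>) (\<lambda>x. bv \<kappa> x \<bullet> bv \<kappa> x)"
      by (simp add: inner_vec_def bv_def)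
  qed (use bv_nonzero[OF \<kappa>] in simp)
  show ?thesis
  proof (rule smooth_on_vec[OF img])
    fix i
    have "smooth_on (chart_img \<kappa>) (\<lambda>x. \<Sum>j\<in>UNIV. matrix_inv (am \<kappa> x) $ i $ j * (1 / (c * (m + 1)) * wv \<kappa> x (\<Gamma> \<kappa> x) $ j))"
      by (intro intros smooth_matrix_inv_am[OF \<kappa>] w)
    then show "smooth_on (chart_img \<kappa>) (\<lambda>x. fv \<kappa> x (\<Gamma> \<kappa> x) $ i)"
      by (simp add: fv_def matrix_vector_mult_def)
  qed
qed

text \<open>The value 0 at the other charts is the one prescribed by
  \<open>tangent_space\<close>.\<close>

definition berwald_field :: "(('m, 'n) chart \<Rightarrow> real^'n \<Rightarrow> 'n \<Rightarrow> 'n \<Rightarrow> 'n \<Rightarrow> real) \<Rightarrow> 'm \<Rightarrow> ('m, 'n) tvector" where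
  "berwald_field \<Gamma> p = (\<lambda>\<kappa>. if \<kappa> \<in> M \<and> p \<in> chart_dom \<kappa>
    then fv \<kappa> (chart_map \<kappa> p) (\<Gamma> \<kappa> (chart_map \<kappa> p)) else 0)"

lemma berwald_field_chart:
  assumes "\<kappa> \<in> M" "x \<in> chart_img \<kappa>"
  shows "berwald_field \<Gamma> (chart_inv \<kappa> x) \<kappa> = fv \<kappa> x (\<Gamma> \<kappa> x)"
  using assms chart_inv_mem[OF assms(2)] by (simp add: berwald_field_def chart_map_inv)

lemma smooth_berwald_field:
  assumes \<Gamma>: "berwald_coefficients M A F \<Gamma>"
  shows "smooth_vector_field M (berwald_field \<Gamma>)"
  unfolding smooth_vector_field_def tangent_space_def
proof (intro conjI allI ballI CollectI impI)
  show "berwald_field \<Gamma> p \<kappa> = 0" if "\<kappa> \<notin> M \<or> p \<notin> chart_dom \<kappa>" for p \<kappa>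
    using that by (auto simp: berwald_field_def)
  show "berwald_field \<Gamma> p \<mu> = dird (transition \<kappa> \<mu>) (chart_map \<kappa> p) (berwald_field \<Gamma> p \<kappa>)"
    if "\<kappa> \<in> M" "\<mu> \<in> M" "p \<in> chart_dom \<kappa> \<and> p \<in> chart_dom \<mu>" for p \<kappa> \<mu>
  proof -
    have x: "chart_map \<kappa> p \<in> overlap \<kappa> \<mu>"
      using that by blast
    have "transition \<kappa> \<mu> (chart_map \<kappa> p) = chart_map \<mu> p"
      using that chart_inv_map by (simp add: transition_def)
    then show ?thesis
      using fv_change[OF \<Gamma> that(1,2) x] that by (simp add: berwald_field_def)
  qed
  show "smooth_on (chart_img \<kappa>) (\<lambda>x. berwald_field \<Gamma> (chart_inv \<kappa> x) \<kappa>)" if "\<kappa> \<in> M" for \<kappa>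
    by (rule smooth_on_transfer[OF open_chart_img[OF that] smooth_fv[OF \<Gamma> that]])
      (rule berwald_field_chart[OF that])
qed

lemma vlower_berwald_field:
  assumes "\<kappa> \<in> M" "x \<in> chart_img \<kappa>"
  shows "c * (m + 1) * vlower M a (berwald_field \<Gamma>) \<kappa> x i = wv \<kappa> x (\<Gamma> \<kappa> x) $ i"
proof -
  have "vlower M a (berwald_field \<Gamma>) \<kappa> x i = (am \<kappa> x *v fv \<kappa> x (\<Gamma> \<kappa> x)) $ i"
    by (simp add: vlower_def vcomp_def berwald_field_chart[OF assms] matrix_vector_mult_def am_def)
  then show ?thesis
    using c_nonzero m_neq_minus_1 by (simp add: am_fv[OF assms] add_eq_0_iff)
qed

theorem berwald_imp_condition:
  assumes \<Gamma>: "berwald_coefficients M A F \<Gamma>"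
  shows "kropina_condition M A a b m c d (berwald_field \<Gamma>)"
  unfolding kropina_condition_iff
proof (intro ballI allI impI)
  fix \<kappa> x y i j
  assume \<kappa>: "\<kappa> \<in> M" and xy: "(x, y) \<in> tcone \<kappa>"
  note x = cone_img[OF xy]
  let ?f = "vlower M a (berwald_field \<Gamma>) \<kappa> x" and ?\<epsilon> = "eps M a \<kappa> x y"
  interpret K: kropina_algebra "am \<kappa> x" "bv \<kappa> x" "da \<kappa> x" "db \<kappa> x" c m "?\<epsilon> * d" ?f
    by (rule kropina_algebra[OF \<kappa> x])
  note \<epsilon> = eps_cases(1)[OF \<kappa> xy]
  note w = vlower_berwald_field[OF \<kappa> x, of \<Gamma>]
  have Da: "K.Da (\<Gamma> \<kappa> x) i j k = - 2 * ?f i * K.h j k" for i j k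
  proof -
    have "(m + 1) * (c * ?\<epsilon>) * K.Da (\<Gamma> \<kappa> x) i j k =
        2 * (c * (m + 1) * ?f i) * (m * (c * ?\<epsilon>) * am \<kappa> x $ j $ k - d * bv \<kappa> x $ j * bv \<kappa> x $ k)"
      using berwald_tensors(2)[OF \<Gamma> \<kappa> xy, of i j k] by (simp add: qmat_def w)
    \<comment> \<open>As \<epsilon> is its own inverse, factoring it out moves it from the term with
      a to the term with d.\<close>
    then have "((m + 1) * c) * (?\<epsilon> * (K.Da (\<Gamma> \<kappa> x) i j k -
        2 * ?f i * (m * c * am \<kappa> x $ j $ k - ?\<epsilon> * d * bv \<kappa> x $ j * bv \<kappa> x $ k))) = 0"
      using \<epsilon> by (auto simp: algebra_simps)
    then have "K.Da (\<Gamma> \<kappa> x) i j k =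
        2 * ?f i * (m * c * am \<kappa> x $ j $ k - ?\<epsilon> * d * bv \<kappa> x $ j * bv \<kappa> x $ k)"
      using \<epsilon> c_nonzero m_neq_minus_1 by (auto simp: add_eq_0_iff)
    then show ?thesis unfolding K.h_def by (simp add: algebra_simps)
  qed
  have "K.low (\<Gamma> \<kappa> x) p i j = K.low K.chr p i j + K.T p i j" for p i j
    using K.low_eq_iff[of "\<Gamma> \<kappa> x", OF berwald_symmetric[OF \<Gamma> \<kappa> x]] Da by blast
  moreover have "K.Db (\<Gamma> \<kappa> x) i j = c * (m + 1) * ?f i * bv \<kappa> x $ j"
  proof -
    have "K.Db (\<Gamma> \<kappa> x) i j = lvec \<kappa> x (\<Gamma> \<kappa> x) i $ j"
      by (simp add: lvec_def)
    also have "\<dots> = wv \<kappa> x (\<Gamma> \<kappa> x) $ i * bv \<kappa> x $ j"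
      using berwald_tensors(1)[OF \<Gamma> \<kappa> xy, of i] by simp
    finally show ?thesis by (simp add: w)
  qed
  ultimately show "K.condition i j"
    using K.condition_iff by blast
qed

section \<open>From the condition to the connection\<close>

lemma condition_imp_parallel:
  assumes f: "kropina_condition M A a b m c d f" and \<kappa>: "\<kappa> \<in> M" and xy: "(x, y) \<in> tcone \<kappa>"
    and y': "(x, y') \<in> sign_cone (eps M a \<kappa> x y) \<kappa>"
  shows "dird (LL \<kappa>) (x, y') (u, - gam (kropina_connection M a b m c d f (eps M a \<kappa> x y) \<kappa> x) u y') = 0"
proof -
  note x = cone_img[OF xy]
  let ?f = "vlower M a f \<kappa> x" and ?\<epsilon> = "eps M a \<kappa> x y"
  let ?G = "kropina_connection M a b m c d f ?\<epsilon> \<kappa> x"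
  interpret K: kropina_algebra "am \<kappa> x" "bv \<kappa> x" "da \<kappa> x" "db \<kappa> x" c m "?\<epsilon> * d" ?f
    by (rule kropina_algebra[OF \<kappa> x])
  note \<epsilon> = eps_cases(1)[OF \<kappa> xy]
  have G: "?G = K.kcon"
    by (simp add: fun_eq_iff condition_eq(4)[OF \<kappa> x])
  have "K.condition i j" for i j
    using f \<kappa> xy unfolding kropina_condition_iff by blast
  note K.kcon_parallel[OF this]
  then have l: "lvec \<kappa> x ?G i = (c * (m + 1) * ?f i) *\<^sub>R bv \<kappa> x"
    and q: "qmat \<kappa> x ?G i $ j $ k = - 2 * ?f i * (?\<epsilon> * d * bv \<kappa> x $ j * bv \<kappa> x $ k - c * m * am \<kappa> x $ j $ k)" for i j k
    unfolding G lvec_def qmat_def K.h_def vec_eq_iff by simp_all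
  have sq: "(bv \<kappa> x \<bullet> y')\<^sup>2 = (\<Sum>j\<in>UNIV. \<Sum>k\<in>UNIV. bv \<kappa> x $ j * bv \<kappa> x $ k * y' $ j * y' $ k)"
    by (simp add: inner_vec_def power2_eq_square sum_product mult_ac)
  have qy: "y' \<bullet> (qmat \<kappa> x ?G i *v y') = - 2 * ?f i * (?\<epsilon> * d * (bv \<kappa> x \<bullet> y')\<^sup>2 - c * m * (y' \<bullet> (am \<kappa> x *v y')))" for i
    unfolding inner_matrix_vector q sq
    by (simp add: sum_distrib_left sum_subtractf[symmetric] algebra_simps)
  \<comment> \<open>The \<epsilon> of P meets that of h, and both sides of the cubic identity become
    2 c m (m + 1) f_i \<beta> P.\<close>
  have "?\<epsilon> * ?\<epsilon> = 1" using \<epsilon> by auto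
  then have "dird (LL \<kappa>) (x, y') (axis i 1, - gam ?G (axis i 1) y') = 0" for i
    unfolding LL_parallel_iff[OF \<kappa> y' \<epsilon>] l qy inner_scaleR_left by algebra
  moreover have "LL \<kappa> differentiable (at (x, y'))"
    by (rule smooth_on_differentiable[OF smooth_LL[OF \<kappa>] sign_cone_cone[OF y']])
  ultimately show ?thesis
    using parallel_iff_axis by blast
qed

lemma kropina_connection_sym:
  assumes "\<kappa> \<in> M" "x \<in> chart_img \<kappa>"
  shows "kropina_connection M a b m c d f \<epsilon> \<kappa> x k i j = kropina_connection M a b m c d f \<epsilon> \<kappa> x k j i"
  unfolding condition_eq(4)[OF assms] by (rule kropina_algebra.kcon_sym[OF kropina_algebra[OF assms]])

text \<open>Uniqueness is applied on the vectors of the sign of y. If both signs occur over x, the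
  connections for the two signs are thereby equal.\<close>

theorem berwald_connection_eq:
  assumes f: "kropina_condition M A a b m c d f" and \<Gamma>: "berwald_coefficients M A F \<Gamma>"
    and \<kappa>: "\<kappa> \<in> M" and xy: "(x, y) \<in> tcone \<kappa>"
  shows "\<Gamma> \<kappa> x k i j = kropina_connection M a b m c d f (eps M a \<kappa> x y) \<kappa> x k i j"
proof (rule berwald_coefficients_unique[OF \<Gamma> \<kappa>, of "{y'. (x, y') \<in> sign_cone (eps M a \<kappa> x y) \<kappa>}"])
  show "open {y'. (x, y') \<in> sign_cone (eps M a \<kappa> x y) \<kappa>}"
    by (rule open_fibres(2)[OF open_sign_cone[OF \<kappa>]])
qed (use sign_cone_cone kropina_connection_sym[OF \<kappa> cone_img[OF xy]] condition_imp_parallel[OF f \<kappa> xy]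
    eps_cases(2)[OF \<kappa> xy] in blast)+

text \<open>\<open>nab\<close> does not contain the sign, so \<open>nab_bs\<close> for two different
  signs gives (\<epsilon>1 - \<epsilon>2) d |b|^4 f_i = 0.\<close>

lemma kropina_connection_consistent:
  assumes f: "kropina_condition M A a b m c d f" and s: "sign_consistent M A a b d"
    and \<kappa>: "\<kappa> \<in> M" and xy: "(x, y) \<in> tcone \<kappa>" and xz: "(x, z) \<in> tcone \<kappa>"
  shows "kropina_connection M a b m c d f (eps M a \<kappa> x y) \<kappa> x =
    kropina_connection M a b m c d f (eps M a \<kappa> x z) \<kappa> x"
proof (cases "eps M a \<kappa> x y = eps M a \<kappa> x z \<or> d = 0")
  case True
  then show ?thesis
    by (auto simp: fun_eq_iff condition_eq(4)[OF \<kappa> cone_img[OF xy]])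
next
  case False
  note x = cone_img[OF xy]
  let ?f = "vlower M a f \<kappa> x"
  interpret Y: kropina_algebra "am \<kappa> x" "bv \<kappa> x" "da \<kappa> x" "db \<kappa> x" c m "eps M a \<kappa> x y * d" ?f
    by (rule kropina_algebra[OF \<kappa> x])
  interpret Z: kropina_algebra "am \<kappa> x" "bv \<kappa> x" "da \<kappa> x" "db \<kappa> x" c m "eps M a \<kappa> x z * d" ?f
    by (rule kropina_algebra[OF \<kappa> x])
  have B: "Y.B \<noteq> 0"
    using s False \<kappa> xy xz unfolding sign_consistent_def condition_eq(2)[OF \<kappa> x, symmetric] by blast
  have cond: "Y.condition i j" "Z.condition i j" for i j
    using f \<kappa> xy xz unfolding kropina_condition_iff by blast+
  have "(c + eps M a \<kappa> x y * d * Y.B) * Y.B * ?f i = (c + eps M a \<kappa> x z * d * Y.B) * Y.B * ?f i" for i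
    by (rule trans[OF Y.nab_bs[OF cond(1), symmetric] Z.nab_bs[OF cond(2)]])
  then have "(eps M a \<kappa> x y - eps M a \<kappa> x z) * d * Y.B * Y.B * ?f i = 0" for i
    by (simp add: algebra_simps)
  \<comment> \<open>With f = 0 the tensor \<open>T\<close> vanishes, and both connections are the
    Levi-Civita connection of a.\<close>
  then have "?f i = 0" for i
    using False B by simp
  then show ?thesis
    by (simp add: fun_eq_iff condition_eq(4)[OF \<kappa> x] Y.kcon_def Z.kcon_def Y.T_def Z.T_def)
qed

theorem condition_imp_berwald:
  assumes f: "kropina_condition M A a b m c d f" and s: "sign_consistent M A a b d"
  shows "berwald_type M A F"
proof -
  \<comment> \<open>Coefficients may depend on x only, so some vector over x selects the sign; by
    \<open>kropina_connection_consistent\<close> any other vector gives the same connection.\<close>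
  define \<Gamma> where "\<Gamma> \<kappa> x = kropina_connection M a b m c d f (eps M a \<kappa> x (SOME y. (x, y) \<in> tcone \<kappa>)) \<kappa> x"
    for \<kappa> x
  have "nlc (LL \<kappa>) (x, y) k i = (\<Sum>j\<in>UNIV. \<Gamma> \<kappa> x k i j * y $ j)"
    if \<kappa>: "\<kappa> \<in> M" and xy: "(x, y) \<in> tcone \<kappa>" for \<kappa> x y k i
  proof -
    have "(x, SOME y. (x, y) \<in> tcone \<kappa>) \<in> tcone \<kappa>"
      using xy by (rule someI)
    then have \<Gamma>: "\<Gamma> \<kappa> x = kropina_connection M a b m c d f (eps M a \<kappa> x y) \<kappa> x"
      unfolding \<Gamma>_def by (rule kropina_connection_consistent[OF f s \<kappa> _ xy])
    show ?thesis
      unfolding \<Gamma>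
    proof (rule nlc_eq_of_parallel[OF \<kappa>, of "{y'. (x, y') \<in> sign_cone (eps M a \<kappa> x y) \<kappa>}"])
      show "open {y'. (x, y') \<in> sign_cone (eps M a \<kappa> x y) \<kappa>}"
        by (rule open_fibres(2)[OF open_sign_cone[OF \<kappa>]])
    qed (use sign_cone_cone kropina_connection_sym[OF \<kappa> cone_img[OF xy]] condition_imp_parallel[OF f \<kappa> xy]
        eps_cases(2)[OF \<kappa> xy] in blast)+
  qed
  then show ?thesis
    unfolding berwald_type_def berwald_coefficients_iff by blast
qed

section \<open>The norm of b and the closedness of f\<close>

lemma smooth_bnorm2:
  assumes \<kappa>: "\<kappa> \<in> M"
  shows "smooth_on (chart_img \<kappa>) (bnorm2 M a b \<kappa>)"
proof -
  note img = open_chart_img[OF \<kappa>]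
  have "smooth_on (chart_img \<kappa>) (\<lambda>x. \<Sum>i\<in>UNIV. \<Sum>j\<in>UNIV.
      matrix_inv (am \<kappa> x) $ i $ j * bcomp M b \<kappa> x i * bcomp M b \<kappa> x j)"
    by (intro smooth_on_sum[OF img] smooth_on_mult[OF img] smooth_matrix_inv_am[OF \<kappa>] smooth_bcomp[OF \<kappa>])
  then show ?thesis
    by (rule smooth_on_transfer[OF img]) (simp add: bnorm2_def ainv_def am_def)
qed

text \<open>Differentiating \<open>a\<^sub>p\<^sub>k b\<^sup>k = b\<^sub>p\<close> and contracting with \<open>b\<^sup>p\<close> avoids the derivative of the inverse
  matrix.\<close>

lemma dird_bnorm2:
  assumes f: "kropina_condition M A a b m c d f" and \<kappa>: "\<kappa> \<in> M" and xy: "(x, y) \<in> tcone \<kappa>"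
  shows "dird (bnorm2 M a b \<kappa>) x (axis i 1) =
    2 * (c + eps M a \<kappa> x y * d * bnorm2 M a b \<kappa> x) * bnorm2 M a b \<kappa> x * vlower M a f \<kappa> x i"
proof -
  note x = cone_img[OF xy] and img = open_chart_img[OF \<kappa>]
  let ?f = "vlower M a f \<kappa> x" and ?\<epsilon> = "eps M a \<kappa> x y"
  interpret K: kropina_algebra "am \<kappa> x" "bv \<kappa> x" "da \<kappa> x" "db \<kappa> x" c m "?\<epsilon> * d" ?f
    by (rule kropina_algebra[OF \<kappa> x])
  define bs where "bs p x = (\<Sum>l\<in>UNIV. matrix_inv (am \<kappa> x) $ p $ l * bcomp M b \<kappa> x l)" for p x
  have bsx: "bs p x = kropina_algebra.bs (am \<kappa> x) (bv \<kappa> x) p" if "x \<in> chart_img \<kappa>" for p x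
    unfolding bs_def kropina_algebra.bs_def[OF kropina_algebra[OF \<kappa> that]] by (simp add: bv_def)
  have da: "(\<lambda>x. acomp M a \<kappa> x p k) differentiable (at x)" for p k
    by (rule smooth_on_differentiable[OF smooth_acomp[OF \<kappa>] x])
  have db: "(\<lambda>x. bcomp M b \<kappa> x p) differentiable (at x)" for p
    by (rule smooth_on_differentiable[OF smooth_bcomp[OF \<kappa>] x])
  have "smooth_on (chart_img \<kappa>) (bs p)" for p
    unfolding bs_def[abs_def]
    by (intro smooth_on_sum[OF img] smooth_on_mult[OF img] smooth_matrix_inv_am[OF \<kappa>] smooth_bcomp[OF \<kappa>])
  note dbs = smooth_on_differentiable[OF this x]
  define Dbs where "Dbs k = dird (bs k) x (axis i 1)" for k
  have 1: "db \<kappa> x i p = (\<Sum>k\<in>UNIV. am \<kappa> x $ p $ k * Dbs k) + (\<Sum>k\<in>UNIV. da \<kappa> x i p k * K.bs k)" for p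
  proof -
    have "db \<kappa> x i p = dird (\<lambda>x. \<Sum>k\<in>UNIV. acomp M a \<kappa> x p k * bs k x) x (axis i 1)"
      unfolding partial_def
    proof (rule dird_cong_at[OF img x])
      fix x assume x: "x \<in> chart_img \<kappa>"
      show "bcomp M b \<kappa> x p = (\<Sum>k\<in>UNIV. acomp M a \<kappa> x p k * bs k x)"
        using kropina_algebra.lower_bs[OF kropina_algebra[OF \<kappa> x], of p "bv \<kappa> x"]
        by (simp add: bsx[OF x]) (simp add: am_def bv_def)
    qed
    also have "\<dots> = (\<Sum>k\<in>UNIV. acomp M a \<kappa> x p k * Dbs k + da \<kappa> x i p k * bs k x)"
      by (subst dird_sum) (auto simp: dird_mult da dbs Dbs_def partial_def intro!: differentiable_mult)
    finally show ?thesis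
      by (simp add: bsx[OF x] sum.distrib am_def)
  qed
  have "dird (bnorm2 M a b \<kappa>) x (axis i 1) = dird (\<lambda>x. \<Sum>p\<in>UNIV. bs p x * bcomp M b \<kappa> x p) x (axis i 1)"
  proof (rule dird_cong_at[OF img x])
    fix x assume x: "x \<in> chart_img \<kappa>"
    show "bnorm2 M a b \<kappa> x = (\<Sum>p\<in>UNIV. bs p x * bcomp M b \<kappa> x p)"
      unfolding condition_eq(2)[OF \<kappa> x] kropina_algebra.B_eq[OF kropina_algebra[OF \<kappa> x]]
      by (simp add: bsx[OF x] bv_def)
  qed
  also have "\<dots> = (\<Sum>p\<in>UNIV. bs p x * db \<kappa> x i p + Dbs p * bcomp M b \<kappa> x p)"
    by (subst dird_sum) (auto simp: dird_mult db dbs Dbs_def partial_def intro!: differentiable_mult)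
  also have "\<dots> = (\<Sum>p\<in>UNIV. K.bs p * db \<kappa> x i p) + (\<Sum>p\<in>UNIV. Dbs p * bv \<kappa> x $ p)"
    by (simp add: bsx[OF x] sum.distrib bv_def)
  also have "(\<Sum>p\<in>UNIV. Dbs p * bv \<kappa> x $ p) =
      (\<Sum>p\<in>UNIV. K.bs p * db \<kappa> x i p) - (\<Sum>p\<in>UNIV. \<Sum>k\<in>UNIV. K.bs p * K.bs k * da \<kappa> x i p k)"
    unfolding 1 K.bs_lower[symmetric] by (simp add: distrib_left sum.distrib sum_distrib_left mult_ac)
  \<comment> \<open>The terms with \<open>db\<close> occur twice and those with \<open>da\<close>
    once with a minus sign: twice the expression in \<open>nab_bs_eq\<close>.\<close>
  finally have "dird (bnorm2 M a b \<kappa>) x (axis i 1) = 2 * (\<Sum>p\<in>UNIV. K.bs p * K.nab i p)"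
    unfolding K.nab_bs_eq by simp
  moreover have "K.condition i j" for i j
    using f \<kappa> xy unfolding kropina_condition_iff by blast
  ultimately show ?thesis
    by (simp add: K.nab_bs condition_eq(2)[OF \<kappa> x])
qed

lemma vlower_eq:
  assumes "kropina_condition M A a b m c d f" "\<kappa> \<in> M" "(x, y) \<in> tcone \<kappa>"
    and "bnorm2 M a b \<kappa> x \<noteq> 0" "c + eps M a \<kappa> x y * d * bnorm2 M a b \<kappa> x \<noteq> 0"
  shows "vlower M a f \<kappa> x i = dird (bnorm2 M a b \<kappa>) x (axis i 1) *
    (1 / (2 * bnorm2 M a b \<kappa> x * (c + eps M a \<kappa> x y * d * bnorm2 M a b \<kappa> x)))"
  unfolding dird_bnorm2[OF assms(1-3)] using assms(4,5) by simp

theorem vlower_eq_partial_ln: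
  assumes "kropina_condition M A a b m c d f" and \<kappa>: "\<kappa> \<in> M" and xy: "(x, y) \<in> tcone \<kappa>"
    and B: "bnorm2 M a b \<kappa> x \<noteq> 0" "c + eps M a \<kappa> x y * d * bnorm2 M a b \<kappa> x \<noteq> 0"
  shows "vlower M a f \<kappa> x i = partial i (\<lambda>x. ln \<bar>bnorm2 M a b \<kappa> x\<bar>) x /
    (2 * (c + eps M a \<kappa> x y * d * bnorm2 M a b \<kappa> x))"
proof -
  let ?B = "bnorm2 M a b \<kappa>"
  \<comment> \<open>Squaring treats both signs of |b|^2 at once; at t = 0 the equation holds because
    \<open>ln 0\<close> is 0.\<close>
  have ln: "ln \<bar>t\<bar> = 1/2 * ln (t\<^sup>2)" for t :: real
    using ln_realpow[of "\<bar>t\<bar>" 2] by (cases "t = 0") simp_all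
  have d: "(?B has_derivative dird ?B x) (at x)"
    by (rule has_derivative_dird[OF smooth_on_differentiable[OF smooth_bnorm2[OF \<kappa>] cone_img[OF xy]]])
  have "((\<lambda>x. 1/2 * ln ((?B x)\<^sup>2)) has_derivative (\<lambda>v. dird ?B x v / ?B x)) (at x)"
  proof -
    have "((\<lambda>x. (?B x)\<^sup>2) has_derivative (\<lambda>v. 2 * ?B x * dird ?B x v)) (at x)"
      using has_derivative_power[OF d, of 2] by (simp add: mult_ac)
    then have "((\<lambda>x. ln ((?B x)\<^sup>2)) has_derivative (\<lambda>v. 2 * ?B x * dird ?B x v * inverse ((?B x)\<^sup>2))) (at x)"
      using B by (intro has_derivative_ln) auto
    from has_derivative_mult_right[OF this, of "1/2"]
    have "((\<lambda>x. 1/2 * ln ((?B x)\<^sup>2)) has_derivative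
        (\<lambda>v. 1/2 * (2 * ?B x * dird ?B x v * inverse ((?B x)\<^sup>2)))) (at x)" .
    moreover have "1/2 * (2 * ?B x * t * inverse ((?B x)\<^sup>2)) = t / ?B x" for t
      using B by (simp add: power2_eq_square field_simps)
    ultimately show ?thesis by simp
  qed
  then have "partial i (\<lambda>x. ln \<bar>?B x\<bar>) x = dird ?B x (axis i 1) / ?B x"
    unfolding ln partial_def by (rule dird_eqI)
  then show ?thesis
    unfolding vlower_eq[OF assms] using B by simp
qed

text \<open>Near x, f_i is the derivative of |b|^2 times a function g of |b|^2, so f is locally
  exact: its derivatives are g' times a symmetric product plus g times a second derivative.\<close>

theorem vlower_closed:
  assumes f: "kropina_condition M A a b m c d f" and \<kappa>: "\<kappa> \<in> M" and xy: "(x, y) \<in> tcone \<kappa>"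
    and B: "bnorm2 M a b \<kappa> x \<noteq> 0" "c + eps M a \<kappa> x y * d * bnorm2 M a b \<kappa> x \<noteq> 0"
  shows "partial i (\<lambda>x. vlower M a f \<kappa> x j) x = partial j (\<lambda>x. vlower M a f \<kappa> x i) x"
proof -
  let ?B = "bnorm2 M a b \<kappa>" and ?\<epsilon> = "eps M a \<kappa> x y"
  define g where "g t = 1 / (2 * t * (c + ?\<epsilon> * d * t))" for t
  note x = cone_img[OF xy] and img = open_chart_img[OF \<kappa>] and \<epsilon> = eps_cases[OF \<kappa> xy]
  note smooth = smooth_bnorm2[OF \<kappa>]
  \<comment> \<open>The formula for f has to hold around x with one g. Keeping y in the cone of the
    same sign fixes \<epsilon>, and the two conditions on |b|^2 are open.\<close>
  define U where "U = {x'. (x', y) \<in> sign_cone ?\<epsilon> \<kappa>} \<inter>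
    (chart_img \<kappa> \<inter> (\<lambda>x. ?B x * (c + ?\<epsilon> * d * ?B x)) -` (- {0}))"
  have U: "open U" "x \<in> U"
  proof -
    have "continuous_on (chart_img \<kappa>) (\<lambda>x. ?B x * (c + ?\<epsilon> * d * ?B x))"
      by (intro continuous_intros smooth_on_continuous_on[OF smooth])
    then have "open (chart_img \<kappa> \<inter> (\<lambda>x. ?B x * (c + ?\<epsilon> * d * ?B x)) -` (- {0}))"
      by (rule continuous_open_preimage[OF _ img]) auto
    then show "open U"
      unfolding U_def using open_fibres(1)[OF open_sign_cone[OF \<kappa>]] by blast
    show "x \<in> U"
      using \<epsilon>(2) x B by (simp add: U_def)
  qed
  have v: "vlower M a f \<kappa> x' j = dird ?B x' (axis j 1) * g (?B x')" if "x' \<in> U" for x' j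
  proof -
    have *: "(x', y) \<in> sign_cone ?\<epsilon> \<kappa>" "?B x' \<noteq> 0" "c + ?\<epsilon> * d * ?B x' \<noteq> 0"
      using that by (auto simp: U_def)
    have "eps M a \<kappa> x' y = ?\<epsilon>"
      by (rule sign_cone_eps[OF \<kappa> *(1) \<epsilon>(1)])
    then show ?thesis
      using vlower_eq[OF f \<kappa> sign_cone_cone[OF *(1)] *(2)] *(3) by (simp add: g_def)
  qed
  have dB: "?B differentiable (at x)" "(\<lambda>x. dird ?B x v) differentiable (at x)" for v
    using smooth_on_differentiable[OF _ x] smooth smooth_on_dird[OF smooth] by blast+
  have g: "g differentiable (at (?B x))"
    unfolding g_def[abs_def] using B
    by (intro differentiable_divide differentiable_mult differentiable_add differentiable_const
        differentiable_ident) auto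
  have gB: "((\<lambda>x. g (?B x)) has_derivative (\<lambda>v. dird g (?B x) (dird ?B x v))) (at x)"
    by (rule has_derivative_compose[OF has_derivative_dird[OF dB(1)] has_derivative_dird[OF g]])
  have lin: "dird g (?B x) t = t * dird g (?B x) 1" for t
    using linear_cmul[OF linear_dird[OF g], of t 1] by simp
  have "partial i (\<lambda>x. vlower M a f \<kappa> x j) x =
      dird ?B x (axis j 1) * (dird ?B x (axis i 1) * dird g (?B x) 1) +
      dird (\<lambda>x. dird ?B x (axis j 1)) x (axis i 1) * g (?B x)" for i j
  proof -
    have "partial i (\<lambda>x. vlower M a f \<kappa> x j) x = dird (\<lambda>x. dird ?B x (axis j 1) * g (?B x)) x (axis i 1)"
      unfolding partial_def by (rule dird_cong_at[OF U]) (rule v)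
    also have "\<dots> = dird ?B x (axis j 1) * dird (\<lambda>x. g (?B x)) x (axis i 1) +
        dird (\<lambda>x. dird ?B x (axis j 1)) x (axis i 1) * g (?B x)"
      by (rule dird_mult[OF dB(2) differentiableI[OF gB]])
    also have "dird (\<lambda>x. g (?B x)) x (axis i 1) = dird ?B x (axis i 1) * dird g (?B x) 1"
      unfolding dird_eqI[OF gB] by (rule lin)
    finally show ?thesis .
  qed
  then show ?thesis
    using dird_commute[OF img smooth x, of "axis j 1" "axis i 1"] by (simp add: mult_ac)
qed

end

text \<open>The equivalence is conditional because the converse relies on
  \<open>sign_consistent\<close>; its forward half is stated once more without that premise. The
  last part concerns every f that satisfies the condition, not just the field built from \<Gamma>.
  Existence of an affine connection is asserted so that the formula for all \<Gamma> is not
  vacuous.\<close>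

theorem proposition5p3p8:
  fixes M :: "('m::{t2_space,second_countable_topology}, 'n::finite) chart set"
    and A :: "('m \<times> ('m, 'n) tvector) set"
    and a :: "'m \<Rightarrow> ('m, 'n) tvector \<Rightarrow> ('m, 'n) tvector \<Rightarrow> real"
    and b F :: "'m \<Rightarrow> ('m, 'n) tvector \<Rightarrow> real"
    and \<sigma> m c d :: real
  assumes "smooth_atlas M"
    and "CARD('n) > 2"
    and "pseudo_riemannian_metric M a"
    and "smooth_one_form M b"
    and "conic_subbundle M A"
    and "finsler_metric M A F"
    and "generalized_kropina A a b F \<sigma> m c d"
    and "properly_finslerian M A F"
  shows "(sign_consistent M A a b d \<longrightarrow>
           (berwald_type M A F \<longleftrightarrow>
             (\<exists>f. smooth_vector_field M f \<and> kropina_condition M A a b m c d f))) \<and>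
         (berwald_type M A F \<longrightarrow>
           (\<exists>f. smooth_vector_field M f \<and> kropina_condition M A a b m c d f)) \<and>
         (\<forall>f. smooth_vector_field M f \<and> kropina_condition M A a b m c d f \<longrightarrow>
           (berwald_type M A F \<longrightarrow>
             (\<exists>\<Gamma>. affine_connection_of M A F \<Gamma>) \<and>
             (\<forall>\<Gamma>. affine_connection_of M A F \<Gamma> \<longrightarrow>
               (\<forall>\<kappa>\<in>M. \<forall>(x, y)\<in>chart_cone M A \<kappa>. \<forall>k i j.
                 \<Gamma> \<kappa> x k i j = kropina_connection M a b m c d f (eps M a \<kappa> x y) \<kappa> x k i j))) \<and>
           (\<forall>\<kappa>\<in>M. \<forall>(x, y)\<in>chart_cone M A \<kappa>.
             bnorm2 M a b \<kappa> x \<noteq> 0 \<and> c + eps M a \<kappa> x y * d * bnorm2 M a b \<kappa> x \<noteq> 0 \<longrightarrow>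
             (\<forall>i. vlower M a f \<kappa> x i =
                partial i (\<lambda>x. ln \<bar>bnorm2 M a b \<kappa> x\<bar>) x /
                (2 * (c + eps M a \<kappa> x y * d * bnorm2 M a b \<kappa> x))) \<and>
             (\<forall>i j. partial i (\<lambda>x. vlower M a f \<kappa> x j) x = partial j (\<lambda>x. vlower M a f \<kappa> x i) x)))"
proof -
  interpret kropina_manifold M A F a b \<sigma> m c d
    by unfold_locales (use assms in auto)
  have forward: "\<exists>f. smooth_vector_field M f \<and> kropina_condition M A a b m c d f"
    if "berwald_type M A F"
    using that smooth_berwald_field berwald_imp_condition unfolding berwald_type_def by blast
  have connection: "\<exists>\<Gamma>. affine_connection_of M A F \<Gamma>" if "berwald_type M A F"
    using that berwald_torsion_free unfolding berwald_type_def affine_connection_of_def by blast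
  have *: "(\<forall>(x, y)\<in>S. P x y) \<longleftrightarrow> (\<forall>x y. (x, y) \<in> S \<longrightarrow> P x y)"
    for S and P :: "real^'n \<Rightarrow> real^'n \<Rightarrow> bool"
    by auto
  show ?thesis
    unfolding *
    using forward connection condition_imp_berwald berwald_connection_eq vlower_eq_partial_ln vlower_closed
    unfolding affine_connection_of_def
    by (intro conjI allI impI ballI iffI) blast+
qed

end
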